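(* Let $d=1$, $2\le p\le\infty$, $1/p+1/q=1$, $h>0$, $N\in\mathbb Z_+$, and let $M$ be an integer with $|M|\ge2$ (a dilation factor), $m=|M|$. Let $$a_l=\frac1{l!\,2h}\int_{-h}^{h}t^l\,dt\quad(0\le l\le N),\qquad \widetilde\varphi=\sum_{l=0}^{N}\overline{a_l}(-1)^l\delta_0^{(l)},$$ where $\delta_0$ is the Dirac delta at the origin. Suppose: (i) $\varphi\in\mathcal L_p$ and there exists $B_\varphi>0$ such that $\sum_{k\in\mathbb Z}|\widehat\varphi(\xi+k)|^q<B_\varphi$ for all $\xi\in\mathbb R$; there exist $n\in\mathbb N$ and $\delta\in(0,1/2)$ such that $\widehat\varphi\,\widehat{\widetilde\varphi}$ is boundedly differentiable up to order $n$ on $\{|\xi|<\delta\}$, $\widehat\varphi$ is boundedly differentiable up to order $n$ on $\{|\xi+l|<\delta\}$ for all $l\in\mathbb Z\setminus\{0\}$; the function $\sum_{l\in\mathbb Z,\,l\neq0}|\widehat\varphi^{(n)}(\xi+l)|$ is bounded on $\{|\xi|<\delta\}$; $(1-\widehat\varphi\,\widehat{\widetilde\varphi})^{(\beta)}(0)=0$ for $\beta=0,\dots,n-1$; and the Strang-Fix condition of order $n$ holds for $\varphi$; (ii) $f\in W_1^{N+1}$ and $f^{(N+1)}\in\mathrm{Lip}\,\varepsilon$, $\varepsilon>0$. Then there is a constant $C$ not depending on $j$ such that for all $j\in\mathbb Z_+$ $$\Big\|f-m^{-j/2}\sum_{k\in\mathbb Z}\mathrm{Av}_h(f,-M^{-j}k)\,\varphi_{jk}\Big\|_p\le\begin{cases}C|M|^{-j(N+\frac1p)}&\text{if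 }n>N+\frac1p,\\ C|M|^{-jn}&\text{if }n\le N+\frac1p.\end{cases}$$
   Context: $\mathbb Z_+=\{0,1,2,\dots\}$; for $p=\infty$, $1/p=0$. $W_1^{N+1}$ is the Sobolev space of functions on $\mathbb R$ whose derivatives up to order $N+1$ are in $L_1(\mathbb R)$. $F\in\mathrm{Lip}\,\varepsilon$ means that $F$ satisfies the Hölder (Lipschitz) condition $|F(x)-F(y)|\le K|x-y|^\varepsilon$ for all $x,y\in\mathbb R$, with some constant $K$. The average near a point $y$ of the form $M^{-j}k$, $k\in\mathbb Z$ (the dependence on $j$ being implicit), is $$\mathrm{Av}_h(f,y)=\frac{m^j}{2h}\int_{-m^{-j}h}^{m^{-j}h}f(y+t)\,dt .$$ Fourier transform: $\widehat f(\xi)=\int_{\mathbb R}f(x)e^{-2\pi ix\xi}dx$, extended to tempered distributions as usual; thus $\widehat{\widetilde\varphi}(\xi)=\sum_{l=0}^N\overline{a_l}(-1)^l(2\pi i\xi)^l$. $\mathcal L_p$ is the space of $f\in L_p(\mathbb R)$ with $\big\|\sum_{k\in\mathbb Z}|f(\cdot+k)|\big\|_{L_p([-1/2,1/2])}<\infty$. $\varphi_{jk}(x)=m^{j/2}\varphi(M^jx+k)$. A function $\varphi\in L_1(\mathbb R)$ satisfies the Strang-Fix condition of order $n$ if $\widehat\varphi^{(\beta)}(k)=0$ for all $k\in\mathbb Z\setminus\{0\}$ and $\beta=0,\dots,n-1$. "Boundedly differentiable up to order $n$ on a set" means $n$ times differentiable there with all derivatives of order at most $n$ bounded there. *)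

theory Defs
  imports "HOL-Analysis.Analysis" "HOL-Probability.Essential_Supremum"
begin

(* Iterated derivative of a complex-valued function on the real line.  As vector_derivative is
   total, its values mean something only where the derivatives exist; the predicates below
   assert existence wherever it is not supplied elsewhere. *)
definition nderiv :: "nat \<Rightarrow> (real \<Rightarrow> complex) \<Rightarrow> real \<Rightarrow> complex" where
  "nderiv k = (\<lambda>F x. vector_derivative F (at x)) ^^ k"

(* meant for open S *)
definition boundedly_differentiable :: "nat \<Rightarrow> (real \<Rightarrow> complex) \<Rightarrow> real set \<Rightarrow> bool" where
  "boundedly_differentiable n F S \<longleftrightarrow>
     (\<forall>k<n. \<forall>x\<in>S. nderiv k F differentiable (at x)) \<and>
     (\<forall>k\<le>n. bounded (nderiv k F ` S))"

(* meant for a > 0 *)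
definition enn_powr :: "ennreal \<Rightarrow> real \<Rightarrow> ennreal" where
  "enn_powr x a = (if x = \<infinity> then \<infinity> else ennreal (enn2real x powr a))"

(* The norm of L_p(M), 1 \<le> p \<le> \<infinity>, taken of the modulus of the function. *)
definition lp_norm :: "'a measure \<Rightarrow> ennreal \<Rightarrow> ('a \<Rightarrow> ennreal) \<Rightarrow> ennreal" where
  "lp_norm M p g =
     (if p = \<infinity> then esssup M g
      else enn_powr (\<integral>\<^sup>+x. enn_powr (g x) (enn2real p) \<partial>M) (1 / enn2real p))"

definition lp_space :: "ennreal \<Rightarrow> (real \<Rightarrow> complex) set" where
  "lp_space p =
     {f \<in> borel_measurable lebesgue. lp_norm lebesgue p (\<lambda>x. ennreal (cmod (f x))) < \<infinity>}"

(* The space written with a calligraphic L_p. *)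
definition periodized_lp_space :: "ennreal \<Rightarrow> (real \<Rightarrow> complex) set" where
  "periodized_lp_space p =
     {f \<in> lp_space p.
        lp_norm (restrict_space lebesgue {-1/2..1/2}) p
          (\<lambda>x. \<Sum>\<^sub>\<infinity>k::int. ennreal (cmod (f (x + of_int k)))) < \<infinity>}"

definition fourier :: "(real \<Rightarrow> complex) \<Rightarrow> real \<Rightarrow> complex" where
  "fourier f \<xi> = (LINT x|lebesgue. f x * exp (- (2 * pi * \<i> * x * \<xi>)))"

definition smooth :: "(real \<Rightarrow> complex) \<Rightarrow> bool" where
  "smooth \<psi> \<longleftrightarrow> (\<forall>k x. nderiv k \<psi> differentiable (at x))"

definition test_function :: "(real \<Rightarrow> complex) \<Rightarrow> bool" where
  "test_function \<psi> \<longleftrightarrow> smooth \<psi> \<and> (\<exists>R. \<forall>x. \<bar>x\<bar> > R \<longrightarrow> \<psi> x = 0)"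

definition locally_integrable :: "(real \<Rightarrow> complex) \<Rightarrow> bool" where
  "locally_integrable f \<longleftrightarrow> (\<forall>R. set_integrable lebesgue {-R..R} f)"

definition weak_deriv :: "nat \<Rightarrow> (real \<Rightarrow> complex) \<Rightarrow> (real \<Rightarrow> complex) \<Rightarrow> bool" where
  "weak_deriv k f g \<longleftrightarrow>
     locally_integrable f \<and> locally_integrable g \<and>
     (\<forall>\<psi>. test_function \<psi> \<longrightarrow>
        (LINT x|lebesgue. f x * nderiv k \<psi> x) = (- 1) ^ k * (LINT x|lebesgue. g x * \<psi> x))"

(* The Sobolev space W_1^r on the real line. *)
definition sobolev_1 :: "nat \<Rightarrow> (real \<Rightarrow> complex) set" where
  "sobolev_1 r =
     {f. integrable lebesgue f \<and> (\<forall>k\<le>r. \<exists>g. integrable lebesgue g \<and> weak_deriv k f g)}"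

definition lip :: "real \<Rightarrow> (real \<Rightarrow> complex) set" where
  "lip \<epsilon> = {F. \<exists>K. \<forall>x y. cmod (F x - F y) \<le> K * \<bar>x - y\<bar> powr \<epsilon>}"

(* A compactly supported distribution is represented by its bilinear pairing with smooth
   functions, and its Fourier transform is the function obtained by pairing it with
   x \<mapsto> exp (-2 pi i x \<xi>). *)
type_synonym distribution = "(real \<Rightarrow> complex) \<Rightarrow> complex"

definition delta0_deriv :: "nat \<Rightarrow> distribution" where
  "delta0_deriv l \<psi> = (- 1) ^ l * nderiv l \<psi> 0"

definition fourier_distr :: "distribution \<Rightarrow> real \<Rightarrow> complex" where
  "fourier_distr T \<xi> = T (\<lambda>x. exp (- (2 * pi * \<i> * x * \<xi>)))"

definition av_coeff :: "real \<Rightarrow> nat \<Rightarrow> complex" where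
  "av_coeff h l = of_real (1 / (fact l * (2 * h)) * (LINT t:{-h..h}|lebesgue. t ^ l))"

definition phi_tilde :: "real \<Rightarrow> nat \<Rightarrow> distribution" where
  "phi_tilde h N \<psi> = (\<Sum>l\<le>N. cnj (av_coeff h l) * (- 1) ^ l * delta0_deriv l \<psi>)"

lemma nderiv_exp_linear:
  "nderiv k (\<lambda>x. exp (c * of_real x)) = (\<lambda>x. c ^ k * exp (c * of_real x))"
proof (induction k)
  case 0
  then show ?case by (simp add: nderiv_def)
next
  case (Suc k)
  have "((\<lambda>x. c ^ k * exp (c * of_real x)) has_vector_derivative c ^ Suc k * exp (c * of_real x)) (at x)"
    for x :: real
  proof -
    have "((\<lambda>z. c ^ k * exp (c * z)) has_field_derivative c ^ Suc k * exp (c * of_real x))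
            (at (of_real x))"
      by (auto intro!: derivative_eq_intros)
    then show ?thesis
      by (rule has_vector_derivative_real_field)
  qed
  then have "vector_derivative (\<lambda>x. c ^ k * exp (c * of_real x)) (at x)
      = c ^ Suc k * exp (c * of_real x)" for x :: real
    by (rule vector_derivative_at)
  moreover have "nderiv (Suc k) F = (\<lambda>x. vector_derivative (nderiv k F) (at x))" for F
    by (simp add: nderiv_def)
  ultimately show ?case by (simp only: Suc)
qed

lemma fourier_phi_tilde:
  "fourier_distr (phi_tilde h N) \<xi>
     = (\<Sum>l\<le>N. cnj (av_coeff h l) * (- 1) ^ l * (2 * pi * \<i> * \<xi>) ^ l)"
proof -
  define c where "c = - (2 * pi * \<i> * \<xi>)"
  have e: "(\<lambda>x::real. exp (- (2 * pi * \<i> * x * \<xi>))) = (\<lambda>x. exp (c * of_real x))"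
    by (simp add: c_def algebra_simps)
  have "delta0_deriv l (\<lambda>x. exp (c * of_real x)) = (2 * pi * \<i> * \<xi>) ^ l" for l
    unfolding delta0_deriv_def nderiv_exp_linear
    by (simp add: c_def power_mult_distrib [symmetric] del: power_mult_distrib)
  then show ?thesis
    unfolding fourier_distr_def phi_tilde_def e by simp
qed

(* The derivatives occurring here are not claimed to exist: this has to be known separately. *)
definition strang_fix :: "nat \<Rightarrow> (real \<Rightarrow> complex) \<Rightarrow> bool" where
  "strang_fix n \<phi> \<longleftrightarrow>
     integrable lebesgue \<phi> \<and>
     (\<forall>k::int. k \<noteq> 0 \<longrightarrow> (\<forall>\<beta><n. nderiv \<beta> (fourier \<phi>) (of_int k) = 0))"

definition dilated_shift :: "int \<Rightarrow> (real \<Rightarrow> complex) \<Rightarrow> nat \<Rightarrow> int \<Rightarrow> real \<Rightarrow> complex" where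
  "dilated_shift M \<phi> j k x =
     of_real (real_of_int \<bar>M\<bar> powr (j / 2)) * \<phi> (of_int M ^ j * x + of_int k)"

definition average :: "int \<Rightarrow> nat \<Rightarrow> real \<Rightarrow> (real \<Rightarrow> complex) \<Rightarrow> real \<Rightarrow> complex" where
  "average M j h f y =
     of_real (real_of_int \<bar>M\<bar> ^ j / (2 * h)) *
     (LINT t:{- (h / real_of_int \<bar>M\<bar> ^ j)..h / real_of_int \<bar>M\<bar> ^ j}|lebesgue. f (y + t))"

definition expansion_term ::
  "int \<Rightarrow> real \<Rightarrow> (real \<Rightarrow> complex) \<Rightarrow> (real \<Rightarrow> complex) \<Rightarrow> nat \<Rightarrow> int \<Rightarrow> real \<Rightarrow> complex" where
  "expansion_term M h \<phi> f j k x =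
     average M j h f (- (of_int k / of_int M ^ j)) * dilated_shift M \<phi> j k x"

end

theory Submission
  imports Defs "HOL-Probability.Probability"
begin

text \<open>
  Write \<open>\<mu> = M ^ j\<close>, \<open>a = |\<mu>|\<close> and rescale: \<open>g y = f (y / \<mu>)\<close> has the transform
  \<open>G \<xi> = a * FT f (\<mu> * \<xi>)\<close>, and the error at \<open>x\<close> is the error of \<open>g\<close> at scale one, taken at \<open>\<mu> * x\<close>.
  For frequencies below \<open>\<delta>\<close> the average is replaced by the differential operator given by
  \<open>phi_tilde\<close>; by Poisson summation the error then has a symbol of size \<open>|\<xi>| ^ n\<close>, because of the
  Strang-Fix conditions and the flatness of \<open>1 - FT \<phi> * P\<close> at \<open>0\<close>, where \<open>P\<close> is the transform of
  \<open>phi_tilde\<close>. This part and the high frequencies of \<open>g\<close> are bounded in \<open>L_2\<close> by Bessel's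
  inequality and in \<open>L_\<infinity>\<close> trivially, hence in \<open>L_p\<close> since \<open>p \<ge> 2\<close>; no Hausdorff-Young inequality is
  used. All remaining coefficients are Fourier coefficients of a function of size \<open>a ^ (- N) / (1 + \<xi>\<^sup>2)\<close>,
  hence \<open>O (a ^ (- N))\<close> in \<open>l_2\<close>, and the shifts of \<open>\<phi>\<close> turn this into an \<open>L_p\<close> bound. The smoothness of \<open>f\<close>
  enters through \<open>|\<xi>| ^ (N + 1) * |FT f \<xi>|\<close> being bounded and square integrable, the latter because an
  integrable Hoelder function is bounded. The factor \<open>a powr (- 1 / p)\<close> comes from undoing the rescaling.
\<close>

section \<open>Fourier transform on the line\<close>

text \<open>Absolute summability of the translates of \<open>FT \<phi>\<close> is derived only for
  \<open>|\<xi>| < \<delta>\<close>, so Poisson summation is confined to these frequencies. What it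
  does not reach must be estimated through the coefficients of the shifts of \<phi>. Two leftovers
  of different origin meet there: at low frequencies the Taylor remainder of the average supplies a
  factor \<open>|\<xi>| ^ (N + 1)\<close>, at high ones the average supplies an additional
  \<open>1 / |\<xi>|\<close>. Against
  \<open>|G \<xi>| * |\<xi>| ^ (N + 1) \<le> D * a powr (- N)\<close>, where one power of a is lost
  to the prefactor of G, both yield an integrable majorant of order \<open>a powr (- N)\<close>. The
  two cases of the rate reflect the size of \<open>E\<close>: with \<open>r = min n N\<close> its
  supremum is of order \<open>a powr (- r)\<close> and its squared L_2 norm of order
  \<open>a powr (\<sigma> - 2 * r)\<close>, where \<sigma> is 1 for n \<le> N and 0 otherwise.
  Interpolating and undoing the scaling gives \<open>a powr (\<sigma> - r * p - 1)\<close> for the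
  p-th power, that is, the rate n or N + 1/p.\<close>

definition ee :: "real \<Rightarrow> complex" where "ee t = cis (2 * pi * t)"

lemma ee_0 [simp]: "ee 0 = 1"
  by (simp add: ee_def)

lemma norm_ee [simp]: "cmod (ee t) = 1"
  by (simp add: ee_def)

lemma ee_nonzero [simp]: "ee t \<noteq> 0"
  by (simp add: ee_def)

lemma ee_add: "ee (a + b) = ee a * ee b"
  by (simp add: ee_def cis_mult ring_distribs)

lemma cnj_ee: "cnj (ee t) = ee (- t)"
  by (simp add: ee_def cis_cnj)

lemma ee_int [simp]: "ee (of_int k) = 1"
  by (simp add: ee_def cis_multiple_2pi)

lemma ee_add_int: "ee (t + of_int k) = ee t"
  by (simp add: ee_add)

lemma continuous_on_ee [continuous_intros]:
  "continuous_on S f \<Longrightarrow> continuous_on S (\<lambda>x. ee (f x))"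
  unfolding ee_def by (intro continuous_intros)

lemma measurable_ee [measurable]: "ee \<in> borel_measurable borel"
  by (intro borel_measurable_continuous_onI continuous_intros)

lemma ee_eq_exp: "ee t = exp (2 * of_real pi * \<i> * of_real t)"
  by (simp add: ee_def cis_conv_exp mult_ac)

lemma ee_eq_iexp: "ee t = iexp (2 * pi * t)"
  by (simp add: ee_eq_exp mult_ac)

lemma integrable_mult_ee:
  fixes u :: "real \<Rightarrow> complex"
  assumes "integrable M u" and [measurable]: "g \<in> borel_measurable M"
  shows "integrable M (\<lambda>x. u x * ee (g x))"
proof (rule Bochner_Integration.integrable_bound[OF assms(1)])
  have [measurable]: "u \<in> borel_measurable M" using assms(1) by auto
  show "(\<lambda>x. u x * ee (g x)) \<in> borel_measurable M" by measurable
qed (simp add: norm_mult)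

definition FT :: "(real \<Rightarrow> complex) \<Rightarrow> real \<Rightarrow> complex" where
  "FT u \<xi> = (LINT x|lborel. u x * ee (- (x * \<xi>)))"

lemma FT_measurable [measurable]:
  assumes [measurable]: "u \<in> borel_measurable borel"
  shows "FT u \<in> borel_measurable borel"
  unfolding FT_def[abs_def] by measurable

lemma norm_FT_le:
  assumes "integrable lborel u"
  shows "cmod (FT u \<xi>) \<le> (LINT x|lborel. cmod (u x))"
proof -
  have "cmod (FT u \<xi>) \<le> (LINT x|lborel. cmod (u x * ee (- (x * \<xi>))))"
    unfolding FT_def by (rule integral_norm_bound)
  then show ?thesis by (simp add: norm_mult)
qed

text \<open>The positive and the negative part of v have equal transforms, hence equal masses; after
  normalisation they are densities of two distributions with the same characteristic function, and
  \<open>Levy_uniqueness\<close> identifies them.\<close>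

lemma real_zero_of_integrals_iexp:
  fixes v :: "real \<Rightarrow> real"
  assumes v: "integrable lborel v"
    and z: "\<And>t. (CLINT x|lborel. of_real (v x) * iexp (t * x)) = 0"
  shows "AE x in lborel. v x = 0"
proof -
  have [measurable]: "v \<in> borel_measurable borel" using v by auto
  define P where "P x = max 0 (v x)" for x
  define Q where "Q x = max 0 (- v x)" for x
  have [measurable]: "P \<in> borel_measurable borel" "Q \<in> borel_measurable borel"
    by (simp_all add: P_def[abs_def] Q_def[abs_def])
  have P: "integrable lborel P" and Q: "integrable lborel Q"
    unfolding P_def[abs_def] Q_def[abs_def] using v by auto
  have PQ: "v x = P x - Q x" "0 \<le> P x" "0 \<le> Q x" for x
    by (auto simp: P_def Q_def)
  have ii: "integrable lborel (\<lambda>x. of_real (R x) * iexp (t * x))" if "integrable lborel R" for R :: "real \<Rightarrow> real" and t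
  proof (rule Bochner_Integration.integrable_bound[OF that])
    have [measurable]: "R \<in> borel_measurable borel" using that by auto
    show "(\<lambda>x. of_real (R x) * iexp (t * x)) \<in> borel_measurable lborel" by measurable
  qed (simp add: norm_mult)
  have eq: "(CLINT x|lborel. of_real (P x) * iexp (t * x)) = (CLINT x|lborel. of_real (Q x) * iexp (t * x))" for t
  proof -
    have "0 = (CLINT x|lborel. of_real (P x) * iexp (t * x) - of_real (Q x) * iexp (t * x))"
      using z[of t] by (simp add: PQ(1) ring_distribs)
    also have "\<dots> = (CLINT x|lborel. of_real (P x) * iexp (t * x)) - (CLINT x|lborel. of_real (Q x) * iexp (t * x))"
      by (intro Bochner_Integration.integral_diff ii P Q)
    finally show ?thesis by simp
  qed
  define c where "c = (LINT x|lborel. P x)"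
  \<comment> \<open>Frequency 0 shows that both parts have the same mass c. The case c = 0 is
    separate because nothing can be normalised there.\<close>
  have "of_real (LINT x|lborel. P x) = (of_real (LINT x|lborel. Q x) :: complex)"
    using eq[of 0] by simp
  then have c: "c = (LINT x|lborel. Q x)" by (simp add: c_def)
  have "c \<ge> 0" unfolding c_def by (intro integral_nonneg_AE) (auto simp: PQ)
  show ?thesis
  proof (cases "c = 0")
    case True
    have "AE x in lborel. P x = 0" "AE x in lborel. Q x = 0"
      using True c integral_nonneg_eq_0_iff_AE[OF P] integral_nonneg_eq_0_iff_AE[OF Q]
      by (auto simp: c_def PQ)
    then show ?thesis by eventually_elim (simp add: PQ(1))
  next
    case False
    with \<open>c \<ge> 0\<close> have "c > 0" by simp
    define D where "D R = density lborel (\<lambda>x. ennreal (R x / c))" for R :: "real \<Rightarrow> real"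
    have rd: "real_distribution (D R)"
      if [measurable]: "R \<in> borel_measurable borel" and "integrable lborel R" "\<And>x. 0 \<le> R x" "(LINT x|lborel. R x) = c" for R
    proof -
      have "emeasure (D R) (space (D R)) = (\<integral>\<^sup>+x. ennreal (R x / c) \<partial>lborel)"
        by (simp add: D_def emeasure_density)
      also have "\<dots> = ennreal (LINT x|lborel. R x / c)"
        using that \<open>c > 0\<close> by (intro nn_integral_eq_integral) auto
      also have "\<dots> = 1" using that \<open>c > 0\<close> by simp
      finally have "prob_space (D R)" by (rule prob_spaceI)
      then show ?thesis
        by (auto simp: real_distribution_def real_distribution_axioms_def D_def)
    qed
    have ch: "char (D R) t = (CLINT x|lborel. of_real (R x) * iexp (t * x)) / c"
      if [measurable]: "R \<in> borel_measurable borel" and "\<And>x. 0 \<le> R x" for R t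
    proof -
      have "char (D R) t = (CLINT x|lborel. (R x / c) *\<^sub>R iexp (t * x))"
        unfolding char_def D_def using that \<open>c > 0\<close> by (subst integral_density) auto
      also have "\<dots> = (CLINT x|lborel. (of_real (R x) * iexp (t * x)) / c)"
        by (simp add: scaleR_conv_of_real)
      finally show ?thesis by simp
    qed
    have "D P = D Q"
      using P Q PQ c c_def by (intro Levy_uniqueness rd ext) (auto simp only: ch eq \<open>P \<in> borel_measurable borel\<close> \<open>Q \<in> borel_measurable borel\<close>)
    then have "AE x in lborel. ennreal (P x / c) = ennreal (Q x / c)"
      unfolding D_def by (subst (asm) sigma_finite_measure.density_unique_iff[OF sigma_finite_lborel]) auto
    then show ?thesis
      by eventually_elim (use PQ \<open>c > 0\<close> in auto)
  qed
qed

text \<open>The transform of \<open>cnj u\<close> is the conjugate of that of u at the opposite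
  frequency, so it vanishes as well. The real and imaginary parts are combinations of u and
  \<open>cnj u\<close>, which reduces the claim to real functions.\<close>

lemma FT_unique:
  assumes u: "integrable lborel u" and z: "\<And>\<xi>. FT u \<xi> = 0"
  shows "AE x in lborel. u x = 0"
proof -
  have i: "integrable lborel (\<lambda>x. u x * ee (x * s))" for s
    using integrable_mult_ee[OF u, of "\<lambda>x. x * s"] by simp
  have z': "(LINT x|lborel. u x * ee (x * s)) = 0" for s
    using z[of "- s"] by (simp add: FT_def)
  have zc: "(LINT x|lborel. cnj (u x) * ee (x * s)) = 0" for s
  proof -
    have "(LINT x|lborel. cnj (u x) * ee (x * s)) = (LINT x|lborel. cnj (u x * ee (x * (- s))))"
      by (simp add: cnj_ee)
    also have "\<dots> = 0" unfolding Bochner_Integration.integral_cnj z' by simp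
    finally show ?thesis .
  qed
  have ic: "integrable lborel (\<lambda>x. cnj (u x) * ee (x * s))" for s
    using integrable_mult_ee[of lborel "\<lambda>x. cnj (u x)" "\<lambda>x. x * s"] u by simp
  have e: "iexp (t * x) = ee (x * (t / (2 * pi)))" for t x
    by (simp add: ee_eq_iexp mult_ac)
  have "AE x in lborel. Re (u x) = 0"
  proof (rule real_zero_of_integrals_iexp)
    show "integrable lborel (\<lambda>x. Re (u x))" using u by simp
    fix t
    let ?s = "t / (2 * pi)"
    have "(CLINT x|lborel. of_real (Re (u x)) * iexp (t * x))
        = (CLINT x|lborel. (u x * ee (x * ?s) + cnj (u x) * ee (x * ?s)) / 2)"
      unfolding e by (intro Bochner_Integration.integral_cong refl) (simp add: complex_eq_iff field_simps)
    also have "\<dots> = 0" using i[of ?s] ic[of ?s] z'[of ?s] zc[of ?s] by simp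
    finally show "(CLINT x|lborel. of_real (Re (u x)) * iexp (t * x)) = 0" .
  qed
  moreover have "AE x in lborel. Im (u x) = 0"
  proof (rule real_zero_of_integrals_iexp)
    show "integrable lborel (\<lambda>x. Im (u x))" using u by simp
    fix t
    let ?s = "t / (2 * pi)"
    have "(CLINT x|lborel. of_real (Im (u x)) * iexp (t * x))
        = (CLINT x|lborel. (u x * ee (x * ?s) - cnj (u x) * ee (x * ?s)) / (2 * \<i>))"
    proof (intro Bochner_Integration.integral_cong refl)
      fix x
      have "complex_of_real (Im (u x)) = (u x - cnj (u x)) / (2 * \<i>)"
        by (simp add: complex_eq_iff Re_divide Im_divide)
      then show "of_real (Im (u x)) * iexp (t * x) = (u x * ee (x * ?s) - cnj (u x) * ee (x * ?s)) / (2 * \<i>)"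
        unfolding e left_diff_distrib[symmetric] by (simp only: times_divide_eq_left)
    qed
    also have "\<dots> = 0" using i[of ?s] ic[of ?s] z'[of ?s] zc[of ?s] by simp
    finally show "(CLINT x|lborel. of_real (Im (u x)) * iexp (t * x)) = 0" .
  qed
  ultimately show ?thesis by eventually_elim (simp add: complex_eq_iff)
qed

section \<open>Gaussian kernels, the inversion formula and Bessel's inequality on the line\<close>

lemma gaussian_integral_ee:
  assumes "a > 0"
  shows "integrable lborel (\<lambda>x. exp (- pi * (a * x)\<^sup>2))"
    and "(LINT x|lborel. of_real (exp (- pi * (a * x)\<^sup>2)) * ee (x * t)) = of_real (exp (- pi * (t / a)\<^sup>2) / a)"
proof -
  \<comment> \<open>This scaling turns the exponent \<open>x\<^sup>2 / 2\<close> of the normal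
    density into \<open>pi * (a * x)\<^sup>2\<close>, so its characteristic function can be
    quoted.\<close>
  define c where "c = sqrt (2 * pi) * a"
  have c: "c > 0" using assms by (simp add: c_def)
  have d: "std_normal_density (0 + c * x) = exp (- pi * (a * x)\<^sup>2) / sqrt (2 * pi)" for x
    by (simp add: std_normal_density_def c_def power_mult_distrib field_simps)
  have "integrable lborel (\<lambda>x. std_normal_density (0 + c * x))"
    using c by (intro lborel_integrable_real_affine) auto
  then have "integrable lborel (\<lambda>x. exp (- pi * (a * x)\<^sup>2) / sqrt (2 * pi) * sqrt (2 * pi))"
    unfolding d by (rule integrable_mult_left)
  then show "integrable lborel (\<lambda>x. exp (- pi * (a * x)\<^sup>2))" by simp
  let ?s = "2 * pi * t / c"
  have s2: "- (?s\<^sup>2) / 2 = - pi * (t / a)\<^sup>2"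
    using assms by (simp add: c_def power_divide power_mult_distrib field_simps power2_eq_square)
  have "of_real (exp (- (?s\<^sup>2) / 2)) = char std_normal_distribution ?s"
    by (simp add: char_std_normal_distribution)
  also have "\<dots> = (CLINT x|lborel. std_normal_density x *\<^sub>R iexp (?s * x))"
    unfolding char_def by (subst integral_density) auto
  also have "\<dots> = \<bar>c\<bar> *\<^sub>R (CLINT x|lborel. std_normal_density (0 + c * x) *\<^sub>R iexp (?s * (0 + c * x)))"
    using c by (subst lborel_integral_real_affine[where c = c and t = 0]) auto
  also have "\<dots> = c *\<^sub>R (CLINT x|lborel. (of_real (exp (- pi * (a * x)\<^sup>2)) * ee (x * t)) / of_real (sqrt (2 * pi)))"
    unfolding d using c by (intro arg_cong2[where f = scaleR] Bochner_Integration.integral_cong) (auto simp: ee_eq_iexp scaleR_conv_of_real field_simps)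
  also have "\<dots> = of_real a * (LINT x|lborel. of_real (exp (- pi * (a * x)\<^sup>2)) * ee (x * t))"
    by (simp add: c_def scaleR_conv_of_real)
  finally show "(LINT x|lborel. of_real (exp (- pi * (a * x)\<^sup>2)) * ee (x * t)) = of_real (exp (- pi * (t / a)\<^sup>2) / a)"
    unfolding s2 using assms by (simp add: field_simps)
qed

lemma measurable_cnj [measurable]: "cnj \<in> borel_measurable borel"
  by (intro borel_measurable_continuous_onI continuous_intros)

text \<open>The factor \<open>ee\<close> is unimodular, so joint integrability follows from that of
  u and v separately. Inversion, Bessel's inequality and the averages all interchange integrals in
  this form.\<close>

lemma Fubini_ee:
  fixes u v :: "real \<Rightarrow> complex" and g :: "real \<Rightarrow> real \<Rightarrow> real"
  assumes u: "integrable lborel u" and v: "integrable lborel v"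
    and [measurable]: "(\<lambda>(x, y). g x y) \<in> borel_measurable (borel \<Otimes>\<^sub>M borel)"
  shows "(LINT x|lborel. u x * (LINT y|lborel. v y * ee (g x y)))
       = (LINT y|lborel. v y * (LINT x|lborel. u x * ee (g x y)))"
proof -
  have [measurable]: "u \<in> borel_measurable borel" "v \<in> borel_measurable borel"
    using u v by auto
  let ?F = "\<lambda>(x, y). u x * v y * ee (g x y)"
  have iy: "integrable lborel (\<lambda>y. v y * ee (g x y))" for x
    by (rule integrable_mult_ee[OF v]) measurable
  have "integrable (lborel \<Otimes>\<^sub>M lborel) ?F"
  proof (rule lborel_pair.Fubini_integrable)
    show "?F \<in> borel_measurable (lborel \<Otimes>\<^sub>M lborel)" by measurable
    show "integrable lborel (\<lambda>x. LINT y|lborel. norm (?F (x, y)))"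
      using u by (simp add: norm_mult)
    show "AE x in lborel. integrable lborel (\<lambda>y. ?F (x, y))"
      using integrable_mult_right[OF iy] by (simp add: mult.assoc)
  qed
  then have "(LINT y|lborel. LINT x|lborel. u x * v y * ee (g x y)) = (LINT x|lborel. LINT y|lborel. u x * v y * ee (g x y))"
    by (rule lborel_pair.Fubini_integral)
  moreover have "(LINT y|lborel. u x * v y * ee (g x y)) = u x * (LINT y|lborel. v y * ee (g x y))" for x
    by (subst integral_mult_right_zero[symmetric]) (simp add: mult.assoc)
  moreover have "(LINT x|lborel. u x * v y * ee (g x y)) = v y * (LINT x|lborel. u x * ee (g x y))" for y
    by (subst integral_mult_right_zero[symmetric]) (simp add: mult_ac)
  ultimately show ?thesis by simp
qed

text \<open>Testing against the modulated Gaussians \<open>\<gamma> x * ee (- (x * \<eta>))\<close>, for which inversion is explicit,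
  reduces the inversion formula to the uniqueness theorem.\<close>

theorem FT_inversion:
  assumes u: "integrable lborel u" and Fu: "integrable lborel (FT u)"
  shows "AE x in lborel. u x = (LINT \<xi>|lborel. FT u \<xi> * ee (x * \<xi>))"
proof -
  have [measurable]: "u \<in> borel_measurable borel" using u by auto
  define v where "v x = (LINT \<xi>|lborel. FT u \<xi> * ee (x * \<xi>))" for x
  have [measurable]: "v \<in> borel_measurable borel" unfolding v_def[abs_def] by measurable
  \<comment> \<open>With parameter 1 the Gaussian is its own transform. It makes the product with v,
    which is only known to be bounded, integrable; and as it has no zeros it can be cancelled at the
    end.\<close>
  define \<gamma> where "\<gamma> x = complex_of_real (exp (- pi * (1 * x)\<^sup>2))" for x
  have \<gamma>: "integrable lborel \<gamma>"
    unfolding \<gamma>_def by (rule integrable_of_real[OF gaussian_integral_ee(1)]) simp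
  have [measurable]: "\<gamma> \<in> borel_measurable borel" using \<gamma> by auto
  have \<gamma>1: "(LINT x|lborel. \<gamma> x * ee (x * t)) = \<gamma> t" for t
    using gaussian_integral_ee(2)[of 1 t] by (simp add: \<gamma>_def)
  have "cmod (v x) \<le> (LINT \<xi>|lborel. cmod (FT u \<xi> * ee (x * \<xi>)))" for x
    unfolding v_def by (rule integral_norm_bound)
  then have vb: "cmod (v x) \<le> (LINT \<xi>|lborel. cmod (FT u \<xi>))" for x by (simp add: norm_mult)
  have i1: "integrable lborel (\<lambda>x. v x * \<gamma> x)"
  proof (rule Bochner_Integration.integrable_bound)
    show "integrable lborel (\<lambda>x. (LINT \<xi>|lborel. cmod (FT u \<xi>)) * \<gamma> x)" using \<gamma> by simp
    have "0 \<le> (LINT \<xi>|lborel. cmod (FT u \<xi>))" by (rule integral_nonneg_AE) simp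
    then show "AE x in lborel. cmod (v x * \<gamma> x) \<le> cmod (complex_of_real (LINT \<xi>|lborel. cmod (FT u \<xi>)) * \<gamma> x)"
      using vb by (intro AE_I2) (auto simp: norm_mult intro!: mult_right_mono)
  qed measurable
  have i2: "integrable lborel (\<lambda>x. u x * \<gamma> x)"
    by (rule Bochner_Integration.integrable_bound[OF u]) (auto simp: norm_mult \<gamma>_def intro!: mult_left_le)
  have "FT (\<lambda>x. v x * \<gamma> x - u x * \<gamma> x) \<eta> = 0" for \<eta>
  proof -
    have "FT (\<lambda>x. v x * \<gamma> x) \<eta> = (LINT x|lborel. (\<gamma> x * ee (- (x * \<eta>))) * (LINT \<xi>|lborel. FT u \<xi> * ee (x * \<xi>)))"
      unfolding FT_def by (intro Bochner_Integration.integral_cong) (simp_all add: v_def FT_def mult_ac)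
    also have "\<dots> = (LINT \<xi>|lborel. FT u \<xi> * (LINT x|lborel. (\<gamma> x * ee (- (x * \<eta>))) * ee (x * \<xi>)))"
      by (intro Fubini_ee Fu integrable_mult_ee \<gamma>) measurable
    also have "\<dots> = (LINT \<xi>|lborel. FT u \<xi> * (LINT x|lborel. \<gamma> x * ee (x * (\<xi> - \<eta>))))"
      by (simp add: mult.assoc ee_add[symmetric] right_diff_distrib)
    also have "\<dots> = (LINT \<xi>|lborel. \<gamma> (0 + \<xi> - \<eta>) * (LINT y|lborel. u y * ee (- (y * \<xi>))))"
      unfolding \<gamma>1 by (simp add: FT_def mult_ac)
    also have "\<dots> = (LINT y|lborel. u y * (LINT \<xi>|lborel. \<gamma> (0 + \<xi> - \<eta>) * ee (- (y * \<xi>))))"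
      using lborel_integrable_real_affine[OF \<gamma>, of 1 "- \<eta>"]
      by (intro Fubini_ee u) (auto simp: algebra_simps)
    also have "\<dots> = (LINT y|lborel. u y * (LINT \<xi>|lborel. \<gamma> \<xi> * ee (- (y * (\<eta> + \<xi>)))))"
      by (subst lborel_integral_real_affine[where c = 1 and t = \<eta>]) auto
    also have "\<dots> = (LINT y|lborel. u y * \<gamma> y * ee (- (y * \<eta>)))"
    proof (intro Bochner_Integration.integral_cong refl)
      fix y
      have "(LINT \<xi>|lborel. \<gamma> \<xi> * ee (- (y * (\<eta> + \<xi>)))) = ee (- (y * \<eta>)) * (LINT \<xi>|lborel. \<gamma> \<xi> * ee (\<xi> * (- y)))"
        unfolding integral_mult_right_zero[symmetric] distrib_left minus_add_distrib ee_add
        by (simp add: mult_ac)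
      also have "\<dots> = ee (- (y * \<eta>)) * \<gamma> y" unfolding \<gamma>1 by (simp add: \<gamma>_def)
      finally show "u y * (LINT \<xi>|lborel. \<gamma> \<xi> * ee (- (y * (\<eta> + \<xi>)))) = u y * \<gamma> y * ee (- (y * \<eta>))"
        by simp
    qed
    also have "\<dots> = FT (\<lambda>x. u x * \<gamma> x) \<eta>" by (simp add: FT_def)
    finally have "FT (\<lambda>x. v x * \<gamma> x) \<eta> = FT (\<lambda>x. u x * \<gamma> x) \<eta>" .
    then show ?thesis
      unfolding FT_def left_diff_distrib
      by (subst Bochner_Integration.integral_diff) (auto intro!: integrable_mult_ee i1 i2)
  qed
  then have "AE x in lborel. v x * \<gamma> x - u x * \<gamma> x = 0"
    using i1 i2 by (intro FT_unique) auto
  then show ?thesis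
    by eventually_elim (simp add: \<gamma>_def v_def)
qed

text \<open>The squared transform of an integrable u need not be integrable, so Fubini is applied
  with a Gaussian weight. The weighted integral becomes the double integral of
  \<open>u x * cnj (u y) * \<kappa> (y - x)\<close> with a probability density \<kappa>, which the
  squared norm of u bounds; Fatou's lemma removes the weight.\<close>

theorem FT_Bessel:
  assumes u: "integrable lborel u"
  shows "(\<integral>\<^sup>+\<xi>. ennreal ((cmod (FT u \<xi>))\<^sup>2) \<partial>lborel) \<le> (\<integral>\<^sup>+x. ennreal ((cmod (u x))\<^sup>2) \<partial>lborel)"
proof -
  have [measurable]: "u \<in> borel_measurable borel" using u by auto
  define L where "L = (LINT x|lborel. cmod (u x))"
  have FL: "cmod (FT u \<xi>) \<le> L" for \<xi> using norm_FT_le[OF u] by (simp add: L_def)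
  have "L \<ge> 0" unfolding L_def by (rule integral_nonneg_AE) simp
  have step: "(\<integral>\<^sup>+\<xi>. ennreal (exp (- pi * (a * \<xi>)\<^sup>2) * (cmod (FT u \<xi>))\<^sup>2) \<partial>lborel) \<le> (\<integral>\<^sup>+x. ennreal ((cmod (u x))\<^sup>2) \<partial>lborel)"
    if "a > 0" for a
  proof -
    define g where "g \<xi> = exp (- pi * (a * \<xi>)\<^sup>2)" for \<xi> :: real
    define \<kappa> where "\<kappa> t = exp (- pi * (t / a)\<^sup>2) / a" for t :: real
    have g: "integrable lborel g" unfolding g_def by (rule gaussian_integral_ee(1)[OF that])
    have [measurable]: "g \<in> borel_measurable borel" "\<kappa> \<in> borel_measurable borel"
      by (simp_all add: g_def[abs_def] \<kappa>_def[abs_def])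
    have g0: "0 \<le> g \<xi>" and k0: "0 \<le> \<kappa> \<xi>" for \<xi> using that by (auto simp: g_def \<kappa>_def)
    have g\<kappa>: "(LINT \<xi>|lborel. of_real (g \<xi>) * ee (\<xi> * t)) = of_real (\<kappa> t)" for t
      using gaussian_integral_ee(2)[OF that, of t] by (simp add: g_def \<kappa>_def)
    have \<kappa>i: "integrable lborel \<kappa>"
      using gaussian_integral_ee(1)[of "1/a"] that unfolding \<kappa>_def by simp
    have "complex_of_real (LINT t|lborel. \<kappa> t) = (LINT t|lborel. of_real (exp (- pi * ((1/a) * t)\<^sup>2)) * ee (t * 0) / of_real a)"
      by (simp add: \<kappa>_def)
    also have "\<dots> = 1"
      using gaussian_integral_ee(2)[of "1/a" 0] that by (subst integral_divide_zero) simp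
    finally have \<kappa>1: "(LINT t|lborel. \<kappa> t) = 1" by (simp only: of_real_eq_1_iff)
    have \<kappa>n: "(\<integral>\<^sup>+t. ennreal (\<kappa> t) \<partial>lborel) = 1"
      using nn_integral_eq_integral[OF \<kappa>i] k0 \<kappa>1 by simp
    have \<kappa>n1: "(\<integral>\<^sup>+y. ennreal (\<kappa> (y - x)) \<partial>lborel) = 1" for x
      using nn_integral_real_affine[of "\<lambda>t. ennreal (\<kappa> t)" 1 "- x"] \<kappa>n by simp
    have \<kappa>n2: "(\<integral>\<^sup>+x. ennreal (\<kappa> (y - x)) \<partial>lborel) = 1" for y
      using nn_integral_real_affine[of "\<lambda>t. ennreal (\<kappa> t)" "-1" y] \<kappa>n by simp
    have gF: "integrable lborel (\<lambda>\<xi>. of_real (g \<xi>) * cnj (FT u \<xi>))"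
    proof (rule Bochner_Integration.integrable_bound)
      show "integrable lborel (\<lambda>\<xi>. L * g \<xi>)" using g by simp
      show "AE \<xi> in lborel. cmod (of_real (g \<xi>) * cnj (FT u \<xi>)) \<le> norm (L * g \<xi>)"
        using FL g0 \<open>L \<ge> 0\<close> by (intro AE_I2) (auto simp: norm_mult mult.commute[of L] intro!: mult_left_mono)
    qed measurable
    have gi: "integrable lborel (\<lambda>\<xi>. g \<xi> * (cmod (FT u \<xi>))\<^sup>2)"
    proof (rule Bochner_Integration.integrable_bound)
      show "integrable lborel (\<lambda>\<xi>. L\<^sup>2 * g \<xi>)" using g by simp
      show "AE \<xi> in lborel. norm (g \<xi> * (cmod (FT u \<xi>))\<^sup>2) \<le> norm (L\<^sup>2 * g \<xi>)"
        using FL g0 \<open>L \<ge> 0\<close> by (intro AE_I2) (auto simp: norm_mult mult.commute[of "L\<^sup>2"] intro!: mult_left_mono power_mono)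
    qed measurable
    have inner: "(LINT \<xi>|lborel. of_real (g \<xi>) * cnj (FT u \<xi>) * ee (- (x * \<xi>))) = (LINT y|lborel. cnj (u y) * of_real (\<kappa> (y - x)))" for x
    proof -
      have "(LINT \<xi>|lborel. of_real (g \<xi>) * cnj (FT u \<xi>) * ee (- (x * \<xi>)))
          = (LINT \<xi>|lborel. (of_real (g \<xi>) * ee (- (x * \<xi>))) * (LINT y|lborel. cnj (u y) * ee (y * \<xi>)))"
        unfolding FT_def by (intro Bochner_Integration.integral_cong refl)
          (simp add: Bochner_Integration.integral_cnj[symmetric] cnj_ee mult_ac del: Bochner_Integration.integral_cnj)
      also have "\<dots> = (LINT y|lborel. cnj (u y) * (LINT \<xi>|lborel. (of_real (g \<xi>) * ee (- (x * \<xi>))) * ee (y * \<xi>)))"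
        using u g by (intro Fubini_ee integrable_mult_ee) auto
      also have "\<dots> = (LINT y|lborel. cnj (u y) * (LINT \<xi>|lborel. of_real (g \<xi>) * ee (\<xi> * (y - x))))"
        unfolding diff_conv_add_uminus distrib_left mult_minus_right ee_add by (simp add: mult_ac)
      finally show ?thesis unfolding g\<kappa> .
    qed
    have "of_real (LINT \<xi>|lborel. g \<xi> * (cmod (FT u \<xi>))\<^sup>2) = (LINT \<xi>|lborel. (of_real (g \<xi>) * cnj (FT u \<xi>)) * (LINT x|lborel. u x * ee (- (x * \<xi>))))"
      unfolding integral_complex_of_real[symmetric] FT_def[symmetric]
      by (intro Bochner_Integration.integral_cong refl) (simp only: of_real_mult complex_norm_square mult_ac)
    also have "\<dots> = (LINT x|lborel. u x * (LINT \<xi>|lborel. (of_real (g \<xi>) * cnj (FT u \<xi>)) * ee (- (x * \<xi>))))"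
      by (intro Fubini_ee gF u) measurable
    also have "\<dots> = (LINT x|lborel. u x * (LINT y|lborel. cnj (u y) * of_real (\<kappa> (y - x))))"
      unfolding inner ..
    finally have eq: "of_real (LINT \<xi>|lborel. g \<xi> * (cmod (FT u \<xi>))\<^sup>2) = (LINT x|lborel. u x * (LINT y|lborel. cnj (u y) * of_real (\<kappa> (y - x))))" .
    have nonneg: "0 \<le> (LINT \<xi>|lborel. g \<xi> * (cmod (FT u \<xi>))\<^sup>2)"
      using g0 by (intro integral_nonneg_AE) auto
    \<comment> \<open>The integral of a non-integrable function is 0 by convention, so no
      integrability has to be checked.\<close>
    have nb: "ennreal (norm (integral\<^sup>L lborel f)) \<le> (\<integral>\<^sup>+x. ennreal (norm (f x)) \<partial>lborel)" for f :: "real \<Rightarrow> complex"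
    proof (cases "integrable lborel f")
      case True then show ?thesis by (rule integral_norm_bound_ennreal)
    qed (simp add: not_integrable_integral_eq)
    have "(\<integral>\<^sup>+\<xi>. ennreal (g \<xi> * (cmod (FT u \<xi>))\<^sup>2) \<partial>lborel) = ennreal (LINT \<xi>|lborel. g \<xi> * (cmod (FT u \<xi>))\<^sup>2)"
      using g0 by (intro nn_integral_eq_integral gi) auto
    also have "\<dots> = ennreal (cmod (of_real (LINT \<xi>|lborel. g \<xi> * (cmod (FT u \<xi>))\<^sup>2)))"
      using nonneg by simp
    also have "\<dots> \<le> (\<integral>\<^sup>+x. ennreal (cmod (u x * (LINT y|lborel. cnj (u y) * of_real (\<kappa> (y - x))))) \<partial>lborel)"
      unfolding eq by (rule nb)
    also have "\<dots> \<le> (\<integral>\<^sup>+x. (\<integral>\<^sup>+y. ennreal ((cmod (u x))\<^sup>2 / 2) * ennreal (\<kappa> (y - x)) + ennreal ((cmod (u y))\<^sup>2 / 2) * ennreal (\<kappa> (y - x)) \<partial>lborel) \<partial>lborel)"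
    proof (rule nn_integral_mono)
      fix x
      have "ennreal (cmod (u x * (LINT y|lborel. cnj (u y) * of_real (\<kappa> (y - x)))))
          \<le> ennreal (cmod (u x)) * (\<integral>\<^sup>+y. ennreal (cmod (cnj (u y) * of_real (\<kappa> (y - x)))) \<partial>lborel)"
        by (subst norm_mult, subst ennreal_mult) (auto intro!: mult_left_mono nb)
      also have "\<dots> = (\<integral>\<^sup>+y. ennreal (cmod (u x)) * ennreal (cmod (cnj (u y) * of_real (\<kappa> (y - x)))) \<partial>lborel)"
        by (rule nn_integral_cmult[symmetric]) measurable
      also have "\<dots> \<le> (\<integral>\<^sup>+y. ennreal ((cmod (u x))\<^sup>2 / 2) * ennreal (\<kappa> (y - x)) + ennreal ((cmod (u y))\<^sup>2 / 2) * ennreal (\<kappa> (y - x)) \<partial>lborel)"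
      proof (rule nn_integral_mono)
        fix y
        \<comment> \<open>Splitting the product into two squares leaves each term with one variable
          that occurs only in \<kappa>, where it integrates to 1.\<close>
        have "cmod (u x) * cmod (u y) \<le> (cmod (u x))\<^sup>2 / 2 + (cmod (u y))\<^sup>2 / 2"
          using sum_squares_bound[of "cmod (u x)" "cmod (u y)"] by simp
        from mult_right_mono[OF this k0[of "y - x"]]
        show "ennreal (cmod (u x)) * ennreal (cmod (cnj (u y) * of_real (\<kappa> (y - x))))
          \<le> ennreal ((cmod (u x))\<^sup>2 / 2) * ennreal (\<kappa> (y - x)) + ennreal ((cmod (u y))\<^sup>2 / 2) * ennreal (\<kappa> (y - x))"
          using k0 by (simp add: norm_mult ennreal_mult[symmetric] ennreal_plus[symmetric] ring_distribs mult.assoc del: ennreal_plus) 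
      qed
      finally show "ennreal (cmod (u x * (LINT y|lborel. cnj (u y) * of_real (\<kappa> (y - x)))))
          \<le> (\<integral>\<^sup>+y. ennreal ((cmod (u x))\<^sup>2 / 2) * ennreal (\<kappa> (y - x)) + ennreal ((cmod (u y))\<^sup>2 / 2) * ennreal (\<kappa> (y - x)) \<partial>lborel)" .
    qed
    also have "\<dots> = (\<integral>\<^sup>+x. ennreal ((cmod (u x))\<^sup>2 / 2) * (\<integral>\<^sup>+y. ennreal (\<kappa> (y - x)) \<partial>lborel) + (\<integral>\<^sup>+y. ennreal ((cmod (u y))\<^sup>2 / 2) * ennreal (\<kappa> (y - x)) \<partial>lborel) \<partial>lborel)"
      by (subst nn_integral_add) (simp_all add: nn_integral_cmult)
    also have "\<dots> = (\<integral>\<^sup>+x. ennreal ((cmod (u x))\<^sup>2 / 2) \<partial>lborel) + (\<integral>\<^sup>+x. \<integral>\<^sup>+y. ennreal ((cmod (u y))\<^sup>2 / 2) * ennreal (\<kappa> (y - x)) \<partial>lborel \<partial>lborel)"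
      unfolding \<kappa>n1 by (subst nn_integral_add) simp_all
    also have "(\<integral>\<^sup>+x. \<integral>\<^sup>+y. ennreal ((cmod (u y))\<^sup>2 / 2) * ennreal (\<kappa> (y - x)) \<partial>lborel \<partial>lborel)
        = (\<integral>\<^sup>+y. \<integral>\<^sup>+x. ennreal ((cmod (u y))\<^sup>2 / 2) * ennreal (\<kappa> (y - x)) \<partial>lborel \<partial>lborel)"
      by (rule lborel_pair.Fubini') measurable
    also have "\<dots> = (\<integral>\<^sup>+y. ennreal ((cmod (u y))\<^sup>2 / 2) \<partial>lborel)"
      by (simp add: nn_integral_cmult \<kappa>n2)
    also have "(\<integral>\<^sup>+x. ennreal ((cmod (u x))\<^sup>2 / 2) \<partial>lborel) + \<dots> = (\<integral>\<^sup>+x. ennreal ((cmod (u x))\<^sup>2) \<partial>lborel)"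
      by (subst nn_integral_add[symmetric]) (simp_all flip: ennreal_plus)
    finally show ?thesis by (simp add: g_def)
  qed
  have "(\<integral>\<^sup>+\<xi>. ennreal ((cmod (FT u \<xi>))\<^sup>2) \<partial>lborel)
      = (\<integral>\<^sup>+\<xi>. liminf (\<lambda>n. ennreal (exp (- pi * (inverse (real (Suc n)) * \<xi>)\<^sup>2) * (cmod (FT u \<xi>))\<^sup>2)) \<partial>lborel)"
  proof (intro nn_integral_cong)
    fix \<xi>
    have "(\<lambda>n. exp (- pi * (inverse (real (Suc n)) * \<xi>)\<^sup>2) * (cmod (FT u \<xi>))\<^sup>2) \<longlonglongrightarrow> exp (- pi * (0 * \<xi>)\<^sup>2) * (cmod (FT u \<xi>))\<^sup>2"
      by (intro tendsto_intros LIMSEQ_inverse_real_of_nat)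
    then have "(\<lambda>n. ennreal (exp (- pi * (inverse (real (Suc n)) * \<xi>)\<^sup>2) * (cmod (FT u \<xi>))\<^sup>2)) \<longlonglongrightarrow> ennreal ((cmod (FT u \<xi>))\<^sup>2)"
      by (intro tendsto_ennrealI) simp
    then show "ennreal ((cmod (FT u \<xi>))\<^sup>2) = liminf (\<lambda>n. ennreal (exp (- pi * (inverse (real (Suc n)) * \<xi>)\<^sup>2) * (cmod (FT u \<xi>))\<^sup>2))"
      by (rule lim_imp_Liminf[symmetric, rotated]) simp
  qed
  \<comment> \<open>Fatou's lemma for the weights with \<open>a = 1 / (n + 1)\<close>, which tend to
    1 pointwise.\<close>
  also have "\<dots> \<le> liminf (\<lambda>n. \<integral>\<^sup>+\<xi>. ennreal (exp (- pi * (inverse (real (Suc n)) * \<xi>)\<^sup>2) * (cmod (FT u \<xi>))\<^sup>2) \<partial>lborel)"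
    by (rule nn_integral_liminf) measurable
  also have "\<dots> \<le> (\<integral>\<^sup>+x. ennreal ((cmod (u x))\<^sup>2) \<partial>lborel)"
    by (intro Liminf_le always_eventually allI step) simp_all
  finally show ?thesis .
qed

section \<open>Periodization and Fourier series\<close>

text \<open>Half-open, so that the integer translates partition the line exactly.\<close>

definition UI :: "real set" where "UI = {-(1/2)..<1/2}"

lemma UI_borel [measurable, simp]: "UI \<in> sets borel"
  by (simp add: UI_def)

lemma emeasure_UI [simp]: "emeasure lborel UI = 1"
  by (simp add: UI_def)

lemma measure_UI [simp]: "measure lborel UI = 1"
  by (simp add: UI_def)

text \<open>Series over the integers are handled as series over \<open>nat\<close> along the enumeration \<open>int_decode\<close>.\<close>

definition zz :: "nat \<Rightarrow> real" where "zz n = of_int (int_decode n)"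

lemma UI_translate_unique: "\<exists>!k::int. x - of_int k \<in> UI"
proof (rule ex1I)
  show "x - of_int \<lfloor>x + 1/2\<rfloor> \<in> UI" using floor_correct[of "x + 1/2"] unfolding UI_def atLeastLessThan_iff by linarith
  fix k :: int assume "x - of_int k \<in> UI"
  then show "k = \<lfloor>x + 1/2\<rfloor>" by (intro floor_unique[symmetric]) (simp_all add: UI_def field_simps)
qed

lemma zz_UI_unique: "\<exists>n. x - zz n \<in> UI \<and> (\<forall>m. m \<noteq> n \<longrightarrow> x - zz m \<notin> UI)"
proof -
  obtain k :: int where k: "x - of_int k \<in> UI" "\<And>l::int. x - of_int l \<in> UI \<Longrightarrow> l = k"
    using UI_translate_unique[of x] by blast
  show ?thesis
  proof (intro exI conjI allI impI)
    show "x - zz (int_encode k) \<in> UI" using k(1) by (simp add: zz_def)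
    fix m assume "m \<noteq> int_encode k"
    then have "int_decode m \<noteq> k" by (metis int_decode_inverse)
    then show "x - zz m \<notin> UI" using k(2)[of "int_decode m"] by (auto simp only: zz_def)
  qed
qed

lemma suminf_indicator_UI:
  "(\<Sum>n. indicator UI (x - zz n) :: ennreal) = 1"
proof -
  obtain n where n: "x - zz n \<in> UI" "\<And>m. m \<noteq> n \<Longrightarrow> x - zz m \<notin> UI" using zz_UI_unique[of x] by blast
  have "(\<Sum>m. indicator UI (x - zz m) :: ennreal) = (\<Sum>m\<in>{n}. indicator UI (x - zz m))"
  proof (intro suminf_finite)
    fix m assume "m \<notin> {n}"
    then have "x - zz m \<notin> UI" using n(2) by blast
    then show "indicator UI (x - zz m) = (0 :: ennreal)" by (rule indicator_simps(2))
  qed simp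
  then show ?thesis using n(1) by (simp only: sum.insert finite.emptyI) (simp add: indicator_def)
qed

text \<open>The translates of the indicator of \<open>UI\<close> form a partition of unity; every
  piece is shifted back to \<open>UI\<close>.\<close>

lemma nn_integral_fold:
  assumes [measurable]: "u \<in> borel_measurable borel"
  shows "(\<integral>\<^sup>+x. u x \<partial>lborel) = (\<integral>\<^sup>+x. (\<Sum>n. u (x + zz n)) * indicator UI x \<partial>lborel)"
proof -
  have "(\<integral>\<^sup>+x. u x \<partial>lborel) = (\<integral>\<^sup>+x. (\<Sum>n. u x * indicator UI (x - zz n)) \<partial>lborel)"
    by (simp add: suminf_indicator_UI)
  also have "\<dots> = (\<Sum>n. \<integral>\<^sup>+x. u x * indicator UI (x - zz n) \<partial>lborel)"
    by (intro nn_integral_suminf) measurable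
  also have "\<dots> = (\<Sum>n. \<integral>\<^sup>+x. u (x + zz n) * indicator UI x \<partial>lborel)"
  proof (intro arg_cong[where f = suminf] ext)
    fix n
    show "(\<integral>\<^sup>+x. u x * indicator UI (x - zz n) \<partial>lborel) = (\<integral>\<^sup>+x. u (x + zz n) * indicator UI x \<partial>lborel)"
      by (subst nn_integral_real_affine[where c = 1 and t = "zz n"]) (simp_all add: add.commute)
  qed
  also have "\<dots> = (\<integral>\<^sup>+x. (\<Sum>n. u (x + zz n) * indicator UI x) \<partial>lborel)"
    by (intro nn_integral_suminf[symmetric]) measurable
  finally show ?thesis by simp
qed

lemma AE_periodic:
  assumes [measurable]: "Measurable.pred borel P"
    and per: "\<And>x k. P x \<Longrightarrow> P (x + of_int k)"
    and ae: "AE x in lborel. x \<in> UI \<longrightarrow> P x"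
  shows "AE x in lborel. P x"
proof -
  have "AE x in lborel. - zz n + 1 * x \<in> UI \<longrightarrow> P (- zz n + 1 * x)" for n
    by (rule AE_borel_affine[OF _ _ ae]) simp_all
  then have "AE x in lborel. \<forall>n. - zz n + 1 * x \<in> UI \<longrightarrow> P (- zz n + 1 * x)"
    by (simp add: AE_all_countable)
  then show ?thesis
  proof eventually_elim
    case (elim x)
    obtain n where "x - zz n \<in> UI" using zz_UI_unique[of x] by blast
    then have "P (x - zz n)" using elim by (auto simp: algebra_simps)
    from per[OF this, of "int_decode n"] show ?case by (simp add: zz_def)
  qed
qed

text \<open>Shifting by an integer permutes the enumeration, and a series in \<open>ennreal\<close>
  is an integral over counting measure, which is invariant under bijections.\<close>

lemma suminf_zz_shift:
  fixes g :: "real \<Rightarrow> ennreal"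
  shows "(\<Sum>n. g (x + of_int k + zz n)) = (\<Sum>n. g (x + zz n))"
proof -
  define \<pi> where "\<pi> n = int_encode (int_decode n + k)" for n
  have "bij \<pi>"
    by (rule bij_betw_byWitness[where f' = "\<lambda>n. int_encode (int_decode n - k)"]) (auto simp: \<pi>_def)
  have z: "x + of_int k + zz n = x + zz (\<pi> n)" for n by (simp add: zz_def \<pi>_def)
  have "(\<Sum>n. g (x + zz (\<pi> n))) = (\<integral>\<^sup>+n. g (x + zz (\<pi> n)) \<partial>count_space UNIV)"
    by (simp add: nn_integral_count_space_nat)
  also have "\<dots> = (\<integral>\<^sup>+n. g (x + zz n) \<partial>count_space UNIV)"
    using \<open>bij \<pi>\<close> by (rule nn_integral_bij_count_space)
  finally show ?thesis by (simp add: z nn_integral_count_space_nat)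
qed

text \<open>Folding the modulus of u gives absolute convergence almost everywhere in one period, and
  by periodicity on the line. The same finite bound justifies exchanging sum and integral.\<close>

lemma fold_complex:
  fixes u :: "real \<Rightarrow> complex"
  assumes u: "integrable lborel u"
  shows "AE x in lborel. summable (\<lambda>n. cmod (u (x + zz n)))"
    and "integrable lborel (\<lambda>x. indicator UI x *\<^sub>R (\<Sum>n. u (x + zz n)))"
    and "(LINT x|lborel. indicator UI x *\<^sub>R (\<Sum>n. u (x + zz n))) = (LINT x|lborel. u x)"
proof -
  have [measurable]: "u \<in> borel_measurable borel" using u by auto
  have fin: "(\<integral>\<^sup>+x. ennreal (cmod (u x)) \<partial>lborel) < \<infinity>" using u by (simp add: integrable_iff_bounded)
  have "AE x in lborel. (\<Sum>n. ennreal (cmod (u (x + zz n)))) * indicator UI x \<noteq> \<infinity>"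
  proof (rule nn_integral_PInf_AE)
    show "(\<integral>\<^sup>+x. (\<Sum>n. ennreal (cmod (u (x + zz n)))) * indicator UI x \<partial>lborel) \<noteq> \<infinity>"
      using fin by (subst nn_integral_fold[symmetric]) auto
  qed measurable
  then have "AE x in lborel. x \<in> UI \<longrightarrow> (\<Sum>n. ennreal (cmod (u (x + zz n)))) \<noteq> \<infinity>"
    by eventually_elim (auto simp: indicator_def)
  then have "AE x in lborel. (\<Sum>n. ennreal (cmod (u (x + zz n)))) \<noteq> \<infinity>"
  proof (rule AE_periodic[rotated 2])
    show "Measurable.pred borel (\<lambda>x. (\<Sum>n. ennreal (cmod (u (x + zz n)))) \<noteq> \<infinity>)" by measurable
  qed (simp_all only: suminf_zz_shift[of "\<lambda>x. ennreal (cmod (u x))"] simp_thms)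
  then show ae: "AE x in lborel. summable (\<lambda>n. cmod (u (x + zz n)))"
    by eventually_elim (rule summable_suminf_not_top, simp_all)
  have sum1: "(\<Sum>n. \<integral>\<^sup>+x. ennreal (cmod (indicator UI x *\<^sub>R u (x + zz n))) \<partial>lborel) < \<infinity>"
  proof -
    have "(\<Sum>n. \<integral>\<^sup>+x. ennreal (cmod (indicator UI x *\<^sub>R u (x + zz n))) \<partial>lborel)
        = (\<integral>\<^sup>+x. (\<Sum>n. ennreal (cmod (indicator UI x *\<^sub>R u (x + zz n)))) \<partial>lborel)"
      by (intro nn_integral_suminf[symmetric]) measurable
    also have "\<dots> = (\<integral>\<^sup>+x. (\<Sum>n. ennreal (cmod (u (x + zz n)))) * indicator UI x \<partial>lborel)"
    proof (intro nn_integral_cong)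
      show "(\<Sum>n. ennreal (cmod (indicator UI x *\<^sub>R u (x + zz n)))) = (\<Sum>n. ennreal (cmod (u (x + zz n)))) * indicator UI x" for x
        by (cases "x \<in> UI") simp_all
    qed
    also have "\<dots> = (\<integral>\<^sup>+x. ennreal (cmod (u x)) \<partial>lborel)"
      by (rule nn_integral_fold[symmetric]) measurable
    finally show ?thesis using fin by simp
  qed
  have i1: "integrable lborel (\<lambda>x. indicator UI x *\<^sub>R u (x + zz n))" for n
  proof (rule integrable_mult_indicator)
    show "integrable lborel (\<lambda>x. u (x + zz n))"
      using lborel_integrable_real_affine[OF u, of 1 "zz n"] by (simp add: add.commute)
  qed simp
  have i2: "integrable lborel (\<lambda>x. indicator UI (x - zz n) *\<^sub>R u x)" for n
    by (rule Bochner_Integration.integrable_bound[OF u]) (auto simp: indicator_def)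
  have e12: "(LINT x|lborel. F (indicator UI (x - zz n) *\<^sub>R u x)) = (LINT x|lborel. F (indicator UI x *\<^sub>R u (x + zz n)))"
    for F :: "complex \<Rightarrow> 'b::{banach,second_countable_topology}" and n
    by (subst lborel_integral_real_affine[where c = 1 and t = "zz n"]) (simp_all add: add.commute)
  have s1: "summable (\<lambda>n. LINT x|lborel. cmod (indicator UI x *\<^sub>R u (x + zz n)))"
  proof (rule summable_suminf_not_top)
    have "ennreal (LINT x|lborel. cmod (indicator UI x *\<^sub>R u (x + zz n))) = (\<integral>\<^sup>+x. ennreal (cmod (indicator UI x *\<^sub>R u (x + zz n))) \<partial>lborel)" for n
      by (intro nn_integral_eq_integral[symmetric] integrable_norm i1) auto
    then show "(\<Sum>n. ennreal (LINT x|lborel. cmod (indicator UI x *\<^sub>R u (x + zz n)))) \<noteq> top"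
      using sum1 by (simp only: less_top[symmetric] infinity_ennreal_def simp_thms)
  qed (auto intro!: integral_nonneg_AE)
  have aeI: "AE x in lborel. summable (\<lambda>n. cmod (indicator UI x *\<^sub>R u (x + zz n)))"
    using ae by eventually_elim (auto intro: summable_mult)
  have m: "(\<Sum>n. indicator UI x *\<^sub>R u (x + zz n)) = indicator UI x *\<^sub>R (\<Sum>n. u (x + zz n))" for x
    by (auto simp: indicator_def)
  show "integrable lborel (\<lambda>x. indicator UI x *\<^sub>R (\<Sum>n. u (x + zz n)))"
    using integrable_suminf[OF i1 aeI s1] by (simp only: m)
  have one: "(\<lambda>m. indicator UI (x - zz m) *\<^sub>R u x) sums u x" for x
  proof -
    obtain n where n: "x - zz n \<in> UI" "\<And>m. m \<noteq> n \<Longrightarrow> x - zz m \<notin> UI" using zz_UI_unique[of x] by blast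
    have "(\<lambda>m. indicator UI (x - zz m) *\<^sub>R u x) sums (\<Sum>m\<in>{n}. indicator UI (x - zz m) *\<^sub>R u x)"
    proof (intro sums_finite)
      fix m assume "m \<notin> {n}"
      then have "x - zz m \<notin> UI" using n(2) by blast
      then have "indicator UI (x - zz m) = (0::real)" by (rule indicator_simps(2))
      then show "indicator UI (x - zz m) *\<^sub>R u x = 0" by simp
    qed simp
    then show ?thesis using n(1) by simp
  qed
  have one': "summable (\<lambda>m. cmod (indicator UI (x - zz m) *\<^sub>R u x))" for x
  proof -
    obtain n where n: "x - zz n \<in> UI" "\<And>m. m \<noteq> n \<Longrightarrow> x - zz m \<notin> UI" using zz_UI_unique[of x] by blast
    have "indicator UI (x - zz m) = (0::real)" if "m \<notin> {n}" for m
    proof -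
      from that have "x - zz m \<notin> UI" using n(2) by blast
      then show ?thesis by (rule indicator_simps(2))
    qed
    then show ?thesis by (intro summable_finite[of "{n}"]) simp_all
  qed
  have "(LINT x|lborel. indicator UI x *\<^sub>R (\<Sum>n. u (x + zz n))) = (\<Sum>n. LINT x|lborel. indicator UI x *\<^sub>R u (x + zz n))"
    using integral_suminf[OF i1 aeI s1] by (simp only: m)
  also have "\<dots> = (\<Sum>n. LINT x|lborel. indicator UI (x - zz n) *\<^sub>R u x)"
    by (simp only: e12[of "\<lambda>z. z"])
  also have "\<dots> = (LINT x|lborel. (\<Sum>n. indicator UI (x - zz n) *\<^sub>R u x))"
  proof (rule integral_suminf[symmetric, OF i2])
    show "AE x in lborel. summable (\<lambda>n. cmod (indicator UI (x - zz n) *\<^sub>R u x))"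
      by (rule AE_I2) (rule one')
    show "summable (\<lambda>n. LINT x|lborel. cmod (indicator UI (x - zz n) *\<^sub>R u x))"
      unfolding e12[of cmod] by (rule s1)
  qed
  also have "\<dots> = (LINT x|lborel. u x)"
    using one by (simp only: sums_iff)
  finally show "(LINT x|lborel. indicator UI x *\<^sub>R (\<Sum>n. u (x + zz n))) = (LINT x|lborel. u x)" .
qed

section \<open>Orthogonality and Bessel's inequality on the circle\<close>

lemma ee_has_vector_derivative:
  "((\<lambda>x. ee (c * x)) has_vector_derivative (2 * of_real pi * \<i> * of_real c) * ee (c * x)) (at x within S)"
proof -
  have "((\<lambda>z. exp (2 * of_real pi * \<i> * of_real c * z)) has_field_derivative
      2 * of_real pi * \<i> * of_real c * exp (2 * of_real pi * \<i> * of_real c * of_real x)) (at (of_real x))"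
    by (auto intro!: derivative_eq_intros)
  from has_vector_derivative_real_field[OF this] show ?thesis
    by (simp add: ee_eq_exp mult_ac has_vector_derivative_at_within)
qed

lemma integral_ee_Icc:
  assumes "c \<noteq> 0" "a \<le> b"
  shows "(LINT x|lborel. indicator {a..b} x *\<^sub>R ee (c * x)) = (ee (c * b) - ee (c * a)) / (2 * of_real pi * \<i> * of_real c)"
proof -
  have "((\<lambda>x. ee (c * x) / (2 * of_real pi * \<i> * of_real c)) has_vector_derivative ee (c * x)) (at x within {a..b})" for x
    using has_vector_derivative_divide[OF ee_has_vector_derivative[of c x "{a..b}"], of "2 * of_real pi * \<i> * of_real c"] assms
    by simp
  then have "(LINT x|lborel. indicator {a..b} x *\<^sub>R ee (c * x)) = ee (c * b) / (2 * of_real pi * \<i> * of_real c) - ee (c * a) / (2 * of_real pi * \<i> * of_real c)"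
    using assms by (intro integral_FTC_Icc continuous_intros) auto
  then show ?thesis by (simp add: diff_divide_distrib)
qed

lemma AE_UI_Icc: "AE x in lborel. x \<in> UI \<longleftrightarrow> x \<in> {-(1/2)..1/2}"
proof -
  have "AE x in lborel. x \<noteq> (1/2::real)" by (rule AE_lborel_singleton)
  then show ?thesis by eventually_elim (auto simp: UI_def)
qed

lemma integral_ee_UI:
  "(LINT x|lborel. indicator UI x *\<^sub>R ee (of_int k * x)) = (if k = 0 then 1 else 0)"
proof (cases "k = 0")
  case False
  have "(LINT x|lborel. indicator UI x *\<^sub>R ee (of_int k * x)) = (LINT x|lborel. indicator {-(1/2)..1/2} x *\<^sub>R ee (of_int k * x))"
  proof (rule integral_cong_AE)
    show "AE x in lborel. indicator UI x *\<^sub>R ee (of_int k * x) = indicator {-(1/2)..1/2} x *\<^sub>R ee (of_int k * x)"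
      using AE_UI_Icc by eventually_elim (auto simp: indicator_def)
  qed measurable
  also have "\<dots> = 0"
    using integral_ee_Icc[of "of_int k" "-(1/2)" "1/2"] ee_add_int[of "of_int k * (-(1/2))" k] False by simp
  finally show ?thesis using False by simp
qed simp

text \<open>The weight \<open>\<omega>\<close> allows functions \<open>w\<close> that are not supported in one period: only the
  periodization of \<open>\<omega>\<close> has to be bounded.\<close>

theorem circle_Bessel:
  assumes w: "integrable lborel w"
    and [measurable]: "\<omega> \<in> borel_measurable borel" "v \<in> borel_measurable borel"
    and nonneg: "\<And>\<xi>. 0 \<le> \<omega> \<xi>" "\<And>\<xi>. 0 \<le> v \<xi>"
    and wv: "\<And>\<xi>. (cmod (w \<xi>))\<^sup>2 \<le> \<omega> \<xi> * v \<xi>"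
    and C: "\<And>\<xi>. \<xi> \<in> UI \<Longrightarrow> (\<Sum>n. ennreal (\<omega> (\<xi> + zz n))) \<le> C"
  shows "(\<Sum>n. ennreal ((cmod (LINT \<xi>|lborel. w \<xi> * ee (zz n * \<xi>)))\<^sup>2)) \<le> C * (\<integral>\<^sup>+\<xi>. ennreal (v \<xi>) \<partial>lborel)"
proof (rule suminf_le_const[OF summableI])
  fix K :: nat
  have [measurable]: "w \<in> borel_measurable borel" using w by auto
  define c where "c n = (LINT \<xi>|lborel. w \<xi> * ee (zz n * \<xi>))" for n
  \<comment> \<open>A duality argument: the coefficients of S are the conjugates of those to be
    estimated, so the pairing of w with S is X, and the squared norm of S over one period is X as
    well.\<close>
  define S where "S \<xi> = (\<Sum>n<K. cnj (c n) * ee (zz n * \<xi>))" for \<xi>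
  have [measurable]: "S \<in> borel_measurable borel" unfolding S_def[abs_def] by measurable
  define X where "X = (\<Sum>n<K. (cmod (c n))\<^sup>2)"
  have "X \<ge> 0" unfolding X_def by (intro sum_nonneg) auto
  define V where "V = (\<integral>\<^sup>+\<xi>. ennreal (v \<xi>) \<partial>lborel)"
  have iw: "integrable lborel (\<lambda>\<xi>. w \<xi> * ee (zz n * \<xi>))" for n
    by (intro integrable_mult_ee w) measurable
  have "of_real X = (\<Sum>n<K. cnj (c n) * c n)"
    unfolding X_def of_real_sum by (intro sum.cong refl) (simp only: complex_norm_square mult.commute)
  also have "\<dots> = (\<Sum>n<K. LINT \<xi>|lborel. cnj (c n) * (w \<xi> * ee (zz n * \<xi>)))"
    unfolding c_def by (intro sum.cong refl) simp
  also have "\<dots> = (LINT \<xi>|lborel. (\<Sum>n<K. cnj (c n) * (w \<xi> * ee (zz n * \<xi>))))"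
    using iw by (intro Bochner_Integration.integral_sum[symmetric]) auto
  also have "\<dots> = (LINT \<xi>|lborel. w \<xi> * S \<xi>)"
    by (simp add: S_def sum_distrib_left mult_ac)
  finally have X: "of_real X = (LINT \<xi>|lborel. w \<xi> * S \<xi>)" .
  have "integrable lborel (\<lambda>\<xi>. (\<Sum>n<K. cnj (c n) * (w \<xi> * ee (zz n * \<xi>))))"
    using iw by (intro Bochner_Integration.integrable_sum) auto
  then have iwS: "integrable lborel (\<lambda>\<xi>. w \<xi> * S \<xi>)"
    by (simp add: S_def sum_distrib_left mult_ac)
  have SX: "(LINT \<xi>|lborel. indicator UI \<xi> *\<^sub>R (cmod (S \<xi>))\<^sup>2) = X"
  proof -
    have "complex_of_real (LINT \<xi>|lborel. indicator UI \<xi> *\<^sub>R (cmod (S \<xi>))\<^sup>2)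
        = (LINT \<xi>|lborel. (\<Sum>m<K. \<Sum>n<K. (c m * cnj (c n)) * (indicator UI \<xi> *\<^sub>R ee (of_int (int_decode n - int_decode m) * \<xi>))))"
      unfolding integral_complex_of_real[symmetric]
    proof (intro Bochner_Integration.integral_cong refl)
      fix \<xi>
      have "complex_of_real ((cmod (S \<xi>))\<^sup>2) = cnj (S \<xi>) * S \<xi>" by (simp only: complex_norm_square mult.commute)
      also have "\<dots> = (\<Sum>m<K. \<Sum>n<K. (c m * ee (- (zz m * \<xi>))) * (cnj (c n) * ee (zz n * \<xi>)))"
        by (simp add: S_def sum_product cnj_ee)
      also have "\<dots> = (\<Sum>m<K. \<Sum>n<K. (c m * cnj (c n)) * ee (of_int (int_decode n - int_decode m) * \<xi>))"
      proof (intro sum.cong refl)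
        fix m n
        have "ee (of_int (int_decode n - int_decode m) * \<xi>) = ee (- (zz m * \<xi>)) * ee (zz n * \<xi>)"
          by (simp add: zz_def left_diff_distrib flip: ee_add)
        then show "(c m * ee (- (zz m * \<xi>))) * (cnj (c n) * ee (zz n * \<xi>)) = (c m * cnj (c n)) * ee (of_int (int_decode n - int_decode m) * \<xi>)"
          by simp
      qed
      finally show "complex_of_real (indicator UI \<xi> *\<^sub>R (cmod (S \<xi>))\<^sup>2)
          = (\<Sum>m<K. \<Sum>n<K. (c m * cnj (c n)) * (indicator UI \<xi> *\<^sub>R ee (of_int (int_decode n - int_decode m) * \<xi>)))"
        by (simp add: scaleR_conv_of_real sum_distrib_left mult_ac)
    qed
    also have "\<dots> = (\<Sum>m<K. \<Sum>n<K. (c m * cnj (c n)) * (if int_decode n - int_decode m = 0 then 1 else 0))"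
    proof -
      have ii: "integrable lborel (\<lambda>\<xi>. indicator UI \<xi> *\<^sub>R ee (of_int k * \<xi>))" for k
      proof (rule Bochner_Integration.integrable_bound)
        show "integrable lborel (indicator UI :: real \<Rightarrow> real)" by simp
      qed (auto simp: indicator_def)
      show ?thesis
        by (simp only: Bochner_Integration.integral_sum integral_mult_right_zero integral_ee_UI
            integrable_mult_right Bochner_Integration.integrable_sum ii simp_thms)
    qed
    also have "\<dots> = (\<Sum>m<K. c m * cnj (c m))"
    proof (intro sum.cong refl)
      fix m assume "m \<in> {..<K}"
      have "(\<Sum>n<K. (c m * cnj (c n)) * (if int_decode n - int_decode m = 0 then 1 else 0))
          = (\<Sum>n<K. if n = m then c m * cnj (c m) else 0)"
        by (intro sum.cong refl) (auto simp: int_decode_eq)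
      also have "\<dots> = c m * cnj (c m)" using \<open>m \<in> {..<K}\<close> by simp
      finally show "(\<Sum>n<K. (c m * cnj (c n)) * (if int_decode n - int_decode m = 0 then 1 else 0)) = c m * cnj (c m)" .
    qed
    also have "\<dots> = complex_of_real X"
      unfolding X_def of_real_sum by (intro sum.cong refl) (simp only: complex_norm_square)
    finally show ?thesis by (simp only: of_real_eq_iff)
  qed
  have Sb: "cmod (S \<xi>) \<le> (\<Sum>n<K. cmod (c n))" for \<xi>
    unfolding S_def by (rule order_trans[OF norm_sum]) (simp add: norm_mult)
  have SXn: "(\<integral>\<^sup>+\<xi>. ennreal ((cmod (S \<xi>))\<^sup>2) * indicator UI \<xi> \<partial>lborel) = ennreal X"
  proof -
    have "(\<integral>\<^sup>+\<xi>. ennreal ((cmod (S \<xi>))\<^sup>2) * indicator UI \<xi> \<partial>lborel) = (\<integral>\<^sup>+\<xi>. ennreal (indicator UI \<xi> *\<^sub>R (cmod (S \<xi>))\<^sup>2) \<partial>lborel)"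
      by (intro nn_integral_cong) (auto simp: indicator_def)
    also have "\<dots> = ennreal (LINT \<xi>|lborel. indicator UI \<xi> *\<^sub>R (cmod (S \<xi>))\<^sup>2)"
    proof (intro nn_integral_eq_integral)
      show "integrable lborel (\<lambda>\<xi>. indicator UI \<xi> *\<^sub>R (cmod (S \<xi>))\<^sup>2)"
      proof (rule Bochner_Integration.integrable_bound)
        show "integrable lborel (\<lambda>\<xi>. (\<Sum>n<K. cmod (c n))\<^sup>2 * indicator UI \<xi> :: real)" by simp
        show "AE \<xi> in lborel. norm (indicator UI \<xi> *\<^sub>R (cmod (S \<xi>))\<^sup>2) \<le> norm ((\<Sum>n<K. cmod (c n))\<^sup>2 * indicator UI \<xi> :: real)"
          using Sb by (intro AE_I2) (auto simp: indicator_def intro!: power_mono)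
      qed measurable
    qed auto
    finally show ?thesis by (simp only: SX)
  qed
  have S_per: "S (\<xi> + zz n) = S \<xi>" for \<xi> n
  proof -
    have "ee (zz m * (\<xi> + zz n)) = ee (zz m * \<xi>)" for m
      using ee_add_int[of "zz m * \<xi>" "int_decode m * int_decode n"] by (simp add: zz_def distrib_left)
    then show ?thesis by (simp add: S_def)
  qed
  have "(\<integral>\<^sup>+\<xi>. ennreal (\<omega> \<xi> * (cmod (S \<xi>))\<^sup>2) \<partial>lborel)
      = (\<integral>\<^sup>+\<xi>. (\<Sum>n. ennreal (\<omega> (\<xi> + zz n) * (cmod (S (\<xi> + zz n)))\<^sup>2)) * indicator UI \<xi> \<partial>lborel)"
    by (rule nn_integral_fold) measurable
  \<comment> \<open>S is periodic, so folding the integral periodizes only \<omega>, which C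
    bounds.\<close>
  also have "\<dots> \<le> (\<integral>\<^sup>+\<xi>. C * (ennreal ((cmod (S \<xi>))\<^sup>2) * indicator UI \<xi>) \<partial>lborel)"
  proof (intro nn_integral_mono)
    fix \<xi>
    show "(\<Sum>n. ennreal (\<omega> (\<xi> + zz n) * (cmod (S (\<xi> + zz n)))\<^sup>2)) * indicator UI \<xi> \<le> C * (ennreal ((cmod (S \<xi>))\<^sup>2) * indicator UI \<xi>)"
    proof (cases "\<xi> \<in> UI")
      case True
      have "(\<Sum>n. ennreal (\<omega> (\<xi> + zz n) * (cmod (S (\<xi> + zz n)))\<^sup>2)) = (\<Sum>n. ennreal (\<omega> (\<xi> + zz n))) * ennreal ((cmod (S \<xi>))\<^sup>2)"
        by (simp only: S_per ennreal_mult[OF nonneg(1) zero_le_power2] ennreal_suminf_multc)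
      also have "\<dots> \<le> C * ennreal ((cmod (S \<xi>))\<^sup>2)" by (intro mult_right_mono C True) simp
      finally show ?thesis using True by simp
    qed simp
  qed
  also have "\<dots> = C * ennreal X" using SXn by (simp add: nn_integral_cmult)
  finally have \<omega>S: "(\<integral>\<^sup>+\<xi>. ennreal (\<omega> \<xi> * (cmod (S \<xi>))\<^sup>2) \<partial>lborel) \<le> C * ennreal X" .
  have "ennreal X = ennreal (cmod (LINT \<xi>|lborel. w \<xi> * S \<xi>))"
    using \<open>X \<ge> 0\<close> by (simp flip: X)
  also have "\<dots> \<le> (\<integral>\<^sup>+\<xi>. ennreal (cmod (w \<xi> * S \<xi>)) \<partial>lborel)"
    by (rule integral_norm_bound_ennreal[OF iwS])
  also have "\<dots> \<le> (\<integral>\<^sup>+\<xi>. ennreal (sqrt (v \<xi>)) * ennreal (sqrt (\<omega> \<xi>) * cmod (S \<xi>)) \<partial>lborel)"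
  proof (intro nn_integral_mono)
    fix \<xi>
    have "cmod (w \<xi>) \<le> sqrt (\<omega> \<xi>) * sqrt (v \<xi>)"
      using real_le_rsqrt[OF wv[of \<xi>]] by (simp only: real_sqrt_mult)
    from mult_right_mono[OF this, of "cmod (S \<xi>)"]
    show "ennreal (cmod (w \<xi> * S \<xi>)) \<le> ennreal (sqrt (v \<xi>)) * ennreal (sqrt (\<omega> \<xi>) * cmod (S \<xi>))"
      using nonneg by (simp add: norm_mult ennreal_mult[symmetric] mult_ac)
  qed
  finally have "(ennreal X)\<^sup>2 \<le> (\<integral>\<^sup>+\<xi>. ennreal (sqrt (v \<xi>)) * ennreal (sqrt (\<omega> \<xi>) * cmod (S \<xi>)) \<partial>lborel)\<^sup>2"
    by (rule power_mono) simp
  also have "\<dots> \<le> (\<integral>\<^sup>+\<xi>. (ennreal (sqrt (v \<xi>)))\<^sup>2 \<partial>lborel) * (\<integral>\<^sup>+\<xi>. (ennreal (sqrt (\<omega> \<xi>) * cmod (S \<xi>)))\<^sup>2 \<partial>lborel)"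
    by (rule Cauchy_Schwarz_nn_integral) measurable
  also have "\<dots> = V * (\<integral>\<^sup>+\<xi>. ennreal (\<omega> \<xi> * (cmod (S \<xi>))\<^sup>2) \<partial>lborel)"
    using nonneg by (simp add: V_def ennreal_power power_mult_distrib)
  also have "\<dots> \<le> V * (C * ennreal X)" by (intro mult_left_mono \<omega>S) simp
  \<comment> \<open>Cauchy-Schwarz has led to \<open>X * X \<le> X * (C * V)\<close>. To cancel X it
    must be finite, which is why only the first K coefficients are summed.\<close>
  finally have *: "ennreal X * ennreal X \<le> ennreal X * (C * V)" by (simp only: power2_eq_square mult_ac)
  have "ennreal X \<le> C * V"
  proof (cases "X = 0")
    case False
    then have "ennreal X \<noteq> 0" "ennreal X \<noteq> top" using \<open>X \<ge> 0\<close> by auto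
    from ennreal_mult_le_mult_iff[OF this] * show ?thesis by (simp only:)
  qed simp
  moreover have "(\<Sum>n<K. ennreal ((cmod (c n))\<^sup>2)) = ennreal X"
    unfolding X_def by (rule sum_ennreal) simp
  ultimately show "(\<Sum>n<K. ennreal ((cmod (LINT \<xi>|lborel. w \<xi> * ee (zz n * \<xi>)))\<^sup>2)) \<le> C * (\<integral>\<^sup>+\<xi>. ennreal (v \<xi>) \<partial>lborel)"
    by (simp only: c_def V_def)
qed

section \<open>Uniqueness of Fourier coefficients\<close>

lemma ee_eq_1_iff: "ee t = 1 \<longleftrightarrow> (\<exists>k::int. t = of_int k)"
  by (auto simp: ee_eq_exp exp_eq_1)

lemma ee_eq_iff: "ee x = ee y \<longleftrightarrow> (\<exists>k::int. x = y + of_int k)"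
proof -
  have "ee x = ee y * ee (x - y)" by (simp add: ee_add[symmetric])
  then have "ee x = ee y \<longleftrightarrow> ee (x - y) = 1" by simp
  then show ?thesis by (auto simp: ee_eq_1_iff algebra_simps)
qed

lemma integrable_mult_ee_linear:
  "integrable lborel u \<Longrightarrow> integrable lborel (\<lambda>x. u x * ee (c * x))"
  by (rule integrable_mult_ee[of _ _ "\<lambda>x. c * x"]) simp_all

lemma integrable_mult_bounded:
  fixes u w :: "real \<Rightarrow> complex"
  assumes u: "integrable lborel u" and [measurable]: "w \<in> borel_measurable borel" and b: "\<And>x. cmod (w x) \<le> b"
  shows "integrable lborel (\<lambda>x. u x * w x)"
proof (rule Bochner_Integration.integrable_bound)
  have [measurable]: "u \<in> borel_measurable borel" using u by auto
  show "(\<lambda>x. u x * w x) \<in> borel_measurable lborel" by measurable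
  show "integrable lborel (\<lambda>x. b * cmod (u x))" using u by simp
  have "0 \<le> b" using b[of 0] norm_ge_zero order_trans by blast
  show "AE x in lborel. cmod (u x * w x) \<le> norm (b * cmod (u x))"
    using b \<open>0 \<le> b\<close> by (intro AE_I2) (auto simp: norm_mult mult.commute[of b] intro!: mult_left_mono)
qed

text \<open>Multiplication by a trigonometric polynomial preserves the vanishing of all Fourier
  coefficients; the induction needs the multiplier \<open>w\<close> to be arbitrary because of products.\<close>
lemma real_polynomial_orthogonal:
  fixes u :: "real \<Rightarrow> complex"
  assumes u: "integrable lborel u" and p: "real_polynomial_function p"
    and w: "w \<in> borel_measurable borel" "\<And>x. cmod (w x) \<le> b"
      "\<And>l::int. (LINT x|lborel. u x * w x * ee (of_int l * x)) = 0"
  shows "(LINT x|lborel. u x * (of_real (p (ee x)) * w x) * ee (of_int l * x)) = 0"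
proof -
  have bm: "p' \<in> borel_measurable borel \<and> (\<exists>b. \<forall>x. \<bar>p' (ee x)\<bar> \<le> b)" if "real_polynomial_function p'" for p'
  proof
    have c: "continuous_on UNIV p'"
      using that by (simp add: continuous_at_imp_continuous_on continuous_real_polymonial_function)
    then show "p' \<in> borel_measurable borel" by (rule borel_measurable_continuous_onI)
    have "compact (p' ` sphere 0 1)"
      by (intro compact_continuous_image continuous_on_subset[OF c]) auto
    then obtain b where "\<forall>z\<in>sphere 0 1. \<bar>p' z\<bar> \<le> b"
      by (auto dest!: compact_imp_bounded simp: bounded_iff)
    then show "\<exists>b. \<forall>x. \<bar>p' (ee x)\<bar> \<le> b" by (intro exI[of _ b]) auto
  qed
  from p w show ?thesis
  proof (induction arbitrary: w b l rule: real_polynomial_function.induct)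
    case (linear f)
    note [measurable] = linear.prems(1)
    define \<alpha> where "\<alpha> = (of_real (f 1) - \<i> * of_real (f \<i>)) / 2"
    define \<beta> where "\<beta> = (of_real (f 1) + \<i> * of_real (f \<i>)) / 2"
    interpret f: bounded_linear f by (rule linear.hyps)
    \<comment> \<open>A real-linear functional on the plane is a combination of z and
      \<open>cnj z\<close>; at \<open>z = ee x\<close> these factors only move the frequency l by 1
      and by -1.\<close>
    have f_eq: "complex_of_real (f z) = \<alpha> * z + \<beta> * cnj z" for z
    proof -
      have "Re z *\<^sub>R 1 + Im z *\<^sub>R \<i> = z" by (simp add: complex_eq_iff)
      then have "f z = f (Re z *\<^sub>R 1 + Im z *\<^sub>R \<i>)" by simp
      also have "\<dots> = Re z * f 1 + Im z * f \<i>" by (simp only: f.add f.scaleR real_scaleR_def)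
      finally show ?thesis by (simp add: \<alpha>_def \<beta>_def complex_eq_iff field_simps)
    qed
    have i: "integrable lborel (\<lambda>x. u x * w x * ee (of_int k * x))" for k
      by (intro integrable_mult_ee_linear integrable_mult_bounded[OF u linear.prems(1,2)])
    have "(LINT x|lborel. u x * (of_real (f (ee x)) * w x) * ee (of_int l * x))
        = (LINT x|lborel. \<alpha> * (u x * w x * ee (of_int (l + 1) * x)) + \<beta> * (u x * w x * ee (of_int (l - 1) * x)))"
    proof (intro Bochner_Integration.integral_cong refl)
      fix x
      have "ee (of_int (l + 1) * x) = ee (of_int l * x) * ee x" "ee (of_int (l - 1) * x) = ee (of_int l * x) * ee (- x)"
        by (simp_all add: ring_distribs flip: ee_add)
      then show "u x * (of_real (f (ee x)) * w x) * ee (of_int l * x)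
        = \<alpha> * (u x * w x * ee (of_int (l + 1) * x)) + \<beta> * (u x * w x * ee (of_int (l - 1) * x))"
        by (simp only: f_eq cnj_ee) (simp add: algebra_simps)
    qed
    also have "\<dots> = 0"
      using i[of "l + 1"] i[of "l - 1"] linear.prems(3)[of "l + 1"] linear.prems(3)[of "l - 1"] by simp
    finally show ?case .
  next
    case (const c)
    have "(LINT x|lborel. u x * (of_real c * w x) * ee (of_int l * x)) = (LINT x|lborel. of_real c * (u x * w x * ee (of_int l * x)))"
      by (simp add: mult_ac)
    then show ?case using const.prems(3) by simp
  next
    case (add f g)
    obtain bf bg where b: "\<And>x. \<bar>f (ee x)\<bar> \<le> bf" "\<And>x. \<bar>g (ee x)\<bar> \<le> bg"
      using bm[OF add.hyps(1)] bm[OF add.hyps(2)] by blast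
    have [measurable]: "f \<in> borel_measurable borel" "g \<in> borel_measurable borel" "w \<in> borel_measurable borel"
      using bm[OF add.hyps(1)] bm[OF add.hyps(2)] add.prems by blast+
    have i: "integrable lborel (\<lambda>x. u x * (of_real (h (ee x)) * w x) * ee (of_int l * x))"
      if [measurable]: "h \<in> borel_measurable borel" and "\<And>x. \<bar>h (ee x)\<bar> \<le> c" for h c
    proof -
      have "cmod (of_real (h (ee x)) * w x) \<le> c * b" for x
        unfolding norm_mult norm_of_real using that(2)[of x] by (intro mult_mono add.prems(2)) (auto intro: order_trans)
      then show ?thesis
        by (intro integrable_mult_ee_linear integrable_mult_bounded[OF u]) auto
    qed
    have "(LINT x|lborel. u x * (of_real (f (ee x) + g (ee x)) * w x) * ee (of_int l * x))
      = (LINT x|lborel. u x * (of_real (f (ee x)) * w x) * ee (of_int l * x) + u x * (of_real (g (ee x)) * w x) * ee (of_int l * x))"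
      by (simp add: algebra_simps)
    also have "\<dots> = 0"
      using i[of f bf] i[of g bg] b add.IH(1)[OF add.prems] add.IH(2)[OF add.prems] by simp
    finally show ?case .
  next
    case (mult f g)
    obtain bg where b: "\<And>x. \<bar>g (ee x)\<bar> \<le> bg" using bm[OF mult.hyps(2)] by blast
    have [measurable]: "g \<in> borel_measurable borel" "w \<in> borel_measurable borel"
      using bm[OF mult.hyps(2)] mult.prems by blast+
    have "cmod (of_real (g (ee x)) * w x) \<le> bg * b" for x
      unfolding norm_mult norm_of_real using b[of x] by (intro mult_mono mult.prems(2)) (auto intro: order_trans)
    from mult.IH(1)[of "\<lambda>x. of_real (g (ee x)) * w x", OF _ this mult.IH(2)[OF mult.prems]]
    show ?case by (simp add: mult.assoc)
  qed
qed

text \<open>The measures whose densities are the positive and the negative part of v agree on all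
  half-lines, and finite values on half-lines determine a measure.\<close>

lemma real_zero_of_integrals_greaterThan:
  fixes v :: "real \<Rightarrow> real"
  assumes v: "integrable lborel v"
    and z: "\<And>t. (LINT x|lborel. indicator {t<..} x *\<^sub>R v x) = 0"
  shows "AE x in lborel. v x = 0"
proof -
  have [measurable]: "v \<in> borel_measurable borel" using v by auto
  define P where "P x = max 0 (v x)" for x
  define Q where "Q x = max 0 (- v x)" for x
  have [measurable]: "P \<in> borel_measurable borel" "Q \<in> borel_measurable borel"
    by (simp_all add: P_def[abs_def] Q_def[abs_def])
  have P: "integrable lborel P" and Q: "integrable lborel Q"
    unfolding P_def[abs_def] Q_def[abs_def] using v by auto
  have PQ: "v x = P x - Q x" "0 \<le> P x" "0 \<le> Q x" for x
    by (auto simp: P_def Q_def)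
  have em: "emeasure (density lborel (\<lambda>x. ennreal (R x))) {t<..} = ennreal (LINT x|lborel. indicator {t<..} x *\<^sub>R R x)"
    if R: "integrable lborel R" and "\<And>x. 0 \<le> R x" for R and t :: real
  proof -
    have [measurable]: "R \<in> borel_measurable borel" using R by auto
    have "emeasure (density lborel (\<lambda>x. ennreal (R x))) {t<..} = (\<integral>\<^sup>+x. ennreal (indicator {t<..} x *\<^sub>R R x) \<partial>lborel)"
      by (subst emeasure_density) (auto intro!: nn_integral_cong simp: indicator_def)
    also have "\<dots> = ennreal (LINT x|lborel. indicator {t<..} x *\<^sub>R R x)"
      using that by (intro nn_integral_eq_integral integrable_mult_indicator) auto
    finally show ?thesis .
  qed
  have "(LINT x|lborel. indicator {t<..} x *\<^sub>R P x) = (LINT x|lborel. indicator {t<..} x *\<^sub>R Q x)" for t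
  proof -
    have "0 = (LINT x|lborel. indicator {t<..} x *\<^sub>R P x - indicator {t<..} x *\<^sub>R Q x)"
      using z[of t] by (simp add: PQ(1) ring_distribs)
    also have "\<dots> = (LINT x|lborel. indicator {t<..} x *\<^sub>R P x) - (LINT x|lborel. indicator {t<..} x *\<^sub>R Q x)"
      by (intro Bochner_Integration.integral_diff integrable_mult_indicator P Q) auto
    finally show ?thesis by simp
  qed
  then have "density lborel (\<lambda>x. ennreal (P x)) = density lborel (\<lambda>x. ennreal (Q x))"
    by (intro measure_eqI_lessThan) (simp_all add: em P Q PQ)
  then have "AE x in lborel. ennreal (P x) = ennreal (Q x)"
    by (subst (asm) sigma_finite_measure.density_unique_iff[OF sigma_finite_lborel]) auto
  then show ?thesis by eventually_elim (use PQ in auto)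
qed

text \<open>The class of functions of \<open>ee x\<close> to which u is orthogonal grows in three
  steps: from polynomials to continuous functions by Stone-Weierstrass on the circle, to indicators
  of closed sets by dominated convergence, and, for closed arcs, to half-lines in x.\<close>

lemma circle_coefficients_unique:
  fixes u :: "real \<Rightarrow> complex"
  assumes u: "integrable lborel u" and supp: "\<And>x. x \<notin> UI \<Longrightarrow> u x = 0"
    and z: "\<And>l::int. (LINT x|lborel. u x * ee (of_int l * x)) = 0"
  shows "AE x in lborel. u x = 0"
proof -
  have [measurable]: "u \<in> borel_measurable borel" using u by auto
  have poly: "(LINT x|lborel. u x * of_real (p (ee x))) = 0" if "real_polynomial_function p" for p
    using real_polynomial_orthogonal[OF u that, of "\<lambda>_. 1" 1 0] z by simp
  have cont: "(LINT x|lborel. u x * of_real (c (ee x))) = 0"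
    if c: "continuous_on UNIV c" for c :: "complex \<Rightarrow> real"
  proof -
    define L where "L = (LINT x|lborel. cmod (u x))"
    have "L \<ge> 0" unfolding L_def by (rule integral_nonneg_AE) simp
    have [measurable]: "c \<in> borel_measurable borel" using c by (rule borel_measurable_continuous_onI)
    have bd: "\<exists>b. \<forall>x. cmod (of_real (h (ee x))) \<le> b" if "continuous_on UNIV h" for h :: "complex \<Rightarrow> real"
    proof -
      have "compact (h ` sphere 0 1)"
        by (intro compact_continuous_image continuous_on_subset[OF that]) auto
      then obtain b where "\<forall>z\<in>sphere 0 1. \<bar>h z\<bar> \<le> b"
        by (auto dest!: compact_imp_bounded simp: bounded_iff)
      then show ?thesis by (intro exI[of _ b]) auto
    qed
    have "cmod (LINT x|lborel. u x * of_real (c (ee x))) \<le> 0 + e" if "e > 0" for e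
    proof -
      \<comment> \<open>\<open>L + 1\<close> instead of L, because the norm L may be 0.\<close>
      have "e / (L + 1) > 0" using that \<open>L \<ge> 0\<close> by simp
      then obtain p where p: "real_polynomial_function p" "\<And>z. z \<in> sphere 0 1 \<Longrightarrow> \<bar>c z - p z\<bar> < e / (L + 1)"
        using Stone_Weierstrass_real_polynomial_function[of "sphere 0 1" c] continuous_on_subset[OF c] by (metis compact_sphere top_greatest)
      have pc: "continuous_on UNIV p"
        using p by (simp add: continuous_at_imp_continuous_on continuous_real_polymonial_function)
      then have [measurable]: "p \<in> borel_measurable borel" by (rule borel_measurable_continuous_onI)
      obtain b1 b2 where "\<And>x. cmod (of_real (c (ee x))) \<le> b1" "\<And>x. cmod (of_real (p (ee x))) \<le> b2"
        using bd[OF c] bd[OF pc] by blast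
      then have i: "integrable lborel (\<lambda>x. u x * of_real (c (ee x)))" "integrable lborel (\<lambda>x. u x * of_real (p (ee x)))"
        by (auto intro!: integrable_mult_bounded[OF u])
      have "(LINT x|lborel. u x * of_real (c (ee x))) = (LINT x|lborel. u x * of_real (c (ee x))) - (LINT x|lborel. u x * of_real (p (ee x)))"
        using poly[OF p(1)] by simp
      also have "\<dots> = (LINT x|lborel. u x * of_real (c (ee x)) - u x * of_real (p (ee x)))"
        using i by simp
      also have "cmod \<dots> \<le> (LINT x|lborel. (e / (L + 1)) * cmod (u x))"
      proof (rule Bochner_Integration.integral_norm_bound_integral)
        fix x
        have "cmod (u x * of_real (c (ee x)) - u x * of_real (p (ee x))) = cmod (u x) * \<bar>c (ee x) - p (ee x)\<bar>"
          by (simp add: right_diff_distrib[symmetric] norm_mult flip: of_real_diff)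
        also have "\<dots> \<le> cmod (u x) * (e / (L + 1))"
          using p(2)[of "ee x"] by (intro mult_left_mono) auto
        finally show "cmod (u x * of_real (c (ee x)) - u x * of_real (p (ee x))) \<le> (e / (L + 1)) * cmod (u x)"
          by (simp only: mult.commute)
      qed (use i u in auto)
      also have "\<dots> = e * (L / (L + 1))" by (simp add: L_def)
      also have "\<dots> \<le> e * 1" using that \<open>L \<ge> 0\<close> by (intro mult_left_mono) (auto simp: field_simps)
      finally show ?thesis by simp
    qed
    then have "cmod (LINT x|lborel. u x * of_real (c (ee x))) \<le> 0" by (rule field_le_epsilon)
    then show ?thesis by simp
  qed
  have closed: "(LINT x|lborel. u x * of_real (indicator A (ee x))) = 0"
    if A: "closed A" "A \<noteq> {}" for A :: "complex set"
  proof -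
    \<comment> \<open>Continuous tent functions that are 1 on A and vanish at distance
      \<open>1 / n\<close> from it.\<close>
    define c where "c n z = max 0 (1 - real n * infdist z A)" for n z
    have cc: "continuous_on UNIV (c n)" for n
      unfolding c_def[abs_def] by (intro continuous_intros)
    have [measurable]: "c n \<in> borel_measurable borel" for n by (rule borel_measurable_continuous_onI[OF cc])
    have [measurable]: "A \<in> sets borel" using A by simp
    have lim: "(\<lambda>n. c n z) \<longlonglongrightarrow> indicator A z" for z
    proof (cases "z \<in> A")
      case False
      then have "infdist z A > 0" using A by (simp add: infdist_pos_not_in_closed)
      then obtain n0 where "1 \<le> real n0 * infdist z A"
        using reals_Archimedean3[of "infdist z A"] less_imp_le by blast
      then have "\<forall>\<^sub>F n in sequentially. c n z = 0"
        unfolding c_def using \<open>infdist z A > 0\<close>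
        by (intro eventually_sequentiallyI[of n0]) (auto simp: max_def, meson mult_right_mono of_nat_mono order_trans less_imp_le antisym)
      then show ?thesis using False by (simp add: tendsto_eventually)
    qed (simp add: c_def)
    have "(\<lambda>n. LINT x|lborel. u x * of_real (c n (ee x))) \<longlonglongrightarrow> (LINT x|lborel. u x * of_real (indicator A (ee x)))"
    proof (rule integral_dominated_convergence)
      show "integrable lborel (\<lambda>x. cmod (u x))" using u by simp
      show "AE x in lborel. (\<lambda>n. u x * of_real (c n (ee x))) \<longlonglongrightarrow> u x * of_real (indicator A (ee x))"
        by (intro AE_I2 tendsto_intros lim)
      have "\<bar>c n z\<bar> \<le> 1" for n z by (auto simp: c_def infdist_nonneg)
      then show "AE x in lborel. cmod (u x * of_real (c n (ee x))) \<le> cmod (u x)" for n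
        by (intro AE_I2) (auto simp: norm_mult intro!: mult_left_le)
    qed measurable
    then show ?thesis using cont[OF cc] by (simp add: LIMSEQ_const_iff)
  qed
  have half: "(LINT x|lborel. indicator {t<..} x *\<^sub>R u x) = 0" for t
  proof (cases "t < 1/2")
    case False
    then have z0: "indicator {t<..} x *\<^sub>R u x = 0" for x
      using supp[of x] by (auto simp: indicator_def UI_def)
    show ?thesis unfolding z0 by simp
  next
    case True
    \<comment> \<open>For t below -1/2 the half-line contains all of \<open>UI\<close>, so t may be
      clipped to the period.\<close>
    define s where "s = max t (-(1/2))"
    have s: "-(1/2) \<le> s" "s < 1/2" using True by (auto simp: s_def)
    define A where "A = ee ` {s..1/2}"
    have "compact A" unfolding A_def by (intro compact_continuous_image continuous_intros) auto
    then have "closed A" by (rule compact_imp_closed)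
    have "(LINT x|lborel. indicator {t<..} x *\<^sub>R u x) = (LINT x|lborel. u x * of_real (indicator A (ee x)))"
    proof (rule integral_cong_AE)
      \<comment> \<open>Two points are exceptional: -1/2, whose image coincides with that of the end
        point 1/2 of the arc, and s, which lies in the closed arc but perhaps not in the open
        half-line.\<close>
      have "AE x in lborel. x \<noteq> -(1/2) \<and> x \<noteq> s"
        using AE_lborel_singleton[of "-(1/2)::real"] AE_lborel_singleton[of s] by eventually_elim simp
      then show "AE x in lborel. indicator {t<..} x *\<^sub>R u x = u x * of_real (indicator A (ee x))"
      proof eventually_elim
        case (elim x)
        show ?case
        proof (cases "x \<in> UI")
          case True
          then have x: "-(1/2) < x" "x < 1/2" using elim by (auto simp: UI_def)
          have "ee x \<in> A \<longleftrightarrow> s \<le> x"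
          proof
            assume "ee x \<in> A"
            then obtain y k where y: "s \<le> y" "y \<le> 1/2" "x = y + of_int k" by (auto simp: A_def ee_eq_iff)
            then have "real_of_int k < 1" "-1 < real_of_int k" using x s by linarith+
            then have "k = 0" by linarith
            then show "s \<le> x" using y by simp
          qed (use x in \<open>auto simp: A_def\<close>)
          also have "s \<le> x \<longleftrightarrow> t < x" using elim x by (auto simp: s_def max_def split: if_splits)
          finally show ?thesis by (simp add: indicator_def)
        qed (simp add: supp)
      qed
      have [measurable]: "A \<in> sets borel" using \<open>closed A\<close> by simp
      show "(\<lambda>x. u x * of_real (indicator A (ee x))) \<in> borel_measurable lborel" by measurable
    qed measurable
    also have "\<dots> = 0" using closed[OF \<open>closed A\<close>] s by (auto simp: A_def)
    finally show ?thesis .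
  qed
  have ii: "integrable lborel (\<lambda>x. indicator {t<..} x *\<^sub>R u x)" for t :: real
    by (intro integrable_mult_indicator u) simp
  have "AE x in lborel. Re (u x) = 0"
  proof (rule real_zero_of_integrals_greaterThan)
    show "(LINT x|lborel. indicator {t<..} x *\<^sub>R Re (u x)) = 0" for t
      using integral_Re[OF ii[of t]] half[of t] by simp
  qed (use u in simp)
  moreover have "AE x in lborel. Im (u x) = 0"
  proof (rule real_zero_of_integrals_greaterThan)
    show "(LINT x|lborel. indicator {t<..} x *\<^sub>R Im (u x)) = 0" for t
      using integral_Im[OF ii[of t]] half[of t] by simp
  qed (use u in simp)
  ultimately show ?thesis by eventually_elim (simp add: complex_eq_iff)
qed

section \<open>Poisson summation and Taylor bounds\<close>

lemma has_sum_int_decode: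
  fixes f :: "int \<Rightarrow> 'a::banach"
  assumes "summable (\<lambda>n. norm (f (int_decode n)))"
  shows "(f has_sum (\<Sum>n. f (int_decode n))) UNIV"
proof -
  have "((\<lambda>n. f (int_decode n)) has_sum (\<Sum>n. f (int_decode n))) UNIV"
    by (rule norm_summable_imp_has_sum[OF assms summable_sums[OF summable_norm_cancel[OF assms]]])
  then show ?thesis
    using has_sum_reindex_bij_betw[OF bij_int_decode, of f "\<Sum>n. f (int_decode n)"] by simp
qed

lemma infsum_ennreal_int_decode:
  fixes f :: "int \<Rightarrow> ennreal"
  shows "(\<Sum>\<^sub>\<infinity>k. f k) = (\<Sum>n. f (int_decode n))"
proof -
  have "(\<lambda>n. f (int_decode n)) sums (\<Sum>n. f (int_decode n))" by (rule summable_sums) simp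
  moreover have "(\<Sum>\<^sub>\<infinity>n. f (int_decode n)) = (\<Sum>n. f (int_decode n))"
  proof (rule sums_unique2)
    have "((\<lambda>n. f (int_decode n)) has_sum (\<Sum>\<^sub>\<infinity>n. f (int_decode n))) UNIV"
      by (intro has_sum_infsum nonneg_summable_on_complete) simp
    then show "(\<lambda>n. f (int_decode n)) sums (\<Sum>\<^sub>\<infinity>n. f (int_decode n))" by (rule has_sum_imp_sums)
  qed fact
  moreover have "(\<Sum>\<^sub>\<infinity>n. f (int_decode n)) = (\<Sum>\<^sub>\<infinity>k. f k)"
    by (rule infsum_reindex_bij_betw[OF bij_int_decode])
  ultimately show ?thesis by simp
qed

text \<open>Absolute convergence turns the series into an unordered sum over the integers, where the
  shift is a reindexing.\<close>

lemma suminf_zz_shift_complex: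
  fixes g :: "real \<Rightarrow> complex"
  assumes "summable (\<lambda>n. cmod (g (x + zz n)))"
  shows "summable (\<lambda>n. cmod (g (x + of_int k + zz n)))"
    and "(\<Sum>n. g (x + of_int k + zz n)) = (\<Sum>n. g (x + zz n))"
proof -
  have "(\<Sum>n. ennreal (cmod (g (x + zz n)))) \<noteq> top"
    using assms by (simp add: ennreal_suminf_neq_top)
  then have "(\<Sum>n. ennreal (cmod (g (x + of_int k + zz n)))) \<noteq> top"
    by (simp only: suminf_zz_shift[of "\<lambda>x. ennreal (cmod (g x))"] simp_thms)
  then show s: "summable (\<lambda>n. cmod (g (x + of_int k + zz n)))"
    by (intro summable_suminf_not_top) simp_all
  have 1: "((\<lambda>l. g (x + of_int k + of_int l)) has_sum (\<Sum>n. g (x + of_int k + zz n))) UNIV"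
    using has_sum_int_decode[of "\<lambda>l. g (x + of_int k + of_int l)"] s by (simp add: zz_def)
  have 2: "((\<lambda>l. g (x + of_int l)) has_sum (\<Sum>n. g (x + zz n))) UNIV"
    using has_sum_int_decode[of "\<lambda>l. g (x + of_int l)"] assms by (simp add: zz_def)
  have b: "bij (\<lambda>l::int. k + l)" by (rule bij_betw_byWitness[where f' = "\<lambda>l. l - k"]) auto
  from 2 have "((\<lambda>l. g (x + of_int (k + l))) has_sum (\<Sum>n. g (x + zz n))) UNIV"
    using has_sum_reindex_bij_betw[OF b, of "\<lambda>l. g (x + of_int l)"] by simp
  then have "((\<lambda>l. g (x + of_int k + of_int l)) has_sum (\<Sum>n. g (x + zz n))) UNIV"
    by (simp add: add.assoc)
  then show "(\<Sum>n. g (x + of_int k + zz n)) = (\<Sum>n. g (x + zz n))"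
    using 1 by (rule has_sum_unique[symmetric])
qed

lemma pred_eq_complex [measurable (raw)]:
  fixes f g :: "'a \<Rightarrow> complex"
  assumes [measurable]: "f \<in> borel_measurable M" "g \<in> borel_measurable M"
  shows "Measurable.pred M (\<lambda>x. f x = g x)"
  unfolding pred_def by measurable

lemma pred_summable_real [measurable (raw)]:
  fixes f :: "'a \<Rightarrow> nat \<Rightarrow> real"
  assumes [measurable]: "\<And>n. (\<lambda>x. f x n) \<in> borel_measurable M"
  shows "Measurable.pred M (\<lambda>x. summable (f x))"
  unfolding pred_def summable_iff_convergent Cauchy_convergent_iff[symmetric]
  by (rule sets_Collect_Cauchy) measurable

text \<open>Both sides, cut off to one period, are integrable with coefficient
  \<open>FT \<phi> (\<xi> - of_int l)\<close> at every l: on the left by unfolding the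
  periodization, on the right by orthogonality. Uniqueness of coefficients gives equality on
  \<open>UI\<close>, and both sides are periodic in x.\<close>

theorem Poisson_summation_AE:
  assumes \<phi>: "integrable lborel \<phi>"
    and sm: "summable (\<lambda>n. cmod (FT \<phi> (\<xi> + zz n)))"
  shows "AE x in lborel. (\<Sum>n. \<phi> (x + zz n) * ee (- ((x + zz n) * \<xi>))) = (\<Sum>n. FT \<phi> (\<xi> + zz n) * ee (zz n * x))"
proof -
  have [measurable]: "\<phi> \<in> borel_measurable borel" using \<phi> by auto
  define u where "u x = \<phi> x * ee (- (x * \<xi>))" for x
  have [measurable]: "u \<in> borel_measurable borel" unfolding u_def by measurable
  have u: "integrable lborel u" unfolding u_def by (intro integrable_mult_ee \<phi>) measurable
  define T where "T x = (\<Sum>n. FT \<phi> (\<xi> + zz n) * ee (zz n * x))" for x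
  have [measurable]: "T \<in> borel_measurable borel" unfolding T_def[abs_def] by measurable
  have smT: "summable (\<lambda>n. cmod (FT \<phi> (\<xi> + zz n) * ee (zz n * x)))" for x
    using sm by (simp add: norm_mult)
  define U where "U x = indicator UI x *\<^sub>R (\<Sum>n. u (x + zz n))" for x
  define W where "W x = indicator UI x *\<^sub>R T x" for x
  have U: "integrable lborel U" unfolding U_def by (rule fold_complex(2)[OF u])
  define b where "b = (\<Sum>n. cmod (FT \<phi> (\<xi> + zz n)))"
  have iUI: "integrable lborel (\<lambda>x. indicator UI x *\<^sub>R v x)"
    if [measurable]: "v \<in> borel_measurable borel" and "\<And>x. cmod (v x) \<le> c" for v c
  proof (rule Bochner_Integration.integrable_bound)
    show "integrable lborel (\<lambda>x. c * indicator UI x :: real)" by (simp add: less_top[symmetric])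
    show "AE x in lborel. cmod (indicator UI x *\<^sub>R v x) \<le> norm (c * indicator UI x :: real)"
      by (intro AE_I2) (auto simp: indicator_def intro: order_trans[OF that(2) abs_ge_self])
  qed measurable
  have Tb: "cmod (T x) \<le> b" for x
    unfolding T_def b_def using summable_norm[OF smT[of x]] by (simp add: norm_mult)
  have W: "integrable lborel W" unfolding W_def by (rule iUI[OF _ Tb]) measurable
  have cU: "(LINT x|lborel. U x * ee (of_int l * x)) = FT \<phi> (\<xi> - of_int l)" for l
  proof -
    have iu: "integrable lborel (\<lambda>x. u x * ee (of_int l * x))" by (rule integrable_mult_ee_linear[OF u])
    have "(LINT x|lborel. U x * ee (of_int l * x)) = (LINT x|lborel. indicator UI x *\<^sub>R (\<Sum>n. u (x + zz n) * ee (of_int l * (x + zz n))))"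
    proof (rule integral_cong_AE)
      show "AE x in lborel. U x * ee (of_int l * x) = indicator UI x *\<^sub>R (\<Sum>n. u (x + zz n) * ee (of_int l * (x + zz n)))"
        using fold_complex(1)[OF u]
      proof eventually_elim
        case (elim x)
        have "ee (of_int l * (x + zz n)) = ee (of_int l * x)" for n
          using ee_add_int[of "of_int l * x" "l * int_decode n"] by (simp add: zz_def distrib_left)
        then show ?case
          using suminf_mult2[OF summable_norm_cancel[OF elim], of "ee (of_int l * x)"] by (simp add: U_def)
      qed
      show "(\<lambda>x. U x * ee (of_int l * x)) \<in> borel_measurable lborel" unfolding U_def by measurable
    qed measurable
    also have "\<dots> = (LINT x|lborel. u x * ee (of_int l * x))" by (rule fold_complex(3)[OF iu])
    also have "\<dots> = FT \<phi> (\<xi> - of_int l)"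
    proof (unfold FT_def u_def, intro Bochner_Integration.integral_cong refl)
      fix x
      have "ee (- (x * (\<xi> - of_int l))) = ee (- (x * \<xi>)) * ee (of_int l * x)"
        by (simp add: right_diff_distrib mult.commute flip: ee_add)
      then show "\<phi> x * ee (- (x * \<xi>)) * ee (of_int l * x) = \<phi> x * ee (- (x * (\<xi> - of_int l)))" by simp
    qed
    finally show ?thesis .
  qed
  have cW: "(LINT x|lborel. W x * ee (of_int l * x)) = FT \<phi> (\<xi> - of_int l)" for l
  proof -
    define f where "f n x = FT \<phi> (\<xi> + zz n) * (indicator UI x *\<^sub>R ee (of_int (int_decode n + l) * x))" for n x
    have fi: "integrable lborel (f n)" for n
      unfolding f_def by (intro integrable_mult_right iUI[of _ 1]) auto
    have nf: "cmod (f n x) = cmod (FT \<phi> (\<xi> + zz n)) * indicator UI x" for n x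
      by (simp add: f_def norm_mult)
    have "W x * ee (of_int l * x) = (\<Sum>n. f n x)" for x
    proof -
      have "ee (of_int (int_decode n + l) * x) = ee (zz n * x) * ee (of_int l * x)" for n
        by (simp add: zz_def distrib_right ee_add)
      then have "f n x = indicator UI x *\<^sub>R (FT \<phi> (\<xi> + zz n) * ee (zz n * x) * ee (of_int l * x))" for n
        by (simp add: f_def)
      moreover have "(\<Sum>n. FT \<phi> (\<xi> + zz n) * ee (zz n * x) * ee (of_int l * x)) = T x * ee (of_int l * x)"
        unfolding T_def by (rule suminf_mult2[OF summable_norm_cancel[OF smT], symmetric])
      moreover have "summable (\<lambda>n. FT \<phi> (\<xi> + zz n) * ee (zz n * x) * ee (of_int l * x))"
        by (rule summable_mult2[OF summable_norm_cancel[OF smT]])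
      ultimately show ?thesis by (simp add: W_def suminf_scaleR_right[symmetric])
    qed
    then have "(LINT x|lborel. W x * ee (of_int l * x)) = (LINT x|lborel. (\<Sum>n. f n x))" by simp
    also have "\<dots> = (\<Sum>n. LINT x|lborel. f n x)"
    proof (rule integral_suminf[OF fi])
      show "AE x in lborel. summable (\<lambda>n. cmod (f n x))"
        unfolding nf by (intro AE_I2 summable_mult2 sm)
      show "summable (\<lambda>n. LINT x|lborel. cmod (f n x))"
        unfolding nf using sm by simp
    qed
    also have "\<dots> = (\<Sum>n. FT \<phi> (\<xi> + zz n) * (if int_decode n + l = 0 then 1 else 0))"
      unfolding f_def integral_mult_right_zero integral_ee_UI ..
    also have "\<dots> = (\<Sum>n\<in>{int_encode (- l)}. FT \<phi> (\<xi> + zz n) * (if int_decode n + l = 0 then 1 else 0))"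
    proof (rule suminf_finite)
      fix n assume "n \<notin> {int_encode (- l)}"
      then have "int_decode n \<noteq> - l" by (metis int_decode_inverse singletonI)
      then show "FT \<phi> (\<xi> + zz n) * (if int_decode n + l = 0 then 1 else 0) = 0" by auto
    qed simp
    also have "\<dots> = FT \<phi> (\<xi> - of_int l)" by (simp add: zz_def)
    finally show ?thesis .
  qed
  have "AE x in lborel. U x - W x = 0"
  proof (rule circle_coefficients_unique)
    show "integrable lborel (\<lambda>x. U x - W x)" using U W by simp
    show "U x - W x = 0" if "x \<notin> UI" for x using that by (simp add: U_def W_def)
    show "(LINT x|lborel. (U x - W x) * ee (of_int l * x)) = 0" for l
      unfolding left_diff_distrib using cU[of l] cW[of l] integrable_mult_ee_linear[OF U] integrable_mult_ee_linear[OF W] by simp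
  qed
  with fold_complex(1)[OF u]
  have "AE x in lborel. x \<in> UI \<longrightarrow> summable (\<lambda>n. cmod (u (x + zz n))) \<and> (\<Sum>n. u (x + zz n)) = T x"
    by eventually_elim (auto simp: U_def W_def)
  then have "AE x in lborel. summable (\<lambda>n. cmod (u (x + zz n))) \<and> (\<Sum>n. u (x + zz n)) = T x"
  proof (rule AE_periodic[rotated 2])
    show "Measurable.pred borel (\<lambda>x. summable (\<lambda>n. cmod (u (x + zz n))) \<and> (\<Sum>n. u (x + zz n)) = T x)"
      by measurable
    fix x and k :: int
    assume *: "summable (\<lambda>n. cmod (u (x + zz n))) \<and> (\<Sum>n. u (x + zz n)) = T x"
    have "ee (zz n * (x + of_int k)) = ee (zz n * x)" for n
      using ee_add_int[of "zz n * x" "int_decode n * k"] by (simp add: zz_def distrib_left)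
    then have "T (x + of_int k) = T x" by (simp add: T_def)
    with * suminf_zz_shift_complex[of u x k]
    show "summable (\<lambda>n. cmod (u (x + of_int k + zz n))) \<and> (\<Sum>n. u (x + of_int k + zz n)) = T (x + of_int k)"
      by simp
  qed
  then show ?thesis by eventually_elim (simp add: u_def T_def)
qed

text \<open>The exceptional set of x in \<open>Poisson_summation_AE\<close> depends on \<xi>. Later
  x is fixed and the integration runs over \<xi>, so the two quantifiers are exchanged, which joint
  measurability allows.\<close>

lemma Poisson_summation_AE_swap:
  assumes \<phi>: "integrable lborel \<phi>"
    and sm: "\<And>\<xi>. \<bar>\<xi>\<bar> < \<delta> \<Longrightarrow> summable (\<lambda>n. cmod (FT \<phi> (\<xi> + zz n)))"
  shows "AE x in lborel. AE \<xi> in lborel. \<bar>\<xi>\<bar> < \<delta> \<longrightarrow>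
    (\<Sum>n. \<phi> (x + zz n) * ee (- ((x + zz n) * \<xi>))) = (\<Sum>n. FT \<phi> (\<xi> + zz n) * ee (zz n * x))"
proof -
  have [measurable]: "\<phi> \<in> borel_measurable borel" using \<phi> by auto
  have [measurable]: "FT \<phi> \<in> borel_measurable borel" by measurable
  have "AE \<xi> in lborel. AE x in lborel. \<bar>\<xi>\<bar> < \<delta> \<longrightarrow>
    (\<Sum>n. \<phi> (x + zz n) * ee (- ((x + zz n) * \<xi>))) = (\<Sum>n. FT \<phi> (\<xi> + zz n) * ee (zz n * x))"
  proof (rule AE_I2)
    fix \<xi>
    show "AE x in lborel. \<bar>\<xi>\<bar> < \<delta> \<longrightarrow>
      (\<Sum>n. \<phi> (x + zz n) * ee (- ((x + zz n) * \<xi>))) = (\<Sum>n. FT \<phi> (\<xi> + zz n) * ee (zz n * x))"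
      using Poisson_summation_AE[OF \<phi> sm, of \<xi>] by (cases "\<bar>\<xi>\<bar> < \<delta>") auto
  qed
  then show ?thesis
    by (subst lborel_pair.AE_commute) measurable
qed

text \<open>The mean value inequality is iterated, each step gaining a factor \<open>|x|\<close>;
  the factorial is given away. The derivatives are passed as a family F so that finite combinations
  of translates fit without computing their \<open>nderiv\<close>.\<close>

lemma taylor_zero_bound:
  fixes F :: "nat \<Rightarrow> real \<Rightarrow> complex"
  assumes "\<And>k x. k < n \<Longrightarrow> \<bar>x\<bar> < \<delta> \<Longrightarrow> (F k has_vector_derivative F (Suc k) x) (at x)"
    and "\<And>k. k < n \<Longrightarrow> F k 0 = 0"
    and "\<And>x. \<bar>x\<bar> < \<delta> \<Longrightarrow> cmod (F n x) \<le> K"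
    and "\<bar>x\<bar> < \<delta>"
  shows "cmod (F 0 x) \<le> K * \<bar>x\<bar> ^ n"
  using assms
proof (induction n arbitrary: F x)
  case (Suc n)
  have IH: "cmod (F 1 y) \<le> K * \<bar>y\<bar> ^ n" if "\<bar>y\<bar> < \<delta>" for y
    using Suc.IH[of "\<lambda>k. F (Suc k)" y] Suc.prems that by simp
  have "K \<ge> 0" using order_trans[OF norm_ge_zero Suc.prems(3)[OF Suc.prems(4)]] .
  define S where "S = {- \<bar>x\<bar>..\<bar>x\<bar>}"
  have "cmod (F 0 x - F 0 0) \<le> K * \<bar>x\<bar> ^ n * norm (x - 0)"
  proof (rule differentiable_bound[where S = S and f' = "\<lambda>y h. h *\<^sub>R F 1 y"])
    show "(F 0 has_derivative (\<lambda>h. h *\<^sub>R F 1 y)) (at y within S)" if "y \<in> S" for y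
    proof -
      have "\<bar>y\<bar> < \<delta>" using that Suc.prems(4) by (auto simp: S_def)
      then show ?thesis
        using Suc.prems(1)[of 0 y] by (simp add: has_vector_derivative_def has_derivative_at_withinI)
    qed
    show "onorm (\<lambda>h. h *\<^sub>R F 1 y) \<le> K * \<bar>x\<bar> ^ n" if "y \<in> S" for y
    proof (rule onorm_bound)
      have "\<bar>y\<bar> \<le> \<bar>x\<bar>" using that by (auto simp: S_def)
      have "cmod (F 1 y) \<le> K * \<bar>y\<bar> ^ n" using IH[of y] \<open>\<bar>y\<bar> \<le> \<bar>x\<bar>\<close> Suc.prems(4) by simp
      also have "\<dots> \<le> K * \<bar>x\<bar> ^ n" using \<open>\<bar>y\<bar> \<le> \<bar>x\<bar>\<close> \<open>K \<ge> 0\<close> by (intro mult_left_mono power_mono) auto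
      finally show "norm (h *\<^sub>R F 1 y) \<le> K * \<bar>x\<bar> ^ n * norm h" for h
        by (simp add: mult.commute[of _ "\<bar>h\<bar>"] mult_left_mono)
    qed (use \<open>K \<ge> 0\<close> in simp)
  qed (auto simp: S_def)
  then show ?case using Suc.prems(2)[of 0] by (simp add: mult_ac)
qed simp

lemma nderiv_0 [simp]: "nderiv 0 F = F"
  by (simp add: nderiv_def)

lemma nderiv_Suc: "nderiv (Suc k) F = (\<lambda>x. vector_derivative (nderiv k F) (at x))"
  by (simp add: nderiv_def)

lemma nderiv_has_vector_derivative:
  "nderiv k F differentiable (at x) \<Longrightarrow> (nderiv k F has_vector_derivative nderiv (Suc k) F x) (at x)"
  by (simp add: nderiv_Suc vector_derivative_works)

text \<open>Smoothness is known for H but the vanishing at 0 for \<open>1 - H\<close>. The set is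
  open because each derivative is formed from values of the previous one near the point.\<close>

lemma nderiv_one_minus:
  assumes "open S" and d: "\<And>k x. k < n \<Longrightarrow> x \<in> S \<Longrightarrow> nderiv k H differentiable (at x)"
    and "k \<le> n" "x \<in> S"
  shows "nderiv k (\<lambda>x. 1 - H x) x = (if k = 0 then 1 else 0) - nderiv k H x"
  using assms(3,4)
proof (induction k arbitrary: x)
  case (Suc k)
  have "((\<lambda>y. (if k = 0 then 1 else 0) - nderiv k H y) has_vector_derivative 0 - nderiv (Suc k) H x) (at x)"
    using Suc.prems by (intro has_vector_derivative_diff has_vector_derivative_const nderiv_has_vector_derivative d) auto
  then have "(nderiv k (\<lambda>x. 1 - H x) has_vector_derivative 0 - nderiv (Suc k) H x) (at x)"
    by (rule has_vector_derivative_transform_within_open[OF _ \<open>open S\<close> Suc.prems(2)]) (use Suc in auto)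
  then show ?case by (simp add: nderiv_Suc[of k "\<lambda>x. 1 - H x"] vector_derivative_at)
qed simp

lemma one_minus_bound:
  assumes bd: "boundedly_differentiable n H {\<xi>. \<bar>\<xi>\<bar> < \<delta>}" and "n \<ge> 1" "\<delta> > 0"
    and z: "\<And>\<beta>. \<beta> < n \<Longrightarrow> nderiv \<beta> (\<lambda>\<xi>. 1 - H \<xi>) 0 = 0"
  shows "\<exists>K\<ge>0. \<forall>\<xi>. \<bar>\<xi>\<bar> < \<delta> \<longrightarrow> cmod (1 - H \<xi>) \<le> K * \<bar>\<xi>\<bar> ^ n"
proof -
  let ?S = "{\<xi>. \<bar>\<xi>\<bar> < \<delta>}"
  have "open ?S" using open_ball[of "0::real" \<delta>] by (simp add: ball_def dist_norm)
  have d: "nderiv k H differentiable (at x)" if "k < n" "x \<in> ?S" for k x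
    using bd that by (auto simp: boundedly_differentiable_def)
  define F where "F k x = (if k = 0 then 1 else 0) - nderiv k H x" for k x
  have Fd: "F k x = nderiv k (\<lambda>x. 1 - H x) x" if "k \<le> n" "\<bar>x\<bar> < \<delta>" for k x
    unfolding F_def using nderiv_one_minus[OF \<open>open ?S\<close> d that(1)] that(2) by simp
  obtain K where K: "\<And>x. \<bar>x\<bar> < \<delta> \<Longrightarrow> cmod (nderiv n H x) \<le> K"
  proof -
    have "bounded (nderiv n H ` ?S)" using bd by (simp add: boundedly_differentiable_def)
    then obtain K where "\<forall>y\<in>nderiv n H ` ?S. cmod y \<le> K" unfolding bounded_iff ..
    then show thesis using that[of K] by simp
  qed
  have "K \<ge> 0" using order_trans[OF norm_ge_zero K[of 0]] \<open>\<delta> > 0\<close> by simp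
  moreover have "cmod (F 0 x) \<le> K * \<bar>x\<bar> ^ n" if "\<bar>x\<bar> < \<delta>" for x
  proof (rule taylor_zero_bound[OF _ _ _ that])
    show "(F k has_vector_derivative F (Suc k) x) (at x)" if "k < n" "\<bar>x\<bar> < \<delta>" for k x
    proof -
      have "((\<lambda>y. (if k = 0 then 1 else 0) - nderiv k H y) has_vector_derivative 0 - nderiv (Suc k) H x) (at x)"
        using that by (intro has_vector_derivative_diff has_vector_derivative_const nderiv_has_vector_derivative d) auto
      then show ?thesis by (simp add: F_def[abs_def])
    qed
    show "F k 0 = 0" if "k < n" for k using Fd[of k 0] z[of k] that \<open>\<delta> > 0\<close> by simp
    show "cmod (F n x) \<le> K" if "\<bar>x\<bar> < \<delta>" for x using K[OF that] \<open>n \<ge> 1\<close> by (simp add: F_def)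
  qed
  ultimately show ?thesis by (auto simp: F_def)
qed

text \<open>Taylor's formula is applied to one combination of translates with unimodular coefficients
  \<open>\<theta> l\<close> chosen so that its value at \<open>\<xi>\<close> is the sum of the moduli.\<close>

lemma translates_sum_bound:
  assumes bd: "\<And>l::int. l \<noteq> 0 \<Longrightarrow> boundedly_differentiable n G {\<xi>. \<bar>\<xi> + of_int l\<bar> < \<delta>}"
    and z: "\<And>(l::int) \<beta>. l \<noteq> 0 \<Longrightarrow> \<beta> < n \<Longrightarrow> nderiv \<beta> G (of_int l) = 0"
    and K: "\<And>\<xi>. \<bar>\<xi>\<bar> < \<delta> \<Longrightarrow> (\<Sum>\<^sub>\<infinity>l\<in>UNIV - {0::int}. ennreal (cmod (nderiv n G (\<xi> + of_int l)))) \<le> ennreal K"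
    and L: "finite L" "0 \<notin> L" and "K \<ge> 0" and \<xi>: "\<bar>\<xi>\<bar> < \<delta>"
  shows "(\<Sum>l\<in>L. cmod (G (\<xi> + of_int l))) \<le> K * \<bar>\<xi>\<bar> ^ n"
proof -
  define \<theta> where "\<theta> l = cnj (sgn (G (\<xi> + of_int l)))" for l :: int
  have \<theta>: "cmod (\<theta> l) \<le> 1" for l by (simp add: \<theta>_def norm_sgn)
  have \<theta>G: "\<theta> l * G (\<xi> + of_int l) = of_real (cmod (G (\<xi> + of_int l)))" for l
  proof (cases "G (\<xi> + of_int l) = 0")
    case False
    have "G (\<xi> + of_int l) * cnj (G (\<xi> + of_int l)) = of_real ((cmod (G (\<xi> + of_int l)))\<^sup>2)"
      by (simp only: complex_norm_square)
    then show ?thesis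
      using False by (simp add: \<theta>_def sgn_eq field_simps power2_eq_square)
  qed (simp add: \<theta>_def)
  define F where "F k x = (\<Sum>l\<in>L. \<theta> l * nderiv k G (x + of_int l))" for k x
  have "cmod (F 0 \<xi>) \<le> K * \<bar>\<xi>\<bar> ^ n"
  proof (rule taylor_zero_bound[OF _ _ _ \<xi>])
    show "(F k has_vector_derivative F (Suc k) x) (at x)" if "k < n" "\<bar>x\<bar> < \<delta>" for k x
      unfolding F_def[abs_def]
    proof (intro has_vector_derivative_sum has_vector_derivative_mult_right)
      fix l assume "l \<in> L"
      then have "l \<noteq> 0" using L by auto
      \<comment> \<open>The hypothesis with index l concerns a neighbourhood of \<open>- l\<close>,
        hence the sign.\<close>
      then have "\<forall>y. \<bar>y - of_int l\<bar> < \<delta> \<longrightarrow> nderiv k G differentiable (at y)"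
        using bd[of "- l"] \<open>k < n\<close> by (simp add: boundedly_differentiable_def)
      then have "nderiv k G differentiable (at (x + of_int l))" using that by simp
      then have "(nderiv k G has_vector_derivative nderiv (Suc k) G (x + of_int l)) (at (x + of_int l))"
        by (rule nderiv_has_vector_derivative)
      moreover have "((\<lambda>x. x + of_int l) has_vector_derivative 1) (at x)"
        by (auto intro!: derivative_eq_intros)
      ultimately show "((\<lambda>x. nderiv k G (x + of_int l)) has_vector_derivative nderiv (Suc k) G (x + of_int l)) (at x)"
        using vector_diff_chain_at[of "\<lambda>x. x + of_int l" 1 x "nderiv k G"] by (simp add: o_def)
    qed
    show "F k 0 = 0" if "k < n" for k
      unfolding F_def
    proof (intro sum.neutral ballI)
      fix l assume "l \<in> L"
      then have "l \<noteq> 0" using L by auto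
      then show "\<theta> l * nderiv k G (0 + of_int l) = 0" using z[of l k] that by simp
    qed
    show "cmod (F n x) \<le> K" if "\<bar>x\<bar> < \<delta>" for x
    proof -
      have "cmod (F n x) \<le> (\<Sum>l\<in>L. cmod (\<theta> l * nderiv n G (x + of_int l)))" unfolding F_def by (rule norm_sum)
      also have "\<dots> \<le> (\<Sum>l\<in>L. cmod (nderiv n G (x + of_int l)))"
        using \<theta> by (intro sum_mono) (auto simp: norm_mult intro!: mult_left_le_one_le)
      finally have "ennreal (cmod (F n x)) \<le> ennreal (\<Sum>l\<in>L. cmod (nderiv n G (x + of_int l)))"
        by (rule ennreal_leI)
      also have "\<dots> = (\<Sum>l\<in>L. ennreal (cmod (nderiv n G (x + of_int l))))" by simp
      \<comment> \<open>A finite subsum lies below the full sum, so the same K serves every finite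
        L.\<close>
      also have "\<dots> \<le> (\<Sum>\<^sub>\<infinity>l\<in>UNIV - {0::int}. ennreal (cmod (nderiv n G (x + of_int l))))"
        using L by (subst nonneg_infsum_complete) (auto intro!: SUP_upper)
      also have "\<dots> \<le> ennreal K" by (rule K[OF that])
      finally show ?thesis using \<open>K \<ge> 0\<close> by simp
    qed
  qed
  moreover have "F 0 \<xi> = of_real (\<Sum>l\<in>L. cmod (G (\<xi> + of_int l)))"
    by (simp add: F_def \<theta>G)
  moreover have "0 \<le> (\<Sum>l\<in>L. cmod (G (\<xi> + of_int l)))" by (intro sum_nonneg) simp
  ultimately show ?thesis by (simp del: of_real_sum)
qed

section \<open>Weak derivatives\<close>

text \<open>The statement speaks of Lebesgue measure, whereas iterated integrals are handled on
  products of the Borel sets. Functions are therefore replaced by Borel functions that agree with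
  them almost everywhere.\<close>

lemma borel_representative:
  fixes f :: "real \<Rightarrow> complex"
  assumes [measurable]: "f \<in> borel_measurable lebesgue"
  obtains f0 where "f0 \<in> borel_measurable borel" "AE x in lborel. f x = f0 x"
proof -
  have "(\<lambda>x. Re (f x)) \<in> borel_measurable lebesgue" "(\<lambda>x. Im (f x)) \<in> borel_measurable lebesgue"
    by measurable
  from this[THEN completion_ex_borel_measurable_real] obtain a b where ab[measurable]: "a \<in> borel_measurable lborel" "b \<in> borel_measurable lborel"
    and ae: "AE x in lborel. Re (f x) = a x" "AE x in lborel. Im (f x) = b x" by blast
  show thesis
  proof (rule that[of "\<lambda>x. Complex (a x) (b x)"])
    have "(\<lambda>x. of_real (a x) + \<i> * of_real (b x)) \<in> borel_measurable borel" using ab by simp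
    then show "(\<lambda>x. Complex (a x) (b x)) \<in> borel_measurable borel" by (simp only: Complex_eq)
    show "AE x in lborel. f x = Complex (a x) (b x)" using ae by eventually_elim (simp add: complex_eq_iff)
  qed
qed

lemma lebesgue_integral_representative:
  fixes f :: "real \<Rightarrow> complex"
  assumes "f \<in> borel_measurable lebesgue" "f0 \<in> borel_measurable borel" "AE x in lborel. f x = f0 x"
  shows "integrable lebesgue f \<longleftrightarrow> integrable lborel f0"
    and "(LINT x|lebesgue. f x) = (LINT x|lborel. f0 x)"
proof -
  have ae: "AE x in lebesgue. f x = f0 x" using assms(3) by (rule AE_completion)
  have m: "f0 \<in> borel_measurable lborel" using assms(2) by simp
  have m': "f0 \<in> borel_measurable lebesgue" using m by (rule measurable_completion)
  show "integrable lebesgue f \<longleftrightarrow> integrable lborel f0"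
    using integrable_cong_AE[OF assms(1) m' ae] integrable_completion[OF m] by simp
  show "(LINT x|lebesgue. f x) = (LINT x|lborel. f0 x)"
    using integral_cong_AE[OF assms(1) m' ae] integral_completion[OF m] by simp
qed

text \<open>For polynomials P these functions are closed under differentiation: P becomes
  \<open>X\<^sup>2 * (P - P')\<close>. The constant polynomial 1 gives the classical smooth function
  that is flat at 0.\<close>

definition flat_exp :: "real poly \<Rightarrow> real \<Rightarrow> real" where
  "flat_exp P x = (if x > 0 then poly P (inverse x) * exp (- inverse x) else 0)"

lemma flat_exp_has_real_derivative:
  "(flat_exp P has_real_derivative flat_exp ([:0, 0, 1:] * (P - pderiv P)) x) (at x)"
proof (cases x "0 :: real" rule: linorder_cases)
  case less
  have "((\<lambda>_. 0) has_real_derivative 0) (at x)" by simp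
  then have "(flat_exp P has_real_derivative 0) (at x)"
    by (rule has_field_derivative_transform_within_open[where S = "{..<0}"]) (use less in \<open>auto simp: flat_exp_def\<close>)
  then show ?thesis using less by (simp add: flat_exp_def)
next
  case greater
  have "((\<lambda>x. poly P (inverse x) * exp (- inverse x)) has_real_derivative
      poly ([:0, 0, 1:] * (P - pderiv P)) (inverse x) * exp (- inverse x)) (at x)"
    using greater by (auto intro!: derivative_eq_intros DERIV_chain2[OF poly_DERIV]
        simp: algebra_simps power2_eq_square divide_simps)
  then have "(flat_exp P has_real_derivative poly ([:0, 0, 1:] * (P - pderiv P)) (inverse x) * exp (- inverse x)) (at x)"
    by (rule has_field_derivative_transform_within_open[where S = "{0<..}"]) (use greater in \<open>auto simp: flat_exp_def\<close>)
  then show ?thesis using greater by (simp add: flat_exp_def)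
next
  case equal
  \<comment> \<open>In the variable \<open>y = 1 / h\<close> the right difference quotient at 0 is a
    polynomial divided by \<open>exp y\<close>.\<close>
  have "((\<lambda>y. poly Q y / exp y) \<longlongrightarrow> 0) at_top" for Q :: "real poly"
  proof -
    have "((\<lambda>y. \<Sum>i\<le>degree Q. coeff Q i * (y ^ i / exp y)) \<longlongrightarrow> (\<Sum>i\<le>degree Q. coeff Q i * 0)) at_top"
      by (intro tendsto_intros tendsto_power_div_exp_0)
    then show ?thesis by (simp add: poly_altdef sum_divide_distrib)
  qed
  from filterlim_compose[OF this[of "[:0, 1:] * P"] filterlim_inverse_at_top_right]
  have "((\<lambda>h. poly ([:0, 1:] * P) (inverse h) / exp (inverse h)) \<longlongrightarrow> 0) (at_right 0)" .
  then have r: "((\<lambda>h. flat_exp P h / h) \<longlongrightarrow> 0) (at_right 0)"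
    by (rule Lim_transform_eventually)
      (auto simp: eventually_at_right_field flat_exp_def exp_minus field_simps intro!: exI[of _ 1])
  have l: "((\<lambda>h. flat_exp P h / h) \<longlongrightarrow> 0) (at_left 0)"
    by (rule tendsto_eventually) (auto simp: eventually_at_left_field flat_exp_def intro!: exI[of _ "-1"])
  have "((\<lambda>h. flat_exp P h / h) \<longlongrightarrow> 0) (at 0)"
    using l r by (simp add: filterlim_split_at)
  then show ?thesis using equal by (simp add: DERIV_def flat_exp_def)
qed

text \<open>A class of functions that is closed under differentiation and contains a bump function, so that
  smoothness comes for free.\<close>

inductive_set bumps :: "(real \<Rightarrow> complex) set" where
  prod: "(\<lambda>x. of_real (flat_exp P (1 + x) * flat_exp Q (1 - x))) \<in> bumps"
| diff: "F \<in> bumps \<Longrightarrow> G \<in> bumps \<Longrightarrow> (\<lambda>x. F x - G x) \<in> bumps"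

lemma bumps_derivative:
  assumes "F \<in> bumps"
  shows "\<exists>F'\<in>bumps. \<forall>x. (F has_vector_derivative F' x) (at x)"
  using assms
proof induction
  case (prod P Q)
  let ?P = "[:0, 0, 1:] * (P - pderiv P)" and ?Q = "[:0, 0, 1:] * (Q - pderiv Q)"
  have "((\<lambda>x. of_real (flat_exp P (1 + x) * flat_exp Q (1 - x))) has_vector_derivative
    complex_of_real (flat_exp ?P (1 + x) * flat_exp Q (1 - x)) - of_real (flat_exp P (1 + x) * flat_exp ?Q (1 - x))) (at x)" for x
  proof -
    have "((\<lambda>x. flat_exp P (1 + x)) has_real_derivative flat_exp ?P (1 + x) * 1) (at x)"
      by (rule DERIV_chain2[OF flat_exp_has_real_derivative]) (auto intro!: derivative_eq_intros)
    moreover have "((\<lambda>x. flat_exp Q (1 - x)) has_real_derivative flat_exp ?Q (1 - x) * (- 1)) (at x)"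
      by (rule DERIV_chain2[OF flat_exp_has_real_derivative]) (auto intro!: derivative_eq_intros)
    ultimately have "((\<lambda>x. flat_exp P (1 + x) * flat_exp Q (1 - x)) has_real_derivative
        flat_exp ?P (1 + x) * flat_exp Q (1 - x) - flat_exp P (1 + x) * flat_exp ?Q (1 - x)) (at x)"
      using DERIV_mult by (fastforce simp: algebra_simps)
    then have "((\<lambda>x. of_real (flat_exp P (1 + x) * flat_exp Q (1 - x))) has_vector_derivative
        complex_of_real (flat_exp ?P (1 + x) * flat_exp Q (1 - x) - flat_exp P (1 + x) * flat_exp ?Q (1 - x))) (at x)"
      by (intro has_vector_derivative_of_real) (simp add: has_real_derivative_iff_has_vector_derivative)
    then show ?thesis by (simp only: of_real_diff)
  qed
  then show ?case by (intro bexI[of _ "\<lambda>x. of_real (flat_exp ?P (1 + x) * flat_exp Q (1 - x)) - of_real (flat_exp P (1 + x) * flat_exp ?Q (1 - x))"])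
      (blast, intro bumps.intros)
next
  case (diff F G)
  then obtain F' G' where "F' \<in> bumps" "G' \<in> bumps" "\<And>x. (F has_vector_derivative F' x) (at x)" "\<And>x. (G has_vector_derivative G' x) (at x)"
    by blast
  then show ?case
    by (intro bexI[of _ "\<lambda>x. F' x - G' x"]) (auto intro: bumps.intros has_vector_derivative_diff)
qed

lemma nderiv_bumps: "F \<in> bumps \<Longrightarrow> nderiv k F \<in> bumps"
proof (induction k)
  case (Suc k)
  then obtain F' where F': "F' \<in> bumps" "\<And>x. (nderiv k F has_vector_derivative F' x) (at x)"
    using bumps_derivative by blast
  then have "nderiv (Suc k) F = F'" by (auto simp: nderiv_Suc vector_derivative_at)
  then show ?case using F' by simp
qed simp

lemma nderiv_bumps_derivative:
  "F \<in> bumps \<Longrightarrow> (nderiv k F has_vector_derivative nderiv (Suc k) F x) (at x)"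
  using bumps_derivative[OF nderiv_bumps] nderiv_has_vector_derivative
  by (meson differentiableI_vector)

lemma bumps_vanish: "F \<in> bumps \<Longrightarrow> 1 \<le> \<bar>x\<bar> \<Longrightarrow> F x = 0"
  by (induction rule: bumps.induct) (auto simp: flat_exp_def)

lemma bumps_continuous: "F \<in> bumps \<Longrightarrow> continuous_on S F"
  using bumps_derivative by (meson continuous_at_imp_continuous_on has_vector_derivative_continuous)

lemma bumps_bounded:
  assumes "F \<in> bumps"
  obtains b where "\<And>x. cmod (F x) \<le> b"
proof -
  have "compact (F ` {-1..1})" by (intro compact_continuous_image bumps_continuous assms) auto
  then have "bounded (F ` {-1..1})" by (rule compact_imp_bounded)
  then obtain b where b: "\<forall>y\<in>F ` {-1..1}. cmod y \<le> b" unfolding bounded_iff ..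
  show thesis
  proof (rule that[of "max 0 b"])
    fix x show "cmod (F x) \<le> max 0 b"
    proof (cases "\<bar>x\<bar> \<le> 1")
      case True
      then show ?thesis using b by (force simp: abs_le_iff)
    qed (simp add: bumps_vanish[OF assms])
  qed
qed

section \<open>Cut-off exponentials as test functions\<close>

definition bump :: "real \<Rightarrow> complex" where
  "bump = (\<lambda>x. of_real (flat_exp 1 (1 + x) * flat_exp 1 (1 - x)))"

lemma bump_in_bumps [simp]: "bump \<in> bumps"
  unfolding bump_def by (rule bumps.prod)

lemma bump_nonzero: "\<bar>x\<bar> < 1 \<Longrightarrow> bump x \<noteq> 0"
  by (auto simp: bump_def flat_exp_def)

text \<open>An exponential cut off at distance \<open>1 / s\<close>; as s tends to 0 it approaches
  \<open>bump 0\<close> times the full exponential.\<close>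

definition wave :: "complex \<Rightarrow> real \<Rightarrow> real \<Rightarrow> complex" where
  "wave c s x = bump (s * x) * exp (c * of_real x)"

lemma exp_has_vector_derivative:
  fixes c :: complex
  shows "((\<lambda>x. exp (c * of_real x)) has_vector_derivative c * exp (c * of_real x)) (at x)"
proof -
  have "((\<lambda>z. exp (c * z)) has_field_derivative c * exp (c * of_real x)) (at (of_real x))"
    by (auto intro!: derivative_eq_intros)
  then show ?thesis by (rule has_vector_derivative_real_field)
qed

lemma scale_has_vector_derivative: "((\<lambda>x. s * x) has_vector_derivative s) (at x)" for s :: real
  using DERIV_cmult_Id[of s x UNIV] by (simp add: has_real_derivative_iff_has_vector_derivative)

text \<open>Each derivative that falls on the bump brings a factor s, and the coefficients do not
  depend on s. As s tends to 0 only the term with i = 0 remains, whose coefficient is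
  \<open>c ^ k\<close>. That a vanishes beyond k serves the induction.\<close>

lemma wave_nderiv:
  "\<exists>a. a 0 = c ^ k \<and> (\<forall>i>k. a i = 0) \<and>
    (\<forall>s. nderiv k (wave c s) = (\<lambda>x. exp (c * of_real x) * (\<Sum>i\<le>k. a i * of_real s ^ i * nderiv i bump (s * x))) \<and>
      (\<forall>x. nderiv k (wave c s) differentiable (at x)))"
proof (induction k)
  case 0
  have "wave c s differentiable (at x)" for s x
  proof -
    have "((\<lambda>x. bump (s * x)) has_vector_derivative s *\<^sub>R nderiv 1 bump (s * x)) (at x)"
      using vector_diff_chain_at[OF scale_has_vector_derivative nderiv_bumps_derivative[OF bump_in_bumps, of 0]]
      by (simp add: o_def)
    from has_vector_derivative_mult[OF this exp_has_vector_derivative]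
    show ?thesis unfolding wave_def[abs_def] by (rule differentiableI_vector)
  qed
  moreover have "wave c s = (\<lambda>x. exp (c * of_real x) * bump (s * x))" for s
    by (simp add: wave_def fun_eq_iff)
  ultimately show ?case
    by (intro exI[of _ "\<lambda>i. if i = 0 then 1 else 0"]) simp
next
  case (Suc k)
  then obtain a where a: "a 0 = c ^ k" "\<And>i. i > k \<Longrightarrow> a i = 0"
    and n: "\<And>s. nderiv k (wave c s) = (\<lambda>x. exp (c * of_real x) * (\<Sum>i\<le>k. a i * of_real s ^ i * nderiv i bump (s * x)))"
    by blast
  define a' where "a' i = c * a i + (case i of 0 \<Rightarrow> 0 | Suc j \<Rightarrow> a j)" for i
  define E where "E s x = exp (c * of_real x) * (\<Sum>i\<le>Suc k. a' i * of_real s ^ i * nderiv i bump (s * x))" for s x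
  have comp: "((\<lambda>x. nderiv i bump (s * x)) has_vector_derivative of_real s * nderiv (Suc i) bump (s * x)) (at x)" for i s x
    using vector_diff_chain_at[OF scale_has_vector_derivative nderiv_bumps_derivative[OF bump_in_bumps, of i]]
    by (simp add: o_def scaleR_conv_of_real)
  have tm: "((\<lambda>x. \<Sum>i\<le>k. a i * of_real s ^ i * nderiv i bump (s * x)) has_vector_derivative
      (\<Sum>i\<le>k. a i * of_real s ^ i * (of_real s * nderiv (Suc i) bump (s * x)))) (at x)" for s x
    by (intro has_vector_derivative_sum has_vector_derivative_mult_right comp)
  have sums: "c * (\<Sum>i\<le>k. a i * X i) + (\<Sum>i\<le>k. a i * X (Suc i)) = (\<Sum>i\<le>Suc k. a' i * X i)" for X :: "nat \<Rightarrow> complex"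
  proof -
    have "(\<Sum>i\<le>Suc k. a' i * X i) = (\<Sum>i\<le>Suc k. c * a i * X i) + (\<Sum>i\<le>Suc k. (case i of 0 \<Rightarrow> 0 | Suc j \<Rightarrow> a j) * X i)"
      by (simp add: a'_def ring_distribs sum.distrib)
    also have "(\<Sum>i\<le>Suc k. c * a i * X i) = c * (\<Sum>i\<le>k. a i * X i)"
      using a(2)[of "Suc k"] by (simp add: sum_distrib_left mult.assoc)
    also have "(\<Sum>i\<le>Suc k. (case i of 0 \<Rightarrow> 0 | Suc j \<Rightarrow> a j) * X i) = (\<Sum>i\<le>k. a i * X (Suc i))"
      by (subst sum.atMost_Suc_shift) simp
    finally show ?thesis by simp
  qed
  have d: "(nderiv k (wave c s) has_vector_derivative E s x) (at x)" for s x
  proof -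
    let ?X = "\<lambda>i. of_real s ^ i * nderiv i bump (s * x)"
    have "(nderiv k (wave c s) has_vector_derivative
       exp (c * of_real x) * (\<Sum>i\<le>k. a i * of_real s ^ i * (of_real s * nderiv (Suc i) bump (s * x)))
       + c * exp (c * of_real x) * (\<Sum>i\<le>k. a i * of_real s ^ i * nderiv i bump (s * x))) (at x)"
      unfolding n by (intro has_vector_derivative_mult exp_has_vector_derivative tm)
    also have "exp (c * of_real x) * (\<Sum>i\<le>k. a i * of_real s ^ i * (of_real s * nderiv (Suc i) bump (s * x)))
       + c * exp (c * of_real x) * (\<Sum>i\<le>k. a i * of_real s ^ i * nderiv i bump (s * x))
       = exp (c * of_real x) * (c * (\<Sum>i\<le>k. a i * ?X i) + (\<Sum>i\<le>k. a i * ?X (Suc i)))"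
      by (simp add: ring_distribs mult_ac)
    also have "\<dots> = E s x" unfolding sums[of ?X] E_def by (simp only: mult.assoc)
    finally show ?thesis .
  qed
  have e: "nderiv (Suc k) (wave c s) = E s" for s
    using d by (auto simp: nderiv_Suc vector_derivative_at)
  have tm': "((\<lambda>x. \<Sum>i\<le>Suc k. a' i * of_real s ^ i * nderiv i bump (s * x)) has_vector_derivative
      (\<Sum>i\<le>Suc k. a' i * of_real s ^ i * (of_real s * nderiv (Suc i) bump (s * x)))) (at x)" for s x
    by (intro has_vector_derivative_sum has_vector_derivative_mult_right comp)
  have "E s differentiable (at x)" for s x
    unfolding E_def[abs_def] by (rule differentiableI_vector[OF has_vector_derivative_mult[OF exp_has_vector_derivative tm']])
  then show ?case
    using a by (intro exI[of _ a']) (auto simp: e E_def[abs_def] a'_def split: nat.splits)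
qed

lemma wave_test_function:
  assumes "s > 0"
  shows "test_function (wave c s)"
  unfolding test_function_def smooth_def
proof (intro conjI allI)
  show "nderiv k (wave c s) differentiable (at x)" for k x using wave_nderiv[of c k] by blast
  show "\<exists>R. \<forall>x. R < \<bar>x\<bar> \<longrightarrow> wave c s x = 0"
  proof (intro exI[of _ "1 / s"] allI impI)
    fix x assume "1 / s < \<bar>x\<bar>"
    then have "1 \<le> \<bar>s * x\<bar>" using assms by (simp add: field_simps abs_mult)
    then show "wave c s x = 0" by (simp add: wave_def bumps_vanish)
  qed
qed

lemma wave_measurable [measurable]: "wave c s \<in> borel_measurable borel"
proof -
  have [measurable]: "bump \<in> borel_measurable borel"
    by (rule borel_measurable_continuous_onI[OF bumps_continuous]) simp
  show ?thesis unfolding wave_def[abs_def] by measurable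
qed

text \<open>The exponential has no compact support, so the weak derivative is tested with
  \<open>wave c s\<close>. Dominated convergence as s tends to 0 leaves the transforms on both
  sides, times \<open>bump 0\<close>, which is nonzero and cancels.\<close>

theorem weak_deriv_FT:
  assumes wd: "weak_deriv r f g" and f: "integrable lebesgue f" and g: "integrable lebesgue g"
    and f0: "f0 \<in> borel_measurable borel" "AE x in lborel. f x = f0 x"
    and g0: "g0 \<in> borel_measurable borel" "AE x in lborel. g x = g0 x"
  shows "FT g0 \<xi> = (2 * pi * \<i> * \<xi>) ^ r * FT f0 \<xi>"
proof -
  have mf: "f \<in> borel_measurable lebesgue" and mg: "g \<in> borel_measurable lebesgue" using f g by auto
  note [measurable] = f0(1) g0(1)
  have if0: "integrable lborel f0" using lebesgue_integral_representative(1)[OF mf f0] f by simp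
  have ig0: "integrable lborel g0" using lebesgue_integral_representative(1)[OF mg g0] g by simp
  define c where "c = - (2 * pi * \<i> * \<xi>)"
  have ec: "exp (c * of_real x) = ee (- (x * \<xi>))" for x
    by (simp add: ee_eq_exp c_def mult_ac)
  obtain a where a: "a 0 = c ^ r"
    and n: "\<And>s. nderiv r (wave c s) = (\<lambda>x. exp (c * of_real x) * (\<Sum>i\<le>r. a i * of_real s ^ i * nderiv i bump (s * x)))"
    using wave_nderiv[of c r] by blast
  have [measurable]: "nderiv i bump \<in> borel_measurable borel" for i
    by (rule borel_measurable_continuous_onI[OF bumps_continuous[OF nderiv_bumps]]) simp
  have [measurable]: "nderiv r (wave c s) \<in> borel_measurable borel" for s
    unfolding n by measurable
  have bc: "isCont (nderiv i bump) x" for i x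
    using nderiv_bumps_derivative[of bump i x] by (auto intro: has_vector_derivative_continuous)
  have "\<exists>b. \<forall>i x. i \<le> r \<longrightarrow> cmod (nderiv i bump x) \<le> b i"
  proof -
    have "\<exists>b. \<forall>x. cmod (nderiv i bump x) \<le> b" for i
      using bumps_bounded[OF nderiv_bumps[of bump i]] by (metis bump_in_bumps)
    then show ?thesis by metis
  qed
  then obtain b where b: "\<And>i x. i \<le> r \<Longrightarrow> cmod (nderiv i bump x) \<le> b i" by blast
  define s where "s m = inverse (real (Suc m))" for m
  have s: "0 < s m" "s m \<le> 1" for m by (auto simp: s_def field_simps)
  have s0: "s \<longlonglongrightarrow> 0" unfolding s_def by (rule LIMSEQ_inverse_real_of_nat)
  have tt: "(\<lambda>m. nderiv i bump (s m * x)) \<longlonglongrightarrow> nderiv i bump 0" for i x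
  proof (rule isCont_tendsto_compose[OF bc])
    show "(\<lambda>m. s m * x) \<longlonglongrightarrow> 0" using tendsto_mult_right[OF s0, of x] by simp
  qed
  have eq: "(LINT x|lborel. f0 x * nderiv r (wave c (s m)) x) = (- 1) ^ r * (LINT x|lborel. g0 x * wave c (s m) x)" for m
  proof -
    have "(LINT x|lebesgue. f x * nderiv r (wave c (s m)) x) = (LINT x|lborel. f0 x * nderiv r (wave c (s m)) x)"
    proof (rule lebesgue_integral_representative(2))
      show "AE x in lborel. f x * nderiv r (wave c (s m)) x = f0 x * nderiv r (wave c (s m)) x"
        using f0(2) by eventually_elim simp
      have "nderiv r (wave c (s m)) \<in> borel_measurable lebesgue"
        by (rule measurable_completion) simp
      then show "(\<lambda>x. f x * nderiv r (wave c (s m)) x) \<in> borel_measurable lebesgue" using mf by simp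
    qed measurable
    moreover have "(LINT x|lebesgue. g x * wave c (s m) x) = (LINT x|lborel. g0 x * wave c (s m) x)"
    proof (rule lebesgue_integral_representative(2))
      show "AE x in lborel. g x * wave c (s m) x = g0 x * wave c (s m) x"
        using g0(2) by eventually_elim simp
      have "wave c (s m) \<in> borel_measurable lebesgue"
        by (rule measurable_completion) simp
      then show "(\<lambda>x. g x * wave c (s m) x) \<in> borel_measurable lebesgue" using mg by simp
    qed measurable
    ultimately show ?thesis
      using wd wave_test_function[OF s(1)] by (simp add: weak_deriv_def)
  qed
  have L1: "(\<lambda>m. LINT x|lborel. f0 x * nderiv r (wave c (s m)) x) \<longlonglongrightarrow> (LINT x|lborel. f0 x * (ee (- (x * \<xi>)) * (c ^ r * bump 0)))"
  proof (rule integral_dominated_convergence)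
    define W where "W = (\<Sum>i\<le>r. cmod (a i) * b i)"
    show "integrable lborel (\<lambda>x. cmod (f0 x) * W)" using if0 by simp
    show "AE x in lborel. (\<lambda>m. f0 x * nderiv r (wave c (s m)) x) \<longlonglongrightarrow> f0 x * (ee (- (x * \<xi>)) * (c ^ r * bump 0))"
    proof (rule AE_I2)
      fix x
      have "(\<lambda>m. (\<Sum>i\<le>r. a i * of_real (s m) ^ i * nderiv i bump (s m * x))) \<longlonglongrightarrow> (\<Sum>i\<le>r. a i * of_real 0 ^ i * nderiv i bump 0)"
        by (intro tendsto_intros s0 tt)
      \<comment> \<open>Since \<open>0 ^ 0 = 1\<close>, exactly the term with i = 0
        survives.\<close>
      also have "(\<Sum>i\<le>r. a i * of_real 0 ^ i * nderiv i bump 0) = (\<Sum>i\<le>r. if i = 0 then a 0 * bump 0 else 0)"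
        by (intro sum.cong refl) auto
      also have "\<dots> = c ^ r * bump 0" by (simp add: a)
      finally show "(\<lambda>m. f0 x * nderiv r (wave c (s m)) x) \<longlonglongrightarrow> f0 x * (ee (- (x * \<xi>)) * (c ^ r * bump 0))"
        unfolding n ec by (intro tendsto_intros)
    qed
    show "AE x in lborel. cmod (f0 x * nderiv r (wave c (s m)) x) \<le> cmod (f0 x) * W" for m
    proof (rule AE_I2)
      fix x
      have "cmod (\<Sum>i\<le>r. a i * of_real (s m) ^ i * nderiv i bump (s m * x)) \<le> W"
        unfolding W_def
      proof (rule order_trans[OF norm_sum], intro sum_mono)
        fix i assume "i \<in> {..r}"
        have "\<bar>s m\<bar> ^ i \<le> 1" using s[of m] by (intro power_le_one) auto
        then have "cmod (a i) * \<bar>s m\<bar> ^ i * cmod (nderiv i bump (s m * x)) \<le> cmod (a i) * 1 * b i"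
          using b[of i] \<open>i \<in> {..r}\<close> by (intro mult_mono) auto
        then show "cmod (a i * of_real (s m) ^ i * nderiv i bump (s m * x)) \<le> cmod (a i) * b i"
          by (simp add: norm_mult norm_power)
      qed
      then show "cmod (f0 x * nderiv r (wave c (s m)) x) \<le> cmod (f0 x) * W"
        unfolding n ec by (simp add: norm_mult mult_left_mono)
    qed
  qed measurable
  have L2: "(\<lambda>m. LINT x|lborel. g0 x * wave c (s m) x) \<longlonglongrightarrow> (LINT x|lborel. g0 x * (bump 0 * ee (- (x * \<xi>))))"
  proof (rule integral_dominated_convergence)
    show "integrable lborel (\<lambda>x. cmod (g0 x) * b 0)" using ig0 by simp
    show "AE x in lborel. (\<lambda>m. g0 x * wave c (s m) x) \<longlonglongrightarrow> g0 x * (bump 0 * ee (- (x * \<xi>)))"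
      unfolding wave_def ec using tt[of 0] by (intro AE_I2 tendsto_intros) simp
    show "AE x in lborel. cmod (g0 x * wave c (s m) x) \<le> cmod (g0 x) * b 0" for m
      unfolding wave_def ec using b[of 0] by (intro AE_I2) (simp add: norm_mult mult_left_mono)
  qed measurable
  have "(LINT x|lborel. f0 x * (ee (- (x * \<xi>)) * (c ^ r * bump 0))) = (- 1) ^ r * (LINT x|lborel. g0 x * (bump 0 * ee (- (x * \<xi>))))"
    using LIMSEQ_unique[OF L1[unfolded eq] tendsto_mult_left[OF L2]] .
  moreover have "(LINT x|lborel. f0 x * (ee (- (x * \<xi>)) * (c ^ r * bump 0))) = (c ^ r * bump 0) * FT f0 \<xi>"
    unfolding FT_def integral_mult_right_zero[symmetric] by (simp add: mult_ac)
  moreover have "(LINT x|lborel. g0 x * (bump 0 * ee (- (x * \<xi>)))) = bump 0 * FT g0 \<xi>"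
    unfolding FT_def integral_mult_right_zero[symmetric] by (simp add: mult_ac)
  ultimately have "(c ^ r * bump 0) * FT f0 \<xi> = (- 1) ^ r * (bump 0 * FT g0 \<xi>)" by (simp only:)
  then have "bump 0 * (c ^ r * FT f0 \<xi>) = bump 0 * ((- 1) ^ r * FT g0 \<xi>)" by (simp only: mult_ac)
  then have "c ^ r * FT f0 \<xi> = (- 1) ^ r * FT g0 \<xi>" using bump_nonzero[of 0] by simp
  then have "(- 1) ^ r * ((- 1) ^ r * FT g0 \<xi>) = (- 1) ^ r * c ^ r * FT f0 \<xi>" by (simp only: mult.assoc)
  moreover have "(- 1) ^ r * c ^ r = (2 * pi * \<i> * \<xi>) ^ r"
    by (simp add: power_mult_distrib[symmetric] c_def)
  ultimately show ?thesis by (simp add: power_mult_distrib[symmetric] mult.assoc[symmetric])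
qed

text \<open>The integrable derivative of the Sobolev space and the Hoelder continuous one come from
  separate existence statements and have to be identified. Testing with every frequency at fixed s
  shows that the difference times \<open>bump (s * x)\<close> has transform 0, so the difference
  vanishes for \<open>|x| < 1 / s\<close>.\<close>

theorem weak_deriv_unique:
  assumes wd1: "weak_deriv r f g1" and wd2: "weak_deriv r f g2"
    and g1: "g1 \<in> borel_measurable lebesgue" and g2: "g2 \<in> borel_measurable lebesgue"
  shows "AE x in lborel. g1 x = g2 x"
proof -
  define u where "u x = g1 x - g2 x" for x
  have mu: "u \<in> borel_measurable lebesgue" unfolding u_def using g1 g2 by simp
  obtain u0 where u0[measurable]: "u0 \<in> borel_measurable borel" and uu: "AE x in lborel. u x = u0 x"
    using borel_representative[OF mu] by blast
  have loc: "set_integrable lebesgue {-R..R} g1" "set_integrable lebesgue {-R..R} g2" for R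
    using wd1 wd2 by (auto simp: weak_deriv_def locally_integrable_def)
  obtain b where b: "\<And>x. cmod (bump x) \<le> b" using bumps_bounded[of bump] by auto
  have iw: "integrable lebesgue (\<lambda>x. h x * wave c s x)"
    if h: "\<And>R. set_integrable lebesgue {-R..R} h" and "h \<in> borel_measurable lebesgue" and "s > 0" and c: "Re c = 0" for h c s
  proof (rule Bochner_Integration.integrable_bound)
    show "integrable lebesgue (\<lambda>x. b * norm (indicator {-(1/s)..1/s} x *\<^sub>R h x))"
      using h[of "1/s"] by (intro integrable_mult_right integrable_norm) (simp add: set_integrable_def)
    have "wave c s \<in> borel_measurable lebesgue" by (rule measurable_completion) simp
    then show "(\<lambda>x. h x * wave c s x) \<in> borel_measurable lebesgue" using that(2) by simp
    have "b \<ge> 0" using order_trans[OF norm_ge_zero b[of 0]] .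
    show "AE x in lebesgue. cmod (h x * wave c s x) \<le> norm (b * norm (indicator {-(1/s)..1/s} x *\<^sub>R h x))"
    proof (rule AE_I2)
      fix x
      show "cmod (h x * wave c s x) \<le> norm (b * norm (indicator {-(1/s)..1/s} x *\<^sub>R h x))"
      proof (cases "\<bar>x\<bar> \<le> 1 / s")
        case True
        then have "x \<in> {-(1/s)..1/s}" by auto
        then show ?thesis using c b[of "s * x"] \<open>b \<ge> 0\<close> 
          by (simp add: wave_def norm_mult abs_mult mult.commute[of b] mult_left_mono)
      next
        case False
        then have "1 \<le> \<bar>s * x\<bar>" using \<open>s > 0\<close> by (simp add: field_simps abs_mult)
        then show ?thesis by (simp add: wave_def bumps_vanish)
      qed
    qed
  qed
  have ae: "AE x in lborel. \<bar>x\<bar> < 1 / s \<longrightarrow> u0 x = 0" if "s > 0" for s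
  proof -
    have "integrable lebesgue (\<lambda>x. u x * wave 0 s x)"
      unfolding u_def left_diff_distrib using loc g1 g2 that by (intro Bochner_Integration.integrable_diff iw) auto
    then have i0: "integrable lborel (\<lambda>x. u0 x * wave 0 s x)"
    proof (subst (asm) lebesgue_integral_representative(1)[of _ "\<lambda>x. u0 x * wave 0 s x"])
      show "AE x in lborel. u x * wave 0 s x = u0 x * wave 0 s x" using uu by eventually_elim simp
      have "wave 0 s \<in> borel_measurable lebesgue" by (rule measurable_completion) simp
      then show "(\<lambda>x. u x * wave 0 s x) \<in> borel_measurable lebesgue" using mu by simp
    qed auto
    have "FT (\<lambda>x. u0 x * wave 0 s x) \<xi> = 0" for \<xi>
    proof -
      define c where "c = - (2 * pi * \<i> * \<xi>)"
      have ec: "exp (c * of_real x) = ee (- (x * \<xi>))" for x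
        by (simp add: ee_eq_exp c_def mult_ac)
      have "FT (\<lambda>x. u0 x * wave 0 s x) \<xi> = (LINT x|lborel. u0 x * wave c s x)"
        by (simp add: FT_def wave_def ec mult.assoc)
      also have "\<dots> = (LINT x|lebesgue. u x * wave c s x)"
      proof (rule lebesgue_integral_representative(2)[symmetric])
        show "AE x in lborel. u x * wave c s x = u0 x * wave c s x" using uu by eventually_elim simp
        have "wave c s \<in> borel_measurable lebesgue" by (rule measurable_completion) simp
        then show "(\<lambda>x. u x * wave c s x) \<in> borel_measurable lebesgue" using mu by simp
      qed measurable
      also have "\<dots> = (LINT x|lebesgue. g1 x * wave c s x) - (LINT x|lebesgue. g2 x * wave c s x)"
        unfolding u_def left_diff_distrib using loc g1 g2 that
        by (intro Bochner_Integration.integral_diff iw) (auto simp: c_def)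
      also have "(- 1) ^ r * \<dots> = 0"
        using wd1 wd2 wave_test_function[OF that, of c] by (simp add: weak_deriv_def right_diff_distrib)
      finally show ?thesis by simp
    qed
    from FT_unique[OF i0 this]
    have "AE x in lborel. u0 x * wave 0 s x = 0" .
    then show ?thesis
    proof eventually_elim
      case (elim x)
      show ?case
      proof
        assume "\<bar>x\<bar> < 1 / s"
        then have "\<bar>s * x\<bar> < 1" using that by (simp add: field_simps abs_mult)
        then show "u0 x = 0" using elim bump_nonzero[of "s * x"] by (simp add: wave_def)
      qed
    qed
  qed
  have "AE x in lborel. \<forall>m. \<bar>x\<bar> < 1 / inverse (real (Suc m)) \<longrightarrow> u0 x = 0"
    unfolding AE_all_countable by (intro allI ae) simp
  with uu show ?thesis
  proof eventually_elim
    case (elim x)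
    obtain m where "\<bar>x\<bar> < real m" using reals_Archimedean2 by blast
    then have "\<bar>x\<bar> < 1 / inverse (real (Suc m))" by (simp add: inverse_eq_divide)
    then show ?case using elim by (auto simp: u_def)
  qed
qed

section \<open>Decay of the transform; the averaging multiplier\<close>

lemma integrable_inverse_1_plus_square': "integrable lborel (\<lambda>x::real. inverse (1 + x\<^sup>2))"
  using integrable_inverse_1_plus_square by (simp add: set_integrable_def einterval_def)

lemma locally_integrable_measurable:
  assumes "locally_integrable g"
  shows "g \<in> borel_measurable lebesgue"
proof (rule borel_measurable_LIMSEQ_metric)
  fix n :: nat
  have "integrable lebesgue (\<lambda>x. indicator {-real n..real n} x *\<^sub>R g x)"
    using assms by (simp add: locally_integrable_def set_integrable_def)
  then show "(\<lambda>x. indicator {-real n..real n} x *\<^sub>R g x) \<in> borel_measurable lebesgue" by auto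
next
  fix x :: real
  obtain m where "\<bar>x\<bar> < real m" using reals_Archimedean2 by blast
  then have "\<forall>\<^sub>F n in sequentially. indicator {-real n..real n} x *\<^sub>R g x = g x"
    by (intro eventually_sequentiallyI[of m]) (auto simp: indicator_def abs_less_iff)
  then show "(\<lambda>n. indicator {-real n..real n} x *\<^sub>R g x) \<longlonglongrightarrow> g x" by (rule tendsto_eventually)
qed

text \<open>On \<open>{x - 1..x + 1}\<close> the modulus of g is at least
  \<open>cmod (g x) - |K|\<close>, so twice this number is at most the integral of the
  modulus.\<close>

lemma lip_integrable_bounded:
  assumes "g \<in> lip \<epsilon>" "\<epsilon> > 0" and i: "integrable lebesgue g"
  shows "\<exists>b. \<forall>x. cmod (g x) \<le> b"
proof -
  obtain K where K: "\<And>x y. cmod (g x - g y) \<le> K * \<bar>x - y\<bar> powr \<epsilon>"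
    using assms(1) by (auto simp: lip_def)
  define I where "I = (LINT y|lebesgue. cmod (g y))"
  have "cmod (g x) \<le> \<bar>K\<bar> + I / 2" for x
  proof -
    define c where "c = cmod (g x) - \<bar>K\<bar>"
    have "(LINT y|lebesgue. c * indicator {x - 1..x + 1} y) \<le> I"
      unfolding I_def
    proof (rule integral_mono)
      show "integrable lebesgue (\<lambda>y. c * indicator {x - 1..x + 1} y)" by simp
      fix y :: real
      show "c * indicator {x - 1..x + 1} y \<le> cmod (g y)"
      proof (cases "y \<in> {x - 1..x + 1}")
        case True
        then have "\<bar>x - y\<bar> powr \<epsilon> \<le> 1 powr \<epsilon>" using \<open>\<epsilon> > 0\<close> by (intro powr_mono2) auto
        then have "K * \<bar>x - y\<bar> powr \<epsilon> \<le> \<bar>K\<bar> * 1" by (intro mult_mono) auto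
        with K[of x y] have "cmod (g x - g y) \<le> \<bar>K\<bar>" by simp
        moreover have "cmod (g x) \<le> cmod (g x - g y) + cmod (g y)" using norm_triangle_ineq[of "g x - g y" "g y"] by simp
        ultimately show ?thesis using True by (simp add: c_def)
      qed simp
    qed (use i in simp)
    also have "(LINT y|lebesgue. c * indicator {x - 1..x + 1} y) = c * 2"
      by simp
    finally show ?thesis by (simp add: c_def)
  qed
  then show ?thesis by blast
qed

text \<open>The integrability for r = 0 permits inversion, the higher powers feed the rescaled
  estimates. For \<open>|\<xi>| > 1\<close> the weighted transform is bounded by the transform of
  the top derivative times \<open>1 / |\<xi>|\<close>, a product of two square integrable
  functions.\<close>

theorem sobolev_FT:
  assumes f: "f \<in> sobolev_1 (N + 1)" and "\<epsilon> > 0" and lp: "\<exists>g. weak_deriv (N + 1) f g \<and> g \<in> lip \<epsilon>"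
  obtains f0 D where "integrable lborel f0" "AE x in lborel. f x = f0 x"
    "D \<ge> 0" "\<And>\<xi>. cmod (FT f0 \<xi>) * \<bar>\<xi>\<bar> ^ (N + 1) \<le> D"
    "\<And>r. r \<le> N \<Longrightarrow> integrable lborel (\<lambda>\<xi>. cmod (FT f0 \<xi>) * \<bar>\<xi>\<bar> ^ r)"
proof -
  have fi: "integrable lebesgue f" using f by (simp add: sobolev_1_def)
  obtain g where g: "integrable lebesgue g" "weak_deriv (N + 1) f g" using f by (auto simp: sobolev_1_def)
  have fm: "f \<in> borel_measurable lebesgue" and gm: "g \<in> borel_measurable lebesgue" using fi g by auto
  obtain f0 where f0[measurable]: "f0 \<in> borel_measurable borel" and ff: "AE x in lborel. f x = f0 x"
    using borel_representative[OF fm] by blast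
  obtain g0 where g0[measurable]: "g0 \<in> borel_measurable borel" and gg: "AE x in lborel. g x = g0 x"
    using borel_representative[OF gm] by blast
  have if0: "integrable lborel f0" using lebesgue_integral_representative(1)[OF fm f0 ff] fi by simp
  have ig0: "integrable lborel g0" using lebesgue_integral_representative(1)[OF gm g0 gg] g by simp
  obtain g2 where g2: "weak_deriv (N + 1) f g2" "g2 \<in> lip \<epsilon>" using lp by blast
  have g2m: "g2 \<in> borel_measurable lebesgue"
    using g2(1) by (intro locally_integrable_measurable) (simp add: weak_deriv_def)
  have g12: "AE x in lborel. g x = g2 x" by (rule weak_deriv_unique[OF g(2) g2(1) gm g2m])
  have "integrable lebesgue g2"
    using integrable_cong_AE[OF gm g2m AE_completion[OF g12]] g(1) by simp
  from lip_integrable_bounded[OF g2(2) \<open>\<epsilon> > 0\<close> this]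
  obtain b where b: "\<And>x. cmod (g2 x) \<le> b" by blast
  have "b \<ge> 0" using order_trans[OF norm_ge_zero b[of 0]] .
  have g0b: "AE x in lborel. cmod (g0 x) \<le> b"
    using gg g12 by eventually_elim (use b in metis)
  have "(\<integral>\<^sup>+x. ennreal ((cmod (g0 x))\<^sup>2) \<partial>lborel) \<le> (\<integral>\<^sup>+x. ennreal b * ennreal (cmod (g0 x)) \<partial>lborel)"
  proof (intro nn_integral_mono_AE, use g0b in eventually_elim)
    case (elim x)
    then show ?case
      using \<open>b \<ge> 0\<close> by (simp add: power2_eq_square ennreal_mult[symmetric] mult_right_mono ennreal_leI)
  qed
  also have "\<dots> = ennreal b * (\<integral>\<^sup>+x. ennreal (cmod (g0 x)) \<partial>lborel)" by (rule nn_integral_cmult) measurable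
  also have "\<dots> < \<infinity>" using ig0 by (simp add: integrable_iff_bounded ennreal_mult_less_top)
  finally have F2: "(\<integral>\<^sup>+\<xi>. ennreal ((cmod (FT g0 \<xi>))\<^sup>2) \<partial>lborel) < \<infinity>"
    using FT_Bessel[OF ig0] by (rule order.strict_trans1[rotated])
  have iF2: "integrable lborel (\<lambda>\<xi>. (cmod (FT g0 \<xi>))\<^sup>2)"
    using F2 by (intro integrableI_bounded) simp_all
  define L where "L = (LINT x|lborel. cmod (f0 x))"
  define L' where "L' = (LINT x|lborel. cmod (g0 x))"
  have L: "cmod (FT f0 \<xi>) \<le> L" for \<xi> unfolding L_def by (rule norm_FT_le[OF if0])
  have L': "cmod (FT g0 \<xi>) \<le> L'" for \<xi> unfolding L'_def by (rule norm_FT_le[OF ig0])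
  have "L \<ge> 0" using order_trans[OF norm_ge_zero L[of 0]] .
  have "L' \<ge> 0" using order_trans[OF norm_ge_zero L'[of 0]] .
  have "FT g0 \<xi> = (2 * pi * \<i> * \<xi>) ^ (N + 1) * FT f0 \<xi>" for \<xi>
    by (rule weak_deriv_FT[OF g(2) fi g(1) f0 ff g0 gg])
  then have gf: "cmod (FT g0 \<xi>) = (2 * pi) ^ (N + 1) * (\<bar>\<xi>\<bar> ^ (N + 1) * cmod (FT f0 \<xi>))" for \<xi>
    by (simp add: norm_mult norm_power power_mult_distrib mult_ac)
  have "1 \<le> 2 * pi" using pi_gt3 by linarith
  then have p1: "1 \<le> (2 * pi) ^ (N + 1)" by (rule one_le_power)
  have dec: "\<bar>\<xi>\<bar> ^ (N + 1) * cmod (FT f0 \<xi>) \<le> cmod (FT g0 \<xi>)" for \<xi>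
    unfolding gf using mult_right_mono[OF p1, of "\<bar>\<xi>\<bar> ^ (N + 1) * cmod (FT f0 \<xi>)"] by simp
  show thesis
  proof (rule that[OF if0 ff \<open>L' \<ge> 0\<close>])
    show "cmod (FT f0 \<xi>) * \<bar>\<xi>\<bar> ^ (N + 1) \<le> L'" for \<xi>
      using order_trans[OF dec L'] by (simp add: mult.commute)
    fix r assume "r \<le> N"
    show "integrable lborel (\<lambda>\<xi>. cmod (FT f0 \<xi>) * \<bar>\<xi>\<bar> ^ r)"
    proof (rule Bochner_Integration.integrable_bound)
      \<comment> \<open>The constant covers both ranges: up to 1 the bound L is at most
        \<open>2 * L / (1 + \<xi>\<^sup>2)\<close>, beyond 1 the square
        \<open>1 / \<xi>\<^sup>2\<close> is at most \<open>2 / (1 + \<xi>\<^sup>2)\<close>.\<close>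
      show "integrable lborel (\<lambda>\<xi>. (2 * L + 2) * inverse (1 + \<xi>\<^sup>2) + (cmod (FT g0 \<xi>))\<^sup>2)"
        using integrable_inverse_1_plus_square' iF2 by simp
      show "AE \<xi> in lborel. norm (cmod (FT f0 \<xi>) * \<bar>\<xi>\<bar> ^ r) \<le> norm ((2 * L + 2) * inverse (1 + \<xi>\<^sup>2) + (cmod (FT g0 \<xi>))\<^sup>2)"
      proof (rule AE_I2)
        fix \<xi> :: real
        have pos: "0 < 1 + \<xi>\<^sup>2" by (simp add: add_pos_nonneg)
        have "cmod (FT f0 \<xi>) * \<bar>\<xi>\<bar> ^ r \<le> (2 * L + 2) * inverse (1 + \<xi>\<^sup>2) + (cmod (FT g0 \<xi>))\<^sup>2"
        proof (cases "\<bar>\<xi>\<bar> \<le> 1")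
          case True
          have "cmod (FT f0 \<xi>) * \<bar>\<xi>\<bar> ^ r \<le> L * 1"
            using True L \<open>L \<ge> 0\<close> by (intro mult_mono power_le_one) auto
          also have "\<dots> \<le> (2 * L + 2) * inverse (1 + \<xi>\<^sup>2)"
          proof -
            have "\<xi>\<^sup>2 \<le> 1" using True by (simp add: abs_square_le_1)
            then have "L * (1 + \<xi>\<^sup>2) \<le> L * 2" using \<open>L \<ge> 0\<close> by (intro mult_left_mono) auto
            then show ?thesis using pos by (simp add: divide_simps) 
          qed
          finally show ?thesis by (simp add: add_increasing2)
        next
          case False
          then have x1: "1 \<le> \<bar>\<xi>\<bar>" by simp
          have "\<bar>\<xi>\<bar> * (cmod (FT f0 \<xi>) * \<bar>\<xi>\<bar> ^ r) = cmod (FT f0 \<xi>) * \<bar>\<xi>\<bar> ^ Suc r" by simp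
          also have "\<dots> \<le> cmod (FT f0 \<xi>) * \<bar>\<xi>\<bar> ^ (N + 1)"
            using x1 \<open>r \<le> N\<close> by (intro mult_left_mono power_increasing) auto
          also have "\<dots> \<le> cmod (FT g0 \<xi>)" using dec[of \<xi>] by (simp add: mult.commute)
          finally have "cmod (FT f0 \<xi>) * \<bar>\<xi>\<bar> ^ r \<le> cmod (FT g0 \<xi>) * inverse \<bar>\<xi>\<bar>"
            using x1 by (simp add: field_simps)
          also have "\<dots> \<le> (cmod (FT g0 \<xi>))\<^sup>2 + (inverse \<bar>\<xi>\<bar>)\<^sup>2"
            proof -
            have "0 \<le> cmod (FT g0 \<xi>) * inverse \<bar>\<xi>\<bar>" by simp
            then show ?thesis using sum_squares_bound[of "cmod (FT g0 \<xi>)" "inverse \<bar>\<xi>\<bar>"] by linarith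
          qed
          also have "(inverse \<bar>\<xi>\<bar>)\<^sup>2 \<le> 2 * inverse (1 + \<xi>\<^sup>2)"
          proof -
            have "1 \<le> \<xi>\<^sup>2" using x1 by (simp add: abs_le_square_iff[of 1 \<xi>, simplified])
            then have "2 / (2 * \<xi>\<^sup>2) \<le> 2 / (1 + \<xi>\<^sup>2)" by (intro divide_left_mono mult_pos_pos) linarith+
            then show ?thesis by (simp add: power_divide inverse_eq_divide)
          qed
          also have "\<dots> \<le> (2 * L + 2) * inverse (1 + \<xi>\<^sup>2)"
            using pos \<open>L \<ge> 0\<close> by (intro mult_right_mono) auto
          finally show ?thesis by simp
        qed
        then show "norm (cmod (FT f0 \<xi>) * \<bar>\<xi>\<bar> ^ r) \<le> norm ((2 * L + 2) * inverse (1 + \<xi>\<^sup>2) + (cmod (FT g0 \<xi>))\<^sup>2)"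
          by (simp add: abs_mult)
      qed
    qed measurable
  qed
qed

text \<open>This is \<open>sin (2 * pi * h * \<xi>) / (2 * pi * h * \<xi>)\<close>. As an integral
  it needs no exception at \<xi> = 0, and the Taylor polynomial of the exponential can be subtracted
  under the integral.\<close>

definition av_mult :: "real \<Rightarrow> real \<Rightarrow> complex" where
  "av_mult h \<xi> = of_real (1 / (2 * h)) * (LINT s|lborel. indicator {-h..h} s *\<^sub>R ee (- (s * \<xi>)))"

lemma av_mult_measurable [measurable]: "av_mult h \<in> borel_measurable borel"
  unfolding av_mult_def[abs_def] by measurable

lemma integral_norm_indicator_bound:
  fixes v :: "real \<Rightarrow> complex"
  assumes [measurable]: "v \<in> borel_measurable borel" and "h > 0" and b: "\<And>s. \<bar>s\<bar> \<le> h \<Longrightarrow> cmod (v s) \<le> c"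
  shows "integrable lborel (\<lambda>s. indicator {-h..h} s *\<^sub>R v s)"
    and "cmod (of_real (1 / (2 * h)) * (LINT s|lborel. indicator {-h..h} s *\<^sub>R v s)) \<le> c"
proof -
  have ci: "integrable lborel (\<lambda>s. c * indicator {-h..h} s :: real)"
    by (intro integrable_mult_right integrable_real_indicator) (auto simp: emeasure_lborel_Icc_eq)
  have p: "cmod (indicator {-h..h} s *\<^sub>R v s) \<le> c * indicator {-h..h} s" for s
    using b[of s] by (auto simp: indicator_def)
  show i: "integrable lborel (\<lambda>s. indicator {-h..h} s *\<^sub>R v s)"
  proof (rule Bochner_Integration.integrable_bound[OF ci])
    show "AE s in lborel. cmod (indicator {-h..h} s *\<^sub>R v s) \<le> norm (c * indicator {-h..h} s :: real)"
      unfolding real_norm_def by (intro AE_I2 order_trans[OF p abs_ge_self])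
  qed measurable
  have "cmod (LINT s|lborel. indicator {-h..h} s *\<^sub>R v s) \<le> (LINT s|lborel. c * indicator {-h..h} s)"
    by (rule Bochner_Integration.integral_norm_bound_integral[OF i ci p])
  also have "\<dots> = c * (2 * h)" using \<open>h > 0\<close> by simp
  finally show "cmod (of_real (1 / (2 * h)) * (LINT s|lborel. indicator {-h..h} s *\<^sub>R v s)) \<le> c"
    using \<open>h > 0\<close> unfolding norm_mult norm_of_real by (simp add: field_simps)
qed

lemma av_mult_le_1: "h > 0 \<Longrightarrow> cmod (av_mult h \<xi>) \<le> 1"
  unfolding av_mult_def by (rule integral_norm_indicator_bound(2)) auto

text \<open>The oscillation gains one power of \<xi>. Added to the order N + 1 of the transform of f
  it gives order N + 2, integrable at infinity even for N = 0.\<close>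

lemma av_mult_decay:
  assumes "h > 0" "\<xi> \<noteq> 0"
  shows "cmod (av_mult h \<xi>) \<le> 1 / (h * \<bar>\<xi>\<bar>)"
proof -
  have "(LINT s|lborel. indicator {-h..h} s *\<^sub>R ee (- (s * \<xi>))) = (LINT s|lborel. indicator {-h..h} s *\<^sub>R ee ((- \<xi>) * s))"
    by (simp add: mult.commute)
  also have "\<dots> = (ee (- \<xi> * h) - ee (- \<xi> * (- h))) / (2 * of_real pi * \<i> * of_real (- \<xi>))"
    using assms by (intro integral_ee_Icc) auto
  finally have "cmod (LINT s|lborel. indicator {-h..h} s *\<^sub>R ee (- (s * \<xi>))) = cmod (ee (- \<xi> * h) - ee (- \<xi> * (- h))) / (2 * pi * \<bar>\<xi>\<bar>)"
    by (simp add: norm_divide norm_mult)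
  also have "\<dots> \<le> 2 / (2 * pi * \<bar>\<xi>\<bar>)"
    using assms norm_triangle_ineq4[of "ee (- \<xi> * h)" "ee (- \<xi> * (- h))"] by (intro divide_right_mono) auto
  also have "\<dots> \<le> 2 / \<bar>\<xi>\<bar>" using assms pi_gt3 by (simp add: field_simps)
  finally have "cmod (av_mult h \<xi>) \<le> (1 / (2 * h)) * (2 / \<bar>\<xi>\<bar>)"
    unfolding av_mult_def norm_mult norm_of_real using assms by (intro mult_mono) auto
  then show ?thesis by simp
qed

text \<open>\<open>av_coeff h l\<close> is the l-th moment of the averaging measure divided by
  \<open>fact l\<close>, so the transform of \<open>phi_tilde\<close> is the average of the Taylor
  polynomial of degree N of \<open>ee (- (s * \<xi>))\<close>.\<close>

lemma phi_tilde_eq_integral: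
  assumes "h > 0"
  shows "fourier_distr (phi_tilde h N) \<xi> =
    of_real (1 / (2 * h)) * (LINT s|lborel. indicator {-h..h} s *\<^sub>R (\<Sum>l\<le>N. (\<i> * of_real (- (2 * pi * (s * \<xi>)))) ^ l / fact l))"
proof -
  have av: "av_coeff h l = of_real (1 / (2 * h)) * (LINT s|lborel. indicator {-h..h} s *\<^sub>R (of_real (s ^ l) / fact l))" for l
  proof -
    have "(LINT t:{-h..h}|lebesgue. t ^ l) = (LINT s|lborel. indicator {-h..h} s *\<^sub>R s ^ l)"
      unfolding set_lebesgue_integral_def by (rule integral_completion) measurable
    then have "av_coeff h l = of_real (1 / (2 * h)) * (complex_of_real (LINT s|lborel. indicator {-h..h} s *\<^sub>R s ^ l) / fact l)"
      by (simp add: av_coeff_def)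
    also have "complex_of_real (LINT s|lborel. indicator {-h..h} s *\<^sub>R s ^ l) / fact l = (LINT s|lborel. indicator {-h..h} s *\<^sub>R (of_real (s ^ l) / fact l))"
      unfolding integral_complex_of_real[symmetric] integral_divide_zero[symmetric]
      by (intro Bochner_Integration.integral_cong) (simp_all add: scaleR_conv_of_real)
    finally show ?thesis .
  qed
  have i: "integrable lborel (\<lambda>s. indicator {-h..h} s *\<^sub>R (complex_of_real (s ^ l) / fact l))" for l
  proof (rule integral_norm_indicator_bound(1)[OF _ assms])
    show "cmod (complex_of_real (s ^ l) / fact l) \<le> h ^ l / fact l" if "\<bar>s\<bar> \<le> h" for s
      using that by (simp add: norm_divide norm_power divide_right_mono power_mono)
  qed measurable
  \<comment> \<open>The moments are real, so conjugation disappears, and the remaining sign is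
    absorbed into the power of \<open>- (2 * pi * \<i> * \<xi>)\<close>.\<close>
  have real: "cnj (av_coeff h l) = av_coeff h l" for l by (simp add: av_coeff_def)
  have "fourier_distr (phi_tilde h N) \<xi> = (\<Sum>l\<le>N. (- (2 * pi * \<i> * \<xi>)) ^ l * av_coeff h l)"
    unfolding fourier_phi_tilde real 
  proof (intro sum.cong refl)
    fix l
    have "(- (2 * pi * \<i> * \<xi>)) ^ l = (- 1) ^ l * (2 * pi * \<i> * \<xi>) ^ l" by (rule power_minus)
    then show "av_coeff h l * (- 1) ^ l * (2 * pi * \<i> * \<xi>) ^ l = (- (2 * pi * \<i> * \<xi>)) ^ l * av_coeff h l"
      by (simp only: mult_ac)
  qed
  also have "\<dots> = (\<Sum>l\<le>N. of_real (1 / (2 * h)) * (LINT s|lborel. (- (2 * pi * \<i> * \<xi>)) ^ l * (indicator {-h..h} s *\<^sub>R (of_real (s ^ l) / fact l))))"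
    unfolding av integral_mult_right_zero by (simp only: mult_ac)
  also have "\<dots> = of_real (1 / (2 * h)) * (LINT s|lborel. (\<Sum>l\<le>N. (- (2 * pi * \<i> * \<xi>)) ^ l * (indicator {-h..h} s *\<^sub>R (of_real (s ^ l) / fact l))))"
    by (simp only: Bochner_Integration.integral_sum integrable_mult_right i sum_distrib_left simp_thms)
  also have "(\<lambda>s. \<Sum>l\<le>N. (- (2 * pi * \<i> * \<xi>)) ^ l * (indicator {-h..h} s *\<^sub>R (complex_of_real (s ^ l) / fact l)))
      = (\<lambda>s. indicator {-h..h} s *\<^sub>R (\<Sum>l\<le>N. (\<i> * of_real (- (2 * pi * (s * \<xi>)))) ^ l / fact l))"
  proof
    fix s
    have "(\<i> * of_real (- (2 * pi * (s * \<xi>)))) ^ l = (- (2 * pi * \<i> * \<xi>)) ^ l * of_real (s ^ l)" for l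
      unfolding of_real_power power_mult_distrib[symmetric] by (simp add: mult_ac)
    then show "(\<Sum>l\<le>N. (- (2 * pi * \<i> * \<xi>)) ^ l * (indicator {-h..h} s *\<^sub>R (complex_of_real (s ^ l) / fact l)))
      = indicator {-h..h} s *\<^sub>R (\<Sum>l\<le>N. (\<i> * of_real (- (2 * pi * (s * \<xi>)))) ^ l / fact l)"
      by (simp add: scaleR_sum_right)
  qed
  finally show ?thesis .
qed

text \<open>The Taylor remainder of the exponential, averaged. It carries exactly the power of \<xi>
  that the transform of f can absorb.\<close>

lemma av_mult_approx:
  assumes "h > 0"
  shows "cmod (av_mult h \<xi> - fourier_distr (phi_tilde h N) \<xi>) \<le> (2 * pi * h) ^ (N + 1) * \<bar>\<xi>\<bar> ^ (N + 1)"
proof -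
  let ?p = "\<lambda>s. \<Sum>l\<le>N. (\<i> * complex_of_real (- (2 * pi * (s * \<xi>)))) ^ l / fact l"
  let ?c = "(2 * pi * h) ^ (N + 1) * \<bar>\<xi>\<bar> ^ (N + 1)"
  have d: "cmod (ee (- (s * \<xi>)) - ?p s) \<le> ?c" if "\<bar>s\<bar> \<le> h" for s
  proof -
    have "cmod (ee (- (s * \<xi>)) - ?p s) \<le> \<bar>- (2 * pi * (s * \<xi>))\<bar> ^ Suc N / fact (Suc N)"
      using iexp_approx1[of "- (2 * pi * (s * \<xi>))" N] by (simp add: ee_eq_iexp)
    also have "\<dots> \<le> \<bar>- (2 * pi * (s * \<xi>))\<bar> ^ Suc N / 1"
      by (intro divide_left_mono) (auto simp: fact_ge_1 simp del: fact_Suc)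
    also have "\<dots> \<le> (2 * pi * h * \<bar>\<xi>\<bar>) ^ Suc N"
      using that by (simp only: div_by_1) (intro power_mono, auto simp: abs_mult mult_right_mono)
    finally show ?thesis by (simp only: power_mult_distrib[of "2 * pi * h" "\<bar>\<xi>\<bar>"] Suc_eq_plus1)
  qed
  have i1: "integrable lborel (\<lambda>s. indicator {-h..h} s *\<^sub>R ee (- (s * \<xi>)))"
    by (rule integral_norm_indicator_bound(1)[OF _ assms, of _ 1]) auto
  have i2: "integrable lborel (\<lambda>s. indicator {-h..h} s *\<^sub>R (ee (- (s * \<xi>)) - ?p s))"
    by (rule integral_norm_indicator_bound(1)[OF _ assms d]) auto
  have "integrable lborel (\<lambda>s. indicator {-h..h} s *\<^sub>R ee (- (s * \<xi>)) - indicator {-h..h} s *\<^sub>R (ee (- (s * \<xi>)) - ?p s))"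
    using i1 i2 by (rule Bochner_Integration.integrable_diff)
  then have i3: "integrable lborel (\<lambda>s. indicator {-h..h} s *\<^sub>R ?p s)" by (simp add: scaleR_diff_right)
  have eq: "av_mult h \<xi> - fourier_distr (phi_tilde h N) \<xi> = of_real (1 / (2 * h)) * (LINT s|lborel. indicator {-h..h} s *\<^sub>R (ee (- (s * \<xi>)) - ?p s))"
    unfolding av_mult_def phi_tilde_eq_integral[OF assms] scaleR_diff_right Bochner_Integration.integral_diff[OF i1 i3]
    by (simp only: right_diff_distrib)
  have m: "(\<lambda>s. ee (- (s * \<xi>)) - ?p s) \<in> borel_measurable borel" by measurable
  have B: "cmod (of_real (1 / (2 * h)) * (LINT s|lborel. indicator {-h..h} s *\<^sub>R (ee (- (s * \<xi>)) - ?p s))) \<le> ?c"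
    by (rule integral_norm_indicator_bound(2)[OF m assms]) (rule d)
  then show ?thesis by (simp only: eq)
qed

section \<open>The approximation error at scale one\<close>

lemma abs_zz_ge: "real n / 2 \<le> \<bar>zz n\<bar>"
proof (cases "even n")
  case True
  then have "zz n = real (n div 2)" by (simp add: zz_def int_decode_def sum_decode_def)
  then show ?thesis using True by auto
next
  case False
  then have "zz n = - real (n div 2) - 1" by (simp add: zz_def int_decode_def sum_decode_def)
  moreover have "real n = 2 * real (n div 2) + 1" using False by (metis odd_two_times_div_two_succ of_nat_Suc of_nat_mult of_nat_numeral Suc_eq_plus1 add.commute)
  ultimately show ?thesis by simp
qed

lemma suminf_inverse_square_translates:
  obtains C :: real where "C \<ge> 0" "\<And>\<xi>. \<xi> \<in> UI \<Longrightarrow> (\<Sum>n. ennreal (inverse (1 + (\<xi> + zz n)\<^sup>2))) \<le> ennreal C"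
proof -
  have sm: "summable (\<lambda>n. 16 * inverse ((real (Suc n))\<^sup>2))"
    using inverse_power_summable[of 2, where 'a=real] summable_Suc_iff[of "\<lambda>n. inverse ((real n)\<^sup>2)"] by (intro summable_mult) auto
  \<comment> \<open>The constant 16 collects
    \<open>(n + 1)\<^sup>2 \<le> 2 * (1 + n\<^sup>2)\<close>, \<open>n \<le> 2 * |z|\<close>,
    \<open>z\<^sup>2 \<le> 2 * (\<xi> + z)\<^sup>2 + 2 * \<xi>\<^sup>2\<close> and
    \<open>|\<xi>| \<le> 1 / 2\<close>.\<close>
  have le: "inverse (1 + (\<xi> + zz n)\<^sup>2) \<le> 16 * inverse ((real (Suc n))\<^sup>2)" if "\<xi> \<in> UI" for \<xi> n
  proof -
    define z where "z = zz n"
    have "\<bar>\<xi>\<bar> \<le> 1 / 2" using that by (auto simp: UI_def)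
    then have "\<xi>\<^sup>2 \<le> (1/2)\<^sup>2" by (metis abs_le_square_iff abs_of_nonneg zero_le_divide_1_iff zero_le_numeral)
    then have x2: "\<xi>\<^sup>2 \<le> 1 / 4" by (simp add: power2_eq_square)
    have "(real n / 2)\<^sup>2 \<le> \<bar>z\<bar>\<^sup>2" unfolding z_def by (intro power_mono abs_zz_ge) simp
    then have n2: "(real n)\<^sup>2 \<le> 4 * z\<^sup>2" by (simp add: power_divide)
    have "0 \<le> (z + 2 * \<xi>)\<^sup>2" by simp
    then have z2: "z\<^sup>2 \<le> 2 * (\<xi> + z)\<^sup>2 + 2 * \<xi>\<^sup>2" by (simp add: power2_eq_square algebra_simps)
    have "0 \<le> (real n - 1)\<^sup>2" by simp
    then have "(real (Suc n))\<^sup>2 \<le> 2 * (1 + (real n)\<^sup>2)" by (simp add: power2_eq_square algebra_simps)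
    also have "\<dots> \<le> 16 * (1 + (\<xi> + z)\<^sup>2)" using n2 z2 x2 by simp
    finally have le: "(real (Suc n))\<^sup>2 \<le> 16 * (1 + (\<xi> + z)\<^sup>2)" .
    have "inverse (1 + (\<xi> + z)\<^sup>2) \<le> inverse ((real (Suc n))\<^sup>2 / 16)"
      using le by (intro le_imp_inverse_le) simp_all
    then show ?thesis unfolding z_def by (simp add: inverse_eq_divide)
  qed
  show thesis
  proof (rule that[of "\<Sum>n. 16 * inverse ((real (Suc n))\<^sup>2)"])
    show "0 \<le> (\<Sum>n. 16 * inverse ((real (Suc n))\<^sup>2))" by (intro suminf_nonneg sm) simp
    fix \<xi> assume "\<xi> \<in> UI"
    then have "(\<Sum>n. ennreal (inverse (1 + (\<xi> + zz n)\<^sup>2))) \<le> (\<Sum>n. ennreal (16 * inverse ((real (Suc n))\<^sup>2)))"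
      by (intro suminf_le summableI ennreal_leI le)
    also have "\<dots> = ennreal (\<Sum>n. 16 * inverse ((real (Suc n))\<^sup>2))"
      by (intro suminf_ennreal2 sm) simp
    finally show "(\<Sum>n. ennreal (inverse (1 + (\<xi> + zz n)\<^sup>2))) \<le> ennreal (\<Sum>n. 16 * inverse ((real (Suc n))\<^sup>2))" .
  qed
qed

lemma suminf_indicator_UI_plus:
  assumes "\<xi> \<in> UI"
  shows "(\<Sum>n. ennreal (indicator UI (\<xi> + zz n))) = 1"
proof -
  have u: "\<And>k l::int. \<xi> - of_int k \<in> UI \<Longrightarrow> \<xi> - of_int l \<in> UI \<Longrightarrow> k = l"
    using UI_translate_unique[of \<xi>] by blast
  have z: "zz (int_encode 0) = 0" by (simp add: zz_def)
  have "(\<Sum>n. ennreal (indicator UI (\<xi> + zz n))) = (\<Sum>n\<in>{int_encode 0}. ennreal (indicator UI (\<xi> + zz n)))"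
  proof (rule suminf_finite)
    fix n assume n: "n \<notin> {int_encode 0}"
    have "\<xi> + zz n \<notin> UI"
    proof
      assume "\<xi> + zz n \<in> UI"
      then have "- int_decode n = 0" using u[of "- int_decode n" 0] assms by (simp add: zz_def)
      then have "n = int_encode 0" by (metis int_decode_inverse neg_equal_0_iff_equal)
      then show False using n by simp
    qed
    then show "ennreal (indicator UI (\<xi> + zz n)) = 0" by simp
  qed simp
  then show ?thesis using assms by (simp add: z)
qed

text \<open>\<open>circle_Bessel\<close> with the weight \<open>1 / (1 + \<xi>\<^sup>2)\<close>,
  whose periodization is bounded. The square of the bound on w contains this factor twice: one is
  the weight, the other makes the right side finite.\<close>

lemma decaying_coefficients:
  obtains C :: real where "C \<ge> 0"
    "\<And>w A. integrable lborel w \<Longrightarrow> (\<And>\<xi>. cmod (w \<xi>) \<le> A * inverse (1 + \<xi>\<^sup>2)) \<Longrightarrow>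
      (\<Sum>n. ennreal ((cmod (LINT \<xi>|lborel. w \<xi> * ee (- (zz n * \<xi>))))\<^sup>2)) \<le> ennreal (C * A\<^sup>2)"
proof -
  obtain C where C: "C \<ge> 0" "\<And>\<xi>. \<xi> \<in> UI \<Longrightarrow> (\<Sum>n. ennreal (inverse (1 + (\<xi> + zz n)\<^sup>2))) \<le> ennreal C"
    by (rule suminf_inverse_square_translates) blast
  define J where "J = (LINT x|lborel. inverse (1 + x\<^sup>2) :: real)"
  have nn: "0 \<le> inverse (1 + x\<^sup>2)" for x :: real by simp
  have "J \<ge> 0" unfolding J_def using nn by (intro integral_nonneg_AE AE_I2)
  show thesis
  proof (rule that[of "C * J"])
    show "C * J \<ge> 0" using C(1) \<open>J \<ge> 0\<close> by simp
    fix w :: "real \<Rightarrow> complex" and A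
    assume w: "integrable lborel w" and b: "\<And>\<xi>. cmod (w \<xi>) \<le> A * inverse (1 + \<xi>\<^sup>2)"
    \<comment> \<open>A reflection, because these coefficients carry the opposite sign in the
      exponent.\<close>
    have i: "integrable lborel (\<lambda>\<xi>. w (- \<xi>))"
      using lborel_integrable_real_affine[OF w, of "-1" 0] by simp
    have "(LINT \<xi>|lborel. w \<xi> * ee (- (zz n * \<xi>))) = (LINT \<xi>|lborel. w (- \<xi>) * ee (zz n * \<xi>))" for n
      by (subst lborel_integral_real_affine[where c = "-1" and t = 0]) simp_all
    then have "(\<Sum>n. ennreal ((cmod (LINT \<xi>|lborel. w \<xi> * ee (- (zz n * \<xi>))))\<^sup>2))
        = (\<Sum>n. ennreal ((cmod (LINT \<xi>|lborel. w (- \<xi>) * ee (zz n * \<xi>)))\<^sup>2))" by simp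
    also have "\<dots> \<le> ennreal C * (\<integral>\<^sup>+\<xi>. ennreal (A\<^sup>2 * inverse (1 + \<xi>\<^sup>2)) \<partial>lborel)"
    proof (rule circle_Bessel[OF i, where \<omega> = "\<lambda>\<xi>. inverse (1 + \<xi>\<^sup>2)"])
      fix \<xi>
      have "(cmod (w (- \<xi>)))\<^sup>2 \<le> (A * inverse (1 + (- \<xi>)\<^sup>2))\<^sup>2" by (intro power_mono b) simp
      then show "(cmod (w (- \<xi>)))\<^sup>2 \<le> inverse (1 + \<xi>\<^sup>2) * (A\<^sup>2 * inverse (1 + \<xi>\<^sup>2))"
        by (simp only: power_mult_distrib power2_minus) (simp add: power2_eq_square mult_ac)
    qed (use C(2) in auto)
    also have "(\<integral>\<^sup>+\<xi>. ennreal (A\<^sup>2 * inverse (1 + \<xi>\<^sup>2)) \<partial>lborel) = ennreal (LINT \<xi>|lborel. A\<^sup>2 * inverse (1 + \<xi>\<^sup>2))"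
      by (intro nn_integral_eq_integral integrable_mult_right integrable_inverse_1_plus_square' AE_I2) simp
    also have "\<dots> = ennreal (A\<^sup>2 * J)" by (simp add: J_def)
    also have "ennreal C * ennreal (A\<^sup>2 * J) = ennreal (C * J * A\<^sup>2)"
      using C(1) \<open>J \<ge> 0\<close> by (simp add: ennreal_mult[symmetric] mult_ac)
    finally show "(\<Sum>n. ennreal ((cmod (LINT \<xi>|lborel. w \<xi> * ee (- (zz n * \<xi>))))\<^sup>2)) \<le> ennreal (C * J * A\<^sup>2)" .
  qed
qed

text \<open>For fixed \<xi>, the Fourier series in x of the periodic function
  \<open>\<Sum>n. \<phi> (x + zz n) * ee (- ((x + zz n) * \<xi>))\<close>.\<close>

definition fser :: "(real \<Rightarrow> complex) \<Rightarrow> real \<Rightarrow> real \<Rightarrow> complex" where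
  "fser \<phi> \<xi> x = (\<Sum>n. FT \<phi> (\<xi> + zz n) * ee (zz n * x))"

text \<open>The hypothesis controls nonzero translates only. The term with index
  \<open>int_encode 0\<close>, which is \<open>FT \<phi> \<xi>\<close>, is therefore separated; a
  single term does not affect summability.\<close>

lemma fser_bound:
  assumes b: "\<And>L. finite L \<Longrightarrow> 0 \<notin> L \<Longrightarrow> (\<Sum>l\<in>L. cmod (FT \<phi> (\<xi> + of_int l))) \<le> B"
  shows "summable (\<lambda>n. cmod (FT \<phi> (\<xi> + zz n)))"
    and "cmod (fser \<phi> \<xi> x - FT \<phi> \<xi>) \<le> B"
proof -
  let ?n0 = "int_encode 0"
  define t where "t n = (if n = ?n0 then 0 else FT \<phi> (\<xi> + zz n) * ee (zz n * x))" for n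
  have pb: "(\<Sum>n\<in>I. cmod (t n)) \<le> B" if "finite I" for I
  proof -
    have "(\<Sum>n\<in>I. cmod (t n)) = (\<Sum>n\<in>I - {?n0}. cmod (t n))"
      using that by (intro sum.mono_neutral_right) (auto simp: t_def)
    also have "\<dots> = (\<Sum>n\<in>I - {?n0}. cmod (FT \<phi> (\<xi> + of_int (int_decode n))))"
      by (intro sum.cong refl) (simp add: t_def norm_mult zz_def)
    also have "\<dots> = (\<Sum>l\<in>int_decode ` (I - {?n0}). cmod (FT \<phi> (\<xi> + of_int l)))"
      by (subst sum.reindex) (auto simp: inj_on_def int_decode_eq)
    also have "\<dots> \<le> B"
    proof (rule b)
      show "0 \<notin> int_decode ` (I - {?n0})" by (auto simp: image_iff) (metis int_decode_inverse)
    qed (use that in simp)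
    finally show ?thesis .
  qed
  have st: "summable (\<lambda>n. cmod (t n))"
    by (rule summableI_nonneg_bounded[where x = B]) (auto intro: pb)
  have s: "(\<lambda>n. FT \<phi> (\<xi> + zz n) * ee (zz n * x)) = (\<lambda>n. t n + (if n = ?n0 then FT \<phi> \<xi> else 0))"
    by (auto simp: t_def zz_def fun_eq_iff)
  have s1: "(\<lambda>n. if n = ?n0 then FT \<phi> \<xi> else 0) sums FT \<phi> \<xi>" by (rule sums_single)
  have "summable (\<lambda>n. cmod (t n) + cmod (if n = ?n0 then FT \<phi> \<xi> else 0))"
  proof (intro summable_add st)
    have "(\<lambda>n. cmod (if n = ?n0 then FT \<phi> \<xi> else 0)) = (\<lambda>n. if n = ?n0 then cmod (FT \<phi> \<xi>) else 0)" by auto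
    then show "summable (\<lambda>n. cmod (if n = ?n0 then FT \<phi> \<xi> else 0))" using sums_single[of ?n0 "\<lambda>_. cmod (FT \<phi> \<xi>)"] by (auto simp: sums_iff)
  qed
  then have "summable (\<lambda>n. cmod (FT \<phi> (\<xi> + zz n) * ee (zz n * x)))"
  proof (rule summable_comparison_test')
    fix n :: nat assume "0 \<le> n"
    show "norm (cmod (FT \<phi> (\<xi> + zz n) * ee (zz n * x))) \<le> cmod (t n) + cmod (if n = ?n0 then FT \<phi> \<xi> else 0)"
      unfolding fun_cong[OF s] by (simp only: norm_ge_zero real_norm_def abs_of_nonneg norm_triangle_ineq)
  qed
  then show "summable (\<lambda>n. cmod (FT \<phi> (\<xi> + zz n)))" by (simp add: norm_mult)
  have "fser \<phi> \<xi> x = (\<Sum>n. t n) + FT \<phi> \<xi>"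
    unfolding fser_def s using suminf_add[OF summable_norm_cancel[OF st] sums_summable[OF s1]] s1 by (simp add: sums_iff)
  then have "cmod (fser \<phi> \<xi> x - FT \<phi> \<xi>) \<le> (\<Sum>n. cmod (t n))" using summable_norm[OF st] by simp
  also have "\<dots> \<le> B" by (rule suminf_le_const[OF st]) (auto intro: pb)
  finally show "cmod (fser \<phi> \<xi> x - FT \<phi> \<xi>) \<le> B" .
qed

text \<open>When the coefficients come from a function v supported in
  \<open>|\<xi>| < \<delta>\<close>, the series of shifts can be summed under the integral,
  precisely where Poisson summation is available.\<close>

lemma periodic_series_integral:
  assumes sm: "summable (\<lambda>n. cmod (\<phi> (x + zz n)))"
    and P: "AE \<xi> in lborel. \<bar>\<xi>\<bar> < \<delta> \<longrightarrow> (\<Sum>n. \<phi> (x + zz n) * ee (- ((x + zz n) * \<xi>))) = fser \<phi> \<xi> x"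
    and v: "integrable lborel v" and supp: "\<And>\<xi>. \<not> \<bar>\<xi>\<bar> < \<delta> \<Longrightarrow> v \<xi> = 0"
    and [measurable]: "(\<lambda>\<xi>. fser \<phi> \<xi> x) \<in> borel_measurable borel"
  shows "(\<Sum>n. (LINT \<xi>|lborel. v \<xi> * ee (- (zz n * \<xi>))) * \<phi> (x + zz n)) = (LINT \<xi>|lborel. v \<xi> * ee (x * \<xi>) * fser \<phi> \<xi> x)"
proof -
  have [measurable]: "v \<in> borel_measurable borel" using v by auto
  define f where "f n \<xi> = v \<xi> * ee (- (zz n * \<xi>)) * \<phi> (x + zz n)" for n \<xi>
  have ve: "integrable lborel (\<lambda>\<xi>. v \<xi> * ee (- (zz n * \<xi>)))" for n by (intro integrable_mult_ee v) measurable
  have fi: "integrable lborel (f n)" for n unfolding f_def using ve by simp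
  have nf: "cmod (f n \<xi>) = cmod (v \<xi>) * cmod (\<phi> (x + zz n))" for n \<xi> by (simp add: f_def norm_mult)
  have "(\<Sum>n. (LINT \<xi>|lborel. v \<xi> * ee (- (zz n * \<xi>))) * \<phi> (x + zz n)) = (\<Sum>n. LINT \<xi>|lborel. f n \<xi>)"
    by (simp add: f_def)
  also have "\<dots> = (LINT \<xi>|lborel. (\<Sum>n. f n \<xi>))"
  proof (rule integral_suminf[symmetric, OF fi])
    show "AE \<xi> in lborel. summable (\<lambda>n. cmod (f n \<xi>))" unfolding nf by (intro AE_I2 summable_mult sm)
    show "summable (\<lambda>n. LINT \<xi>|lborel. cmod (f n \<xi>))" unfolding nf using sm by (simp add: summable_mult)
  qed
  also have "\<dots> = (LINT \<xi>|lborel. v \<xi> * ee (x * \<xi>) * fser \<phi> \<xi> x)"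
  proof (rule integral_cong_AE)
    show "AE \<xi> in lborel. (\<Sum>n. f n \<xi>) = v \<xi> * ee (x * \<xi>) * fser \<phi> \<xi> x"
      using P
    proof eventually_elim
      case (elim \<xi>)
      show ?case
      proof (cases "\<bar>\<xi>\<bar> < \<delta>")
        case True
        have "f n \<xi> = (v \<xi> * ee (x * \<xi>)) * (\<phi> (x + zz n) * ee (- ((x + zz n) * \<xi>)))" for n
        proof -
          have "ee (- (zz n * \<xi>)) = ee (x * \<xi>) * ee (- ((x + zz n) * \<xi>))"
            by (simp add: ee_add[symmetric] distrib_right)
          then show ?thesis by (simp add: f_def)
        qed
        moreover have "summable (\<lambda>n. \<phi> (x + zz n) * ee (- ((x + zz n) * \<xi>)))"
          by (rule summable_norm_cancel) (simp add: norm_mult sm)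
        ultimately show ?thesis using elim True by (simp add: suminf_mult)
      qed (simp add: f_def supp)
    qed
    have [measurable]: "f n \<in> borel_measurable lborel" for n using fi by auto
    show "(\<lambda>\<xi>. \<Sum>n. f n \<xi>) \<in> borel_measurable lborel" by measurable
  qed measurable
  finally show ?thesis .
qed

text \<open>The size of the error symbol: a power n where flatness and the Strang-Fix conditions
  act, and 1 where no cancellation is used.\<close>

definition low_weight :: "real \<Rightarrow> nat \<Rightarrow> real \<Rightarrow> real" where
  "low_weight \<delta> n \<xi> = (if \<bar>\<xi>\<bar> < \<delta> then \<bar>\<xi>\<bar> ^ n else 1)"

lemma low_weight_nonneg [simp]: "0 \<le> low_weight \<delta> n \<xi>"
  by (simp add: low_weight_def)

lemma low_weight_measurable [measurable]: "low_weight \<delta> n \<in> borel_measurable borel"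
  unfolding low_weight_def[abs_def] by measurable

lemma nn_integral_norm_bound:
  fixes f :: "real \<Rightarrow> complex"
  shows "ennreal (cmod (LINT x|lborel. f x)) \<le> (\<integral>\<^sup>+x. ennreal (cmod (f x)) \<partial>lborel)"
proof (cases "integrable lborel f")
  case True
  then show ?thesis by (rule integral_norm_bound_ennreal)
qed (simp add: not_integrable_integral_eq)

text \<open>Below \<delta> the Taylor remainder of the average meets the bound D directly; above
  \<delta> the decay of the average provides the missing power. The two summands of the constant
  belong to these two ranges.\<close>

lemma high_frequency_multiplier_bound:
  assumes h: "h > 0" and \<delta>: "0 < \<delta>" "\<delta> < 1"
    and G: "cmod (G \<xi>) * \<bar>\<xi>\<bar> ^ (N + 1) \<le> D"
  shows "cmod (G \<xi> * (av_mult h \<xi> - (if \<bar>\<xi>\<bar> < \<delta> then fourier_distr (phi_tilde h N) \<xi> else 0)))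
     \<le> ((2 * (2 * pi * h) ^ (N + 1) + 2 / (h * \<delta> ^ (N + 2))) * D) * inverse (1 + \<xi>\<^sup>2)"
proof -
  have D: "D \<ge> 0" using order_trans[OF _ G, of 0] by simp
  have pos: "0 < 1 + \<xi>\<^sup>2" by (simp add: add_pos_nonneg)
  define a where "a = (2 * pi * h) ^ (N + 1)"
  define b where "b = 2 / (h * \<delta> ^ (N + 2))"
  have a0: "a \<ge> 0" and b0: "b \<ge> 0" using h \<delta> by (simp_all add: a_def b_def)
  show ?thesis
  proof (cases "\<bar>\<xi>\<bar> < \<delta>")
    case True
    then have "\<bar>\<xi>\<bar> \<le> 1" using \<delta> by simp
    then have x2: "\<xi>\<^sup>2 \<le> 1" by (simp add: abs_square_le_1)
    have "cmod (G \<xi> * (av_mult h \<xi> - fourier_distr (phi_tilde h N) \<xi>)) \<le> cmod (G \<xi>) * (a * \<bar>\<xi>\<bar> ^ (N + 1))"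
      unfolding norm_mult a_def by (intro mult_left_mono av_mult_approx h) simp
    also have "\<dots> = a * (cmod (G \<xi>) * \<bar>\<xi>\<bar> ^ (N + 1))" by (simp only: mult_ac)
    also have "\<dots> \<le> a * D" by (intro mult_left_mono G a0)
    also have "\<dots> \<le> a * D * (2 * inverse (1 + \<xi>\<^sup>2))"
    proof -
      have "1 \<le> 2 * inverse (1 + \<xi>\<^sup>2)" using x2 pos by (simp add: divide_simps)
      from mult_left_mono[OF this mult_nonneg_nonneg[OF a0 D]] show ?thesis by simp
    qed
    also have "\<dots> \<le> ((2 * a + b) * D) * inverse (1 + \<xi>\<^sup>2)"
      using mult_nonneg_nonneg[OF mult_nonneg_nonneg[OF b0 D], of "inverse (1 + \<xi>\<^sup>2)"] pos by (simp add: algebra_simps)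
    finally show ?thesis using True by (simp add: a_def b_def)
  next
    case False
    then have x: "\<delta> \<le> \<bar>\<xi>\<bar>" by simp
    then have x0: "0 < \<bar>\<xi>\<bar>" using \<delta> by linarith
    then have "\<xi> \<noteq> 0" by simp
    have "cmod (G \<xi> * av_mult h \<xi>) \<le> (D / \<bar>\<xi>\<bar> ^ (N + 1)) * (1 / (h * \<bar>\<xi>\<bar>))"
      unfolding norm_mult using G x0 \<open>\<xi> \<noteq> 0\<close> D h
      by (intro mult_mono av_mult_decay) (auto simp: field_simps)
    also have "\<dots> = D / (h * (\<bar>\<xi>\<bar> ^ N * \<xi>\<^sup>2))"
    proof -
      have "\<xi>\<^sup>2 = \<bar>\<xi>\<bar> * \<bar>\<xi>\<bar>" by (simp add: power2_eq_square)
      then show ?thesis by (simp only: power_add power_one_right times_divide_times_eq mult_1_right mult_ac)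
    qed
    also have "\<dots> \<le> D / (h * (\<delta> ^ (N + 2) * (1 + \<xi>\<^sup>2) / 2))"
    proof (rule divide_left_mono)
      have d2: "\<delta>\<^sup>2 \<le> \<xi>\<^sup>2" using x \<delta> by (metis abs_le_square_iff abs_of_pos)
      have "\<delta>\<^sup>2 \<le> 1" using \<delta> by (simp add: power_le_one)
      then have "\<delta>\<^sup>2 * \<xi>\<^sup>2 \<le> 1 * \<xi>\<^sup>2" by (intro mult_right_mono) auto
      with d2 have m1: "\<delta>\<^sup>2 * (1 + \<xi>\<^sup>2) \<le> 2 * \<xi>\<^sup>2" by (simp add: distrib_left)
      have m2: "\<delta> ^ N \<le> \<bar>\<xi>\<bar> ^ N" using x \<delta> by (intro power_mono) auto
      have "\<delta> ^ N * (\<delta>\<^sup>2 * (1 + \<xi>\<^sup>2)) \<le> \<bar>\<xi>\<bar> ^ N * (2 * \<xi>\<^sup>2)"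
        using \<delta> pos by (intro mult_mono[OF m2 m1]) auto
      then have "\<delta> ^ (N + 2) * (1 + \<xi>\<^sup>2) / 2 \<le> \<bar>\<xi>\<bar> ^ N * \<xi>\<^sup>2"
        unfolding power_add mult.assoc by linarith
      then show "h * (\<delta> ^ (N + 2) * (1 + \<xi>\<^sup>2) / 2) \<le> h * (\<bar>\<xi>\<bar> ^ N * \<xi>\<^sup>2)" using h by (intro mult_left_mono) auto
      show "0 < h * (\<bar>\<xi>\<bar> ^ N * \<xi>\<^sup>2) * (h * (\<delta> ^ (N + 2) * (1 + \<xi>\<^sup>2) / 2))"
        using h \<delta> \<open>\<xi> \<noteq> 0\<close> pos by (intro mult_pos_pos divide_pos_pos) simp_all
    qed (rule D)
    also have "\<dots> = (b * D) * inverse (1 + \<xi>\<^sup>2)" using h \<delta> pos by (simp add: b_def field_simps)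
    also have "\<dots> \<le> ((2 * a + b) * D) * inverse (1 + \<xi>\<^sup>2)"
      using a0 b0 D pos by (intro mult_right_mono) auto
    finally show ?thesis using False by (simp add: a_def b_def)
  qed
qed

text \<open>On the Fourier side \<open>G\<close> is the transform of the function to be approximated. \<open>E\<close> collects its
  frequencies \<open>\<ge> \<delta>\<close> and the action of the symbol \<open>1 - P \<xi> * fser \<phi> \<xi> x\<close> on its frequencies \<open>< \<delta>\<close>;
  \<open>d\<close> collects the coefficients due to frequencies \<open>\<ge> \<delta>\<close> and to the replacement of the average by
  the differential operator with symbol \<open>P\<close>.\<close>

theorem quasi_projection_error:
  fixes \<phi> :: "real \<Rightarrow> complex"
  assumes \<phi>: "integrable lborel \<phi>" and h: "h > 0" and \<delta>: "0 < \<delta>" "\<delta> < 1 / 2"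
    and b0: "\<And>\<xi>. \<bar>\<xi>\<bar> < \<delta> \<Longrightarrow> cmod (1 - FT \<phi> \<xi> * fourier_distr (phi_tilde h N) \<xi>) \<le> K0 * \<bar>\<xi>\<bar> ^ n"
    and b1: "\<And>\<xi> L. \<bar>\<xi>\<bar> < \<delta> \<Longrightarrow> finite L \<Longrightarrow> 0 \<notin> L \<Longrightarrow> (\<Sum>l\<in>L. cmod (FT \<phi> (\<xi> + of_int l))) \<le> K * \<bar>\<xi>\<bar> ^ n"
    and K: "K0 \<ge> 0" "K \<ge> 0"
  obtains C where "C \<ge> 0"
    "\<And>G D. integrable lborel G \<Longrightarrow> (\<And>\<xi>. cmod (G \<xi>) * \<bar>\<xi>\<bar> ^ (N + 1) \<le> D) \<Longrightarrow>
      \<exists>E d. E \<in> borel_measurable borel \<and>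
        (AE x in lborel. (LINT \<xi>|lborel. G \<xi> * ee (x * \<xi>)) - (\<Sum>m. (LINT \<xi>|lborel. G \<xi> * av_mult h \<xi> * ee (- (zz m * \<xi>))) * \<phi> (x + zz m))
           = E x - (\<Sum>m. d m * \<phi> (x + zz m))) \<and>
        (\<forall>x. ennreal (cmod (E x)) \<le> ennreal C * (\<integral>\<^sup>+\<xi>. ennreal (cmod (G \<xi>) * low_weight \<delta> n \<xi>) \<partial>lborel)) \<and>
        (\<integral>\<^sup>+x. ennreal ((cmod (E x))\<^sup>2) \<partial>lborel) \<le> ennreal C * (\<integral>\<^sup>+\<xi>. ennreal ((cmod (G \<xi>) * low_weight \<delta> n \<xi>)\<^sup>2) \<partial>lborel) \<and>
        (\<Sum>m. ennreal ((cmod (d m))\<^sup>2)) \<le> ennreal (C * D\<^sup>2)"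
proof -
  have [measurable]: "\<phi> \<in> borel_measurable borel" using \<phi> by auto
  define P where "P = fourier_distr (phi_tilde h N)"
  have [measurable]: "P \<in> borel_measurable borel"
  proof -
    have "P = (\<lambda>\<xi>. \<Sum>l\<le>N. cnj (av_coeff h l) * (- 1) ^ l * (2 * pi * \<i> * \<xi>) ^ l)"
      unfolding P_def by (rule ext) (rule fourier_phi_tilde)
    then show ?thesis by simp
  qed
  have [measurable]: "(\<lambda>(\<xi>, x). fser \<phi> \<xi> x) \<in> borel_measurable (borel \<Otimes>\<^sub>M borel)"
    unfolding fser_def by measurable
  \<comment> \<open>P differs from the multiplier of the average, which has modulus at most 1, by a
    Taylor remainder, and \<open>|\<xi>| < 1\<close> here.\<close>
  define P0 where "P0 = 1 + (2 * pi * h) ^ (N + 1)"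
  have "P0 \<ge> 0" using h by (simp add: P0_def)
  have P0: "cmod (P \<xi>) \<le> P0" if "\<bar>\<xi>\<bar> < \<delta>" for \<xi>
  proof -
    have "\<bar>\<xi>\<bar> ^ (N + 1) \<le> 1" using that \<delta> by (intro power_le_one) auto
    then have "(2 * pi * h) ^ (N + 1) * \<bar>\<xi>\<bar> ^ (N + 1) \<le> (2 * pi * h) ^ (N + 1) * 1"
      using h by (intro mult_left_mono) auto
    moreover have "cmod (P \<xi>) \<le> cmod (av_mult h \<xi>) + cmod (av_mult h \<xi> - P \<xi>)"
      using norm_triangle_ineq4[of "av_mult h \<xi>" "av_mult h \<xi> - P \<xi>"] by simp
    moreover have "cmod (av_mult h \<xi> - P \<xi>) \<le> (2 * pi * h) ^ (N + 1) * \<bar>\<xi>\<bar> ^ (N + 1)"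
      unfolding P_def by (rule av_mult_approx[OF h])
    ultimately show ?thesis using av_mult_le_1[OF h, of \<xi>] unfolding P0_def by linarith
  qed
  \<comment> \<open>Three contributions: 1 from the frequencies beyond \<delta>, K0 from the
    flatness at 0, and \<open>P0 * K\<close> from the nonzero translates in
    \<open>fser\<close>.\<close>
  define C1 where "C1 = 1 + K0 + P0 * K"
  have C1: "C1 \<ge> 1" using K \<open>P0 \<ge> 0\<close> by (simp add: C1_def)
  define B where "B x \<xi> = (if \<bar>\<xi>\<bar> < \<delta> then 1 - P \<xi> * fser \<phi> \<xi> x else 1)" for x \<xi>
  have B: "cmod (B x \<xi>) \<le> C1 * low_weight \<delta> n \<xi>" for x \<xi>
  proof (cases "\<bar>\<xi>\<bar> < \<delta>")
    case True
    have e: "1 - P \<xi> * fser \<phi> \<xi> x = (1 - FT \<phi> \<xi> * P \<xi>) - P \<xi> * (fser \<phi> \<xi> x - FT \<phi> \<xi>)"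
      by (simp add: algebra_simps)
    have "cmod (1 - P \<xi> * fser \<phi> \<xi> x) \<le> cmod (1 - FT \<phi> \<xi> * P \<xi>) + cmod (P \<xi>) * cmod (fser \<phi> \<xi> x - FT \<phi> \<xi>)"
      unfolding e using norm_triangle_ineq4[of "1 - FT \<phi> \<xi> * P \<xi>" "P \<xi> * (fser \<phi> \<xi> x - FT \<phi> \<xi>)"] by (simp add: norm_mult)
    also have "\<dots> \<le> K0 * \<bar>\<xi>\<bar> ^ n + P0 * (K * \<bar>\<xi>\<bar> ^ n)"
      using b0[OF True] P0[OF True] fser_bound(2)[OF b1[OF True], of x] \<open>P0 \<ge> 0\<close>
      by (intro add_mono mult_mono) (auto simp: P_def)
    also have "\<dots> \<le> C1 * \<bar>\<xi>\<bar> ^ n" by (simp add: C1_def algebra_simps)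
    finally show ?thesis using True by (simp add: B_def low_weight_def)
  qed (use C1 in \<open>simp add: B_def low_weight_def\<close>)
  have [measurable]: "(\<lambda>(x, \<xi>). B x \<xi>) \<in> borel_measurable (borel \<Otimes>\<^sub>M borel)"
    unfolding B_def by measurable
  have Bbd: "cmod (B x \<xi>) \<le> C1" for x \<xi>
  proof -
    have "low_weight \<delta> n \<xi> \<le> 1" using \<delta> by (auto simp: low_weight_def intro!: power_le_one)
    then have "C1 * low_weight \<delta> n \<xi> \<le> C1 * 1" using C1 by (intro mult_left_mono) auto
    then show ?thesis using B[of x \<xi>] by simp
  qed
  obtain C3 where C3: "C3 \<ge> 0"
    "\<And>w A. integrable lborel w \<Longrightarrow> (\<And>\<xi>. cmod (w \<xi>) \<le> A * inverse (1 + \<xi>\<^sup>2)) \<Longrightarrow>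
      (\<Sum>n. ennreal ((cmod (LINT \<xi>|lborel. w \<xi> * ee (- (zz n * \<xi>))))\<^sup>2)) \<le> ennreal (C3 * A\<^sup>2)"
    by (rule decaying_coefficients) blast
  define C2 where "C2 = 2 * (2 * pi * h) ^ (N + 1) + 2 / (h * \<delta> ^ (N + 2))"
  \<comment> \<open>\<open>4 * C1\<^sup>2\<close> serves the squared norm of the low plus the high
    part of E, \<open>C3 * C2\<^sup>2\<close> the coefficients d. As C1 is at least 1, C is also at
    least C1, which the supremum bound requires.\<close>
  define C where "C = 4 * C1\<^sup>2 + C3 * C2\<^sup>2"
  have "C \<ge> 0" using C3(1) by (simp add: C_def)
  have "C1 \<le> C1\<^sup>2" using C1 by (simp add: power2_eq_square)
  then have CC: "C1 \<le> C" "4 * C1\<^sup>2 \<le> C" "C3 * C2\<^sup>2 \<le> C" using C3(1) C1 by (simp_all add: C_def add_increasing2)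
  show thesis
  proof (rule that[OF \<open>C \<ge> 0\<close>])
    fix G :: "real \<Rightarrow> complex" and D
    assume G: "integrable lborel G" and GD: "\<And>\<xi>. cmod (G \<xi>) * \<bar>\<xi>\<bar> ^ (N + 1) \<le> D"
    have [measurable]: "G \<in> borel_measurable borel" using G by auto
    let ?R = "\<integral>\<^sup>+\<xi>. ennreal ((cmod (G \<xi>) * low_weight \<delta> n \<xi>)\<^sup>2) \<partial>lborel"
    define E where "E x = (LINT \<xi>|lborel. G \<xi> * B x \<xi> * ee (x * \<xi>))" for x
    have Em [measurable]: "E \<in> borel_measurable borel" unfolding E_def[abs_def] by measurable
    define gl where "gl x \<xi> = (if \<bar>\<xi>\<bar> < \<delta> then G \<xi> * B x \<xi> * ee (x * \<xi>) else 0)" for x \<xi>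
    define gh where "gh \<xi> = (if \<bar>\<xi>\<bar> < \<delta> then 0 else G \<xi>)" for \<xi>
    have [measurable]: "(\<lambda>(x, \<xi>). gl x \<xi>) \<in> borel_measurable (borel \<Otimes>\<^sub>M borel)" "gh \<in> borel_measurable borel"
      unfolding gl_def gh_def[abs_def] by measurable
    have igh: "integrable lborel gh"
      by (rule Bochner_Integration.integrable_bound[OF G]) (auto simp: gh_def)
    have igl: "integrable lborel (gl x)" for x
    proof (rule Bochner_Integration.integrable_bound)
      show "integrable lborel (\<lambda>\<xi>. C1 * cmod (G \<xi>))" using G by simp
      show "AE \<xi> in lborel. cmod (gl x \<xi>) \<le> norm (C1 * cmod (G \<xi>))"
        using Bbd[of x] C1 by (intro AE_I2) (auto simp: gl_def norm_mult mult.commute[of C1] intro!: mult_left_mono)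
    qed measurable
    \<comment> \<open>The parts need different Bessel inequalities: the symbol of the low part
      depends on x, though only periodically, whereas the high part is an ordinary inverse
      transform.\<close>
    define El where "El x = (LINT \<xi>|lborel. gl x \<xi>)" for x
    define Eh where "Eh x = (LINT \<xi>|lborel. gh \<xi> * ee (x * \<xi>))" for x
    have [measurable]: "El \<in> borel_measurable borel" "Eh \<in> borel_measurable borel"
      unfolding El_def[abs_def] Eh_def[abs_def] by measurable
    have igh': "integrable lborel (\<lambda>\<xi>. gh \<xi> * ee (x * \<xi>))" for x by (rule integrable_mult_ee_linear[OF igh])
    have E_split: "E x = El x + Eh x" for x
    proof -
      have "E x = (LINT \<xi>|lborel. gl x \<xi> + gh \<xi> * ee (x * \<xi>))"
        unfolding E_def by (intro Bochner_Integration.integral_cong refl) (simp add: gl_def gh_def B_def)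
      then show ?thesis unfolding El_def Eh_def using igl igh' by simp
    qed
    have E1: "ennreal (cmod (E x)) \<le> ennreal C * (\<integral>\<^sup>+\<xi>. ennreal (cmod (G \<xi>) * low_weight \<delta> n \<xi>) \<partial>lborel)" for x
    proof -
      have "ennreal (cmod (E x)) \<le> (\<integral>\<^sup>+\<xi>. ennreal (cmod (G \<xi> * B x \<xi> * ee (x * \<xi>))) \<partial>lborel)"
        unfolding E_def by (rule nn_integral_norm_bound)
      also have "\<dots> \<le> (\<integral>\<^sup>+\<xi>. ennreal C * ennreal (cmod (G \<xi>) * low_weight \<delta> n \<xi>) \<partial>lborel)"
      proof (rule nn_integral_mono)
        fix \<xi>
        have "cmod (B x \<xi>) \<le> C * low_weight \<delta> n \<xi>"
          using B[of x \<xi>] mult_right_mono[OF CC(1) low_weight_nonneg[of \<delta> n \<xi>]] by linarith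
        then have "cmod (G \<xi>) * cmod (B x \<xi>) \<le> cmod (G \<xi>) * (C * low_weight \<delta> n \<xi>)" by (intro mult_left_mono) auto
        then have "ennreal (cmod (G \<xi> * B x \<xi> * ee (x * \<xi>))) \<le> ennreal (C * (cmod (G \<xi>) * low_weight \<delta> n \<xi>))"
          by (intro ennreal_leI) (simp add: norm_mult mult_ac)
        also have "\<dots> = ennreal C * ennreal (cmod (G \<xi>) * low_weight \<delta> n \<xi>)"
          using \<open>C \<ge> 0\<close> by (intro ennreal_mult) auto
        finally show "ennreal (cmod (G \<xi> * B x \<xi> * ee (x * \<xi>))) \<le> ennreal C * ennreal (cmod (G \<xi>) * low_weight \<delta> n \<xi>)" .
      qed
      also have "\<dots> = ennreal C * (\<integral>\<^sup>+\<xi>. ennreal (cmod (G \<xi>) * low_weight \<delta> n \<xi>) \<partial>lborel)"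
        by (rule nn_integral_cmult) measurable
      finally show ?thesis .
    qed
    have Eh2: "(\<integral>\<^sup>+x. ennreal ((cmod (Eh x))\<^sup>2) \<partial>lborel) \<le> ennreal (C1\<^sup>2) * ?R"
    proof -
      have "Eh x = FT gh (- x)" for x by (simp add: Eh_def FT_def mult.commute)
      then have "(\<integral>\<^sup>+x. ennreal ((cmod (Eh x))\<^sup>2) \<partial>lborel) = (\<integral>\<^sup>+x. ennreal ((cmod (FT gh (0 + (- 1) * x)))\<^sup>2) \<partial>lborel)" by simp
      also have "\<dots> = (\<integral>\<^sup>+x. ennreal ((cmod (FT gh x))\<^sup>2) \<partial>lborel)"
        using nn_integral_real_affine[of "\<lambda>x. ennreal ((cmod (FT gh x))\<^sup>2)" "- 1" 0] by simp
      also have "\<dots> \<le> (\<integral>\<^sup>+\<xi>. ennreal ((cmod (gh \<xi>))\<^sup>2) \<partial>lborel)" by (rule FT_Bessel[OF igh])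
      also have "\<dots> \<le> ?R" by (intro nn_integral_mono ennreal_leI power_mono) (auto simp: gh_def low_weight_def)
      also have "\<dots> = 1 * ?R" by simp
      also have "\<dots> \<le> ennreal (C1\<^sup>2) * ?R" using C1 by (intro mult_right_mono) (auto simp: one_le_power simp flip: ennreal_1 intro!: ennreal_leI)
      finally show ?thesis .
    qed
    have El2: "(\<integral>\<^sup>+x. ennreal ((cmod (El x))\<^sup>2) \<partial>lborel) \<le> ennreal (C1\<^sup>2) * ?R"
    proof -
      \<comment> \<open>Since \<open>B\<close> is periodic in x, the values of \<open>El\<close> at
        \<open>x + zz m\<close> are the Fourier coefficients of one function, \<open>gl x\<close>,
        supported inside a single period. Integrating over x in \<open>UI\<close> then recovers the
        norm.\<close>
      have per: "(\<Sum>m. ennreal ((cmod (El (x + zz m)))\<^sup>2)) \<le> ennreal (C1\<^sup>2) * ?R" for x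
      proof -
        have "B (x + zz m) \<xi> = B x \<xi>" for m \<xi>
        proof -
          have "ee (zz k * (x + zz m)) = ee (zz k * x)" for k
            using ee_add_int[of "zz k * x" "int_decode k * int_decode m"] by (simp add: zz_def distrib_left)
          then show ?thesis by (simp add: B_def fser_def)
        qed
        then have "gl (x + zz m) \<xi> = gl x \<xi> * ee (zz m * \<xi>)" for m \<xi>
          by (simp add: gl_def distrib_right ee_add)
        then have "(\<Sum>m. ennreal ((cmod (El (x + zz m)))\<^sup>2)) = (\<Sum>m. ennreal ((cmod (LINT \<xi>|lborel. gl x \<xi> * ee (zz m * \<xi>)))\<^sup>2))"
          by (simp add: El_def)
        also have "\<dots> \<le> 1 * (\<integral>\<^sup>+\<xi>. ennreal (C1\<^sup>2 * (cmod (G \<xi>) * low_weight \<delta> n \<xi>)\<^sup>2) \<partial>lborel)"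
        proof (rule circle_Bessel[OF igl, where \<omega> = "indicator UI"])
          fix \<xi>
          show "(cmod (gl x \<xi>))\<^sup>2 \<le> indicator UI \<xi> * (C1\<^sup>2 * (cmod (G \<xi>) * low_weight \<delta> n \<xi>)\<^sup>2)"
          proof (cases "\<bar>\<xi>\<bar> < \<delta>")
            case True
            then have "\<xi> \<in> UI" using \<delta> by (auto simp: UI_def)
            moreover have "cmod (gl x \<xi>) \<le> C1 * (cmod (G \<xi>) * low_weight \<delta> n \<xi>)"
              using mult_left_mono[OF B[of x \<xi>], of "cmod (G \<xi>)"] True by (simp add: gl_def norm_mult mult_ac)
            then have "(cmod (gl x \<xi>))\<^sup>2 \<le> (C1 * (cmod (G \<xi>) * low_weight \<delta> n \<xi>))\<^sup>2" by (rule power_mono) simp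
            ultimately show ?thesis by (simp add: power_mult_distrib)
          qed (simp add: gl_def)
          show "(\<Sum>m. ennreal (indicator UI (\<xi> + zz m))) \<le> 1" if "\<xi> \<in> UI"
            using suminf_indicator_UI_plus[OF that] by (simp only: order_refl)
        qed auto
        also have "\<dots> = (\<integral>\<^sup>+\<xi>. ennreal (C1\<^sup>2) * ennreal ((cmod (G \<xi>) * low_weight \<delta> n \<xi>)\<^sup>2) \<partial>lborel)"
          by (simp add: ennreal_mult)
        also have "\<dots> = ennreal (C1\<^sup>2) * ?R" by (rule nn_integral_cmult) measurable
        finally show ?thesis .
      qed
      have "(\<integral>\<^sup>+x. ennreal ((cmod (El x))\<^sup>2) \<partial>lborel) = (\<integral>\<^sup>+x. (\<Sum>m. ennreal ((cmod (El (x + zz m)))\<^sup>2)) * indicator UI x \<partial>lborel)"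
        by (rule nn_integral_fold) measurable
      also have "\<dots> \<le> (\<integral>\<^sup>+x. (ennreal (C1\<^sup>2) * ?R) * indicator UI x \<partial>lborel)"
        by (intro nn_integral_mono mult_right_mono per) simp
      also have "\<dots> = ennreal (C1\<^sup>2) * ?R" by (simp add: nn_integral_cmult_indicator)
      finally show ?thesis .
    qed
    have E2: "(\<integral>\<^sup>+x. ennreal ((cmod (E x))\<^sup>2) \<partial>lborel) \<le> ennreal C * ?R"
    proof -
      have "(\<integral>\<^sup>+x. ennreal ((cmod (E x))\<^sup>2) \<partial>lborel) \<le> (\<integral>\<^sup>+x. 2 * ennreal ((cmod (El x))\<^sup>2) + 2 * ennreal ((cmod (Eh x))\<^sup>2) \<partial>lborel)"
      proof (rule nn_integral_mono)
        fix x
        have "(cmod (E x))\<^sup>2 \<le> (cmod (El x) + cmod (Eh x))\<^sup>2"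
          unfolding E_split by (intro power_mono norm_triangle_ineq) simp
        also have "\<dots> \<le> 2 * (cmod (El x))\<^sup>2 + 2 * (cmod (Eh x))\<^sup>2"
          using sum_squares_bound[of "cmod (El x)" "cmod (Eh x)"] by (simp add: power2_sum)
        finally have "ennreal ((cmod (E x))\<^sup>2) \<le> ennreal (2 * (cmod (El x))\<^sup>2 + 2 * (cmod (Eh x))\<^sup>2)" by (rule ennreal_leI)
        then show "ennreal ((cmod (E x))\<^sup>2) \<le> 2 * ennreal ((cmod (El x))\<^sup>2) + 2 * ennreal ((cmod (Eh x))\<^sup>2)"
          by (simp add: ennreal_mult)
      qed
      also have "\<dots> = 2 * (\<integral>\<^sup>+x. ennreal ((cmod (El x))\<^sup>2) \<partial>lborel) + 2 * (\<integral>\<^sup>+x. ennreal ((cmod (Eh x))\<^sup>2) \<partial>lborel)"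
        by (subst nn_integral_add) (simp_all add: nn_integral_cmult)
      also have "\<dots> \<le> 2 * (ennreal (C1\<^sup>2) * ?R) + 2 * (ennreal (C1\<^sup>2) * ?R)"
        by (intro add_mono mult_left_mono El2 Eh2) simp_all
      also have "\<dots> = ennreal (4 * C1\<^sup>2) * ?R"
      proof -
        have "2 * (a * r) + 2 * (a * r) = (4 * a) * r" for a r :: ennreal
          by (simp add: distrib_right[symmetric] mult.assoc[symmetric])
        then show ?thesis by (simp add: ennreal_mult)
      qed
      also have "\<dots> \<le> ennreal C * ?R" by (intro mult_right_mono ennreal_leI CC) simp
      finally show ?thesis .
    qed
    \<comment> \<open>\<open>G \<xi> * av_mult h \<xi>\<close> is split into v, to which Poisson
      summation applies, and w, which is small by the decay estimate.\<close>
    define w where "w \<xi> = G \<xi> * (av_mult h \<xi> - (if \<bar>\<xi>\<bar> < \<delta> then P \<xi> else 0))" for \<xi>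
    define v where "v \<xi> = (if \<bar>\<xi>\<bar> < \<delta> then G \<xi> * P \<xi> else 0)" for \<xi>
    have [measurable]: "w \<in> borel_measurable borel" "v \<in> borel_measurable borel"
      unfolding w_def[abs_def] v_def[abs_def] by measurable
    have ia: "integrable lborel (\<lambda>\<xi>. G \<xi> * av_mult h \<xi>)"
      by (rule integrable_mult_bounded[OF G _ av_mult_le_1[OF h]]) measurable
    have iv: "integrable lborel v"
    proof (rule Bochner_Integration.integrable_bound)
      show "integrable lborel (\<lambda>\<xi>. P0 * cmod (G \<xi>))" using G by simp
      show "AE \<xi> in lborel. cmod (v \<xi>) \<le> norm (P0 * cmod (G \<xi>))"
        using P0 \<open>P0 \<ge> 0\<close> by (intro AE_I2) (auto simp: v_def norm_mult mult.commute[of P0] intro!: mult_left_mono)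
    qed measurable
    have w_eq: "w \<xi> = G \<xi> * av_mult h \<xi> - v \<xi>" for \<xi> by (simp add: w_def v_def right_diff_distrib)
    have iw: "integrable lborel w" unfolding w_eq[abs_def] using ia iv by simp
    define d where "d m = (LINT \<xi>|lborel. w \<xi> * ee (- (zz m * \<xi>)))" for m
    define e where "e m = (LINT \<xi>|lborel. v \<xi> * ee (- (zz m * \<xi>)))" for m
    define c where "c m = (LINT \<xi>|lborel. G \<xi> * av_mult h \<xi> * ee (- (zz m * \<xi>)))" for m
    have iee: "integrable lborel (\<lambda>\<xi>. u \<xi> * ee (- (zz m * \<xi>)))" if "integrable lborel u" for u m
      using integrable_mult_ee_linear[OF that, of "- zz m"] by simp
    have cde: "c m = d m + e m" for m
      unfolding c_def d_def e_def w_eq left_diff_distrib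
      using iee[OF ia, of m] iee[OF iv, of m] by simp
    have dsum: "(\<Sum>m. ennreal ((cmod (d m))\<^sup>2)) \<le> ennreal (C * D\<^sup>2)"
    proof -
      have "(\<Sum>m. ennreal ((cmod (d m))\<^sup>2)) \<le> ennreal (C3 * (C2 * D)\<^sup>2)"
        unfolding d_def
      proof (rule C3(2)[OF iw])
        show "cmod (w \<xi>) \<le> C2 * D * inverse (1 + \<xi>\<^sup>2)" for \<xi>
          unfolding w_def P_def C2_def using \<delta> by (intro high_frequency_multiplier_bound h GD) simp_all
      qed
      also have "\<dots> \<le> ennreal (C * D\<^sup>2)"
        using mult_right_mono[OF CC(3), of "D\<^sup>2"] by (intro ennreal_leI) (simp add: power_mult_distrib mult.assoc)
      finally show ?thesis .
    qed
    have bounded_coeff: "\<exists>b. \<forall>m. cmod (LINT \<xi>|lborel. u \<xi> * ee (- (zz m * \<xi>))) \<le> b" if "integrable lborel u" for u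
    proof -
      have "cmod (LINT \<xi>|lborel. u \<xi> * ee (- (zz m * \<xi>))) \<le> (LINT \<xi>|lborel. cmod (u \<xi>))" for m
        using norm_FT_le[OF that, of "zz m"] by (simp add: FT_def mult.commute)
      then show ?thesis by blast
    qed
    have sb: "summable (\<lambda>m. cmod (FT \<phi> (\<xi> + zz m)))" if "\<bar>\<xi>\<bar> < \<delta>" for \<xi>
      by (rule fser_bound(1)[OF b1[OF that]])
    have pois: "AE x in lborel. AE \<xi> in lborel. \<bar>\<xi>\<bar> < \<delta> \<longrightarrow>
        (\<Sum>n. \<phi> (x + zz n) * ee (- ((x + zz n) * \<xi>))) = (\<Sum>n. FT \<phi> (\<xi> + zz n) * ee (zz n * x))"
      by (rule Poisson_summation_AE_swap[OF \<phi>]) (rule sb)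
    have "AE x in lborel. (LINT \<xi>|lborel. G \<xi> * ee (x * \<xi>)) - (\<Sum>m. c m * \<phi> (x + zz m)) = E x - (\<Sum>m. d m * \<phi> (x + zz m))"
      using fold_complex(1)[OF \<phi>] pois
    proof eventually_elim
      case (elim x)
      have sm: "summable (\<lambda>m. a m * \<phi> (x + zz m))" if ab: "\<exists>b. \<forall>m. cmod (a m) \<le> b" for a
      proof -
        obtain b where b: "\<And>m. cmod (a m) \<le> b" using ab by blast
        show ?thesis
        proof (rule summable_comparison_test')
          show "summable (\<lambda>m. b * cmod (\<phi> (x + zz m)))" using elim(1) by (rule summable_mult)
          show "cmod (a m * \<phi> (x + zz m)) \<le> b * cmod (\<phi> (x + zz m))" if "0 \<le> m" for m
            unfolding norm_mult by (intro mult_right_mono b) simp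
        qed
      qed
      have sd: "summable (\<lambda>m. d m * \<phi> (x + zz m))" unfolding d_def by (rule sm[OF bounded_coeff[OF iw]])
      have se: "summable (\<lambda>m. e m * \<phi> (x + zz m))" unfolding e_def by (rule sm[OF bounded_coeff[OF iv]])
      have "(\<Sum>m. c m * \<phi> (x + zz m)) = (\<Sum>m. d m * \<phi> (x + zz m)) + (\<Sum>m. e m * \<phi> (x + zz m))"
        unfolding cde distrib_right by (rule suminf_add[OF sd se, symmetric])
      moreover have "(\<Sum>m. e m * \<phi> (x + zz m)) = (LINT \<xi>|lborel. v \<xi> * ee (x * \<xi>) * fser \<phi> \<xi> x)"
        unfolding e_def
      proof (rule periodic_series_integral[OF elim(1) _ iv])
        show "AE \<xi> in lborel. \<bar>\<xi>\<bar> < \<delta> \<longrightarrow> (\<Sum>n. \<phi> (x + zz n) * ee (- ((x + zz n) * \<xi>))) = fser \<phi> \<xi> x"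
          using elim(2) by (simp add: fser_def)
        show "v \<xi> = 0" if "\<not> \<bar>\<xi>\<bar> < \<delta>" for \<xi> using that by (simp add: v_def)
      qed measurable
      \<comment> \<open>\<open>1 - B x \<xi>\<close> equals
        \<open>P \<xi> * fser \<phi> \<xi> x\<close> below \<delta> and 0 elsewhere, so the two
        integrals differ exactly by the Poisson side of the v part.\<close>
      moreover have "E x = (LINT \<xi>|lborel. G \<xi> * ee (x * \<xi>)) - (LINT \<xi>|lborel. v \<xi> * ee (x * \<xi>) * fser \<phi> \<xi> x)"
      proof -
        have i1: "integrable lborel (\<lambda>\<xi>. G \<xi> * ee (x * \<xi>))" by (rule integrable_mult_ee_linear[OF G])
        have "integrable lborel (\<lambda>\<xi>. G \<xi> * B x \<xi> * ee (x * \<xi>))"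
          by (rule integrable_mult_ee_linear[OF integrable_mult_bounded[OF G _ Bbd]]) measurable
        from Bochner_Integration.integrable_diff[OF i1 this]
        have i2: "integrable lborel (\<lambda>\<xi>. G \<xi> * ee (x * \<xi>) - G \<xi> * B x \<xi> * ee (x * \<xi>))" .
        have eq: "G \<xi> * ee (x * \<xi>) - G \<xi> * B x \<xi> * ee (x * \<xi>) = v \<xi> * ee (x * \<xi>) * fser \<phi> \<xi> x" for \<xi>
          by (simp add: B_def v_def algebra_simps)
        have "(LINT \<xi>|lborel. G \<xi> * ee (x * \<xi>)) - (LINT \<xi>|lborel. v \<xi> * ee (x * \<xi>) * fser \<phi> \<xi> x)
           = (LINT \<xi>|lborel. G \<xi> * ee (x * \<xi>) - v \<xi> * ee (x * \<xi>) * fser \<phi> \<xi> x)"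
          using i1 i2 unfolding eq by simp
        also have "\<dots> = E x" unfolding E_def eq[symmetric] by simp
        finally show ?thesis by simp
      qed
      ultimately show ?case by simp
    qed
    then show "\<exists>E d. E \<in> borel_measurable borel \<and>
        (AE x in lborel. (LINT \<xi>|lborel. G \<xi> * ee (x * \<xi>)) - (\<Sum>m. (LINT \<xi>|lborel. G \<xi> * av_mult h \<xi> * ee (- (zz m * \<xi>))) * \<phi> (x + zz m))
           = E x - (\<Sum>m. d m * \<phi> (x + zz m))) \<and>
        (\<forall>x. ennreal (cmod (E x)) \<le> ennreal C * (\<integral>\<^sup>+\<xi>. ennreal (cmod (G \<xi>) * low_weight \<delta> n \<xi>) \<partial>lborel)) \<and>
        (\<integral>\<^sup>+x. ennreal ((cmod (E x))\<^sup>2) \<partial>lborel) \<le> ennreal C * ?R \<and>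
        (\<Sum>m. ennreal ((cmod (d m))\<^sup>2)) \<le> ennreal (C * D\<^sup>2)"
      unfolding c_def by (intro exI[of _ E] exI[of _ d] conjI allI Em E1 E2 dsum)
  qed
qed

section \<open>Norm estimates and rescaling\<close>

text \<open>A Borel null set covering the exceptional set is transported, so the lemma applies to
  properties of functions that are only Lebesgue measurable.\<close>

lemma AE_lborel_affine:
  fixes P :: "real \<Rightarrow> bool"
  assumes "AE x in lborel. P x" "c \<noteq> 0"
  shows "AE x in lborel. P (t + c * x)"
proof -
  obtain Z where Z: "Z \<in> null_sets lborel" "{x \<in> space lborel. \<not> P x} \<subseteq> Z"
    using assms(1) by (auto simp: eventually_ae_filter)
  have [measurable]: "Z \<in> sets borel" using Z(1) by auto
  have "AE x in lborel. x \<notin> Z" using Z(1) by (rule AE_not_in)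
  then have "AE x in lborel. t + c * x \<notin> Z"
    by (intro AE_borel_affine[OF assms(2)]) measurable
  then show ?thesis by eventually_elim (use Z(2) in auto)
qed

text \<open>Completeness: every subset of the set where f and g differ is Lebesgue
  measurable.\<close>

lemma measurable_lebesgue_AE_eq:
  fixes f g :: "real \<Rightarrow> complex"
  assumes ae: "AE x in lborel. f x = g x" and g: "g \<in> borel_measurable borel"
  shows "f \<in> borel_measurable lebesgue"
proof (rule measurableI)
  fix A :: "complex set" assume A: "A \<in> sets borel"
  have p: "Measurable.pred lebesgue (\<lambda>x. f x \<noteq> g x \<and> Q x)" for Q
    using ae by (intro sets_completion_AE) auto
  have "g \<in> borel_measurable lebesgue" using g by (intro measurable_completion) simp
  then have "Measurable.pred lebesgue (\<lambda>x. g x \<in> A)" using A by simp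
  then have "Measurable.pred lebesgue (\<lambda>x. (g x \<in> A \<and> \<not> (f x \<noteq> g x \<and> g x \<in> A)) \<or> (f x \<noteq> g x \<and> f x \<in> A))"
    by (intro pred_intros_logic p)
  then have "Measurable.pred lebesgue (\<lambda>x. f x \<in> A)"
    by (rule measurable_cong[THEN iffD1, rotated]) auto
  then show "f -` A \<inter> space lebesgue \<in> sets lebesgue" by (simp add: pred_def vimage_def Int_def conj_commute)
qed simp

text \<open>For P \<ge> 2 the pointwise inequality
  \<open>t powr P \<le> X powr (P - 2) * t\<^sup>2\<close> combines a supremum bound with an L_2
  bound.\<close>

lemma bounded_lp_bound:
  fixes E :: "real \<Rightarrow> complex"
  assumes [measurable]: "E \<in> borel_measurable borel" and X: "\<And>x. cmod (E x) \<le> X" and P: "P \<ge> 2"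
  shows "(\<integral>\<^sup>+x. ennreal (cmod (E x) powr P) \<partial>lborel) \<le> ennreal (X powr (P - 2)) * (\<integral>\<^sup>+x. ennreal ((cmod (E x))\<^sup>2) \<partial>lborel)"
proof -
  have "(\<integral>\<^sup>+x. ennreal (cmod (E x) powr P) \<partial>lborel) \<le> (\<integral>\<^sup>+x. ennreal (X powr (P - 2)) * ennreal ((cmod (E x))\<^sup>2) \<partial>lborel)"
  proof (rule nn_integral_mono)
    fix x
    have "cmod (E x) powr P \<le> X powr (P - 2) * (cmod (E x))\<^sup>2"
    proof (cases "E x = 0")
      case False
      then have pos: "0 < cmod (E x)" by simp
      have "cmod (E x) powr P = cmod (E x) powr (P - 2) * cmod (E x) powr 2"
        using powr_add[of "cmod (E x)" "P - 2" 2] by simp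
      also have "\<dots> = cmod (E x) powr (P - 2) * (cmod (E x))\<^sup>2"
        using pos by simp
      also have "\<dots> \<le> X powr (P - 2) * (cmod (E x))\<^sup>2"
        using X[of x] P by (intro mult_right_mono powr_mono2) auto
      finally show ?thesis .
    qed simp
    then show "ennreal (cmod (E x) powr P) \<le> ennreal (X powr (P - 2)) * ennreal ((cmod (E x))\<^sup>2)"
      by (simp add: ennreal_mult[symmetric] ennreal_leI)
  qed
  then show ?thesis by (simp add: nn_integral_cmult)
qed

lemma powr_diff_le:
  fixes a b :: complex
  assumes "P \<ge> 2"
  shows "cmod (a - b) powr P \<le> 2 powr P * (cmod a powr P + cmod b powr P)"
proof -
  define m where "m = max (cmod a) (cmod b)"
  have "cmod (a - b) \<le> 2 * m" using norm_triangle_ineq4[of a b] unfolding m_def by linarith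
  then have "cmod (a - b) powr P \<le> (2 * m) powr P" using assms by (intro powr_mono2) auto
  also have "\<dots> = 2 powr P * m powr P" by (rule powr_mult)
  also have "m powr P \<le> cmod a powr P + cmod b powr P" by (simp add: m_def max_def)
  finally show ?thesis by simp
qed

section \<open>L_p bounds for series of integer shifts\<close>

definition psum :: "(real \<Rightarrow> complex) \<Rightarrow> real \<Rightarrow> ennreal" where
  "psum \<phi> x = (\<Sum>m. ennreal (cmod (\<phi> (x + zz m))))"

lemma psum_measurable [measurable]:
  assumes [measurable]: "\<phi> \<in> borel_measurable borel"
  shows "psum \<phi> \<in> borel_measurable borel"
  unfolding psum_def[abs_def] by measurable

lemma psum_periodic: "psum \<phi> (x + of_int k) = psum \<phi> x"
  unfolding psum_def by (rule suminf_zz_shift[of "\<lambda>x. ennreal (cmod (\<phi> x))"])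

lemma coeff_le_of_square_sum:
  assumes "(\<Sum>m. ennreal ((cmod (d m))\<^sup>2)) \<le> ennreal (S\<^sup>2)" "S \<ge> 0"
  shows "cmod (d m) \<le> S"
proof -
  have "ennreal ((cmod (d m))\<^sup>2) = (\<Sum>i\<in>{m}. ennreal ((cmod (d i))\<^sup>2))" by simp
  also have "\<dots> \<le> (\<Sum>m. ennreal ((cmod (d m))\<^sup>2))" by (rule sum_le_suminf) auto
  also have "\<dots> \<le> ennreal (S\<^sup>2)" by (rule assms(1))
  finally have "(cmod (d m))\<^sup>2 \<le> S\<^sup>2" by simp
  then show ?thesis using assms(2) by (rule power2_le_imp_le)
qed

lemma series_sup_bound:
  assumes d: "\<And>m. cmod (d m) \<le> S" and fin: "psum \<phi> x < \<infinity>" and "S \<ge> 0"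
  shows "cmod (\<Sum>m. d m * \<phi> (x + zz m)) \<le> S * enn2real (psum \<phi> x)"
proof -
  have sm: "summable (\<lambda>m. cmod (\<phi> (x + zz m)))"
    using fin unfolding psum_def by (intro summable_suminf_not_top) auto
  have ps: "enn2real (psum \<phi> x) = (\<Sum>m. cmod (\<phi> (x + zz m)))"
    unfolding psum_def by (subst suminf_ennreal2) (auto simp: sm suminf_nonneg)
  have le: "cmod (d m * \<phi> (x + zz m)) \<le> S * cmod (\<phi> (x + zz m))" for m
    unfolding norm_mult by (intro mult_right_mono d) simp
  have s2: "summable (\<lambda>m. S * cmod (\<phi> (x + zz m)))" using sm by (rule summable_mult)
  have s1: "summable (\<lambda>m. cmod (d m * \<phi> (x + zz m)))"
    by (rule summable_comparison_test'[OF s2]) (simp add: le)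
  have "cmod (\<Sum>m. d m * \<phi> (x + zz m)) \<le> (\<Sum>m. cmod (d m * \<phi> (x + zz m)))" by (rule summable_norm[OF s1])
  also have "\<dots> \<le> (\<Sum>m. S * cmod (\<phi> (x + zz m)))" by (rule suminf_le[OF le s1 s2])
  also have "\<dots> = S * enn2real (psum \<phi> x)" unfolding ps by (rule suminf_mult[OF sm])
  finally show ?thesis .
qed

text \<open>Let \<tau> be the modulus of the series and F the periodization of the modulus of
  \<phi>. Of the P factors \<tau>, P - 2 are bounded by \<open>S * F\<close> and two by
  Cauchy-Schwarz: \<open>\<tau>\<^sup>2\<close> is at most F times the sum of
  \<open>(cmod (d m))\<^sup>2 * cmod (\<phi> (x + zz m))\<close>. Thus only the square sum of d
  enters, and what remains to integrate folds to the P-th power of F over one period.\<close>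

lemma series_lp_bound:
  assumes [measurable]: "\<phi> \<in> borel_measurable borel" and fin: "AE x in lborel. psum \<phi> x < \<infinity>"
    and d: "(\<Sum>m. ennreal ((cmod (d m))\<^sup>2)) \<le> ennreal (S\<^sup>2)" and S: "S \<ge> 0" and P: "P \<ge> 2"
  shows "(\<integral>\<^sup>+x. ennreal (cmod (\<Sum>m. d m * \<phi> (x + zz m)) powr P) \<partial>lborel)
    \<le> ennreal (S powr P) * (\<integral>\<^sup>+x. ennreal (enn2real (psum \<phi> x) powr P) * indicator UI x \<partial>lborel)"
proof -
  \<comment> \<open>The exponent is P - 2 from the supremum bound plus 1 from
    Cauchy-Schwarz.\<close>
  define W where "W x = ennreal (enn2real (psum \<phi> x) powr (P - 1))" for x
  have [measurable]: "W \<in> borel_measurable borel" unfolding W_def[abs_def] by measurable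
  have Wper: "W (x + zz m) = W x" for x m by (simp add: W_def zz_def psum_periodic)
  have dS: "cmod (d m) \<le> S" for m by (rule coeff_le_of_square_sum[OF d S])
  define Q where "Q x = (\<Sum>m. ennreal ((cmod (d m))\<^sup>2) * ennreal (cmod (\<phi> (x + zz m))))" for x
  have pt: "ennreal (cmod (\<Sum>m. d m * \<phi> (x + zz m)) powr P) \<le> ennreal (S powr (P - 2)) * (W x * Q x)"
    if f: "psum \<phi> x < \<infinity>" for x
  proof -
    define F where "F = enn2real (psum \<phi> x)"
    have F: "psum \<phi> x = ennreal F" using f by (simp add: F_def)
    have "F \<ge> 0" by (simp add: F_def)
    define \<tau> where "\<tau> = cmod (\<Sum>m. d m * \<phi> (x + zz m))"
    have \<tau>S: "\<tau> \<le> S * F" unfolding \<tau>_def F_def by (rule series_sup_bound[OF dS f S])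
    show ?thesis
    proof (cases "\<tau> = 0")
      case False
      then have \<tau>: "\<tau> > 0" by (simp add: \<tau>_def)
      then have "S * F > 0" using \<tau>S by linarith
      then have "S > 0" "F > 0" using S \<open>F \<ge> 0\<close> by (auto simp: zero_less_mult_iff)
      have sm: "summable (\<lambda>m. cmod (\<phi> (x + zz m)))"
        using f unfolding psum_def by (intro summable_suminf_not_top) auto
      have sd: "summable (\<lambda>m. cmod (d m * \<phi> (x + zz m)))"
      proof (rule summable_comparison_test'[OF summable_mult[OF sm, of S]])
        show "norm (cmod (d m * \<phi> (x + zz m))) \<le> S * cmod (\<phi> (x + zz m))" if "0 \<le> m" for m
          using dS[of m] by (simp add: norm_mult mult_right_mono)
      qed
      have "ennreal \<tau> \<le> ennreal (\<Sum>m. cmod (d m * \<phi> (x + zz m)))"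
        unfolding \<tau>_def by (intro ennreal_leI summable_norm sd)
      also have "\<dots> = (\<Sum>m. ennreal (cmod (d m * \<phi> (x + zz m))))"
        by (rule suminf_ennreal2[symmetric, OF _ sd]) simp
      also have "\<dots> = (\<Sum>m. ennreal (cmod (d m) * sqrt (cmod (\<phi> (x + zz m)))) * ennreal (sqrt (cmod (\<phi> (x + zz m)))))"
        by (intro arg_cong[where f = suminf] ext) (simp add: norm_mult mult.assoc flip: ennreal_mult)
      finally have "(ennreal \<tau>)\<^sup>2 \<le> (\<integral>\<^sup>+m. ennreal (cmod (d m) * sqrt (cmod (\<phi> (x + zz m)))) * ennreal (sqrt (cmod (\<phi> (x + zz m)))) \<partial>count_space UNIV)\<^sup>2"
        unfolding nn_integral_count_space_nat by (rule power_mono) simp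
      also have "\<dots> \<le> (\<integral>\<^sup>+m. (ennreal (cmod (d m) * sqrt (cmod (\<phi> (x + zz m)))))\<^sup>2 \<partial>count_space UNIV)
          * (\<integral>\<^sup>+m. (ennreal (sqrt (cmod (\<phi> (x + zz m)))))\<^sup>2 \<partial>count_space UNIV)"
        by (rule Cauchy_Schwarz_nn_integral) auto
      also have "\<dots> = Q x * psum \<phi> x"
        unfolding nn_integral_count_space_nat Q_def psum_def
        by (simp add: ennreal_power power_mult_distrib ennreal_mult)
      finally have sq: "ennreal (\<tau>\<^sup>2) \<le> Q x * ennreal F" using \<tau> by (simp add: ennreal_power F)
      have "\<tau> powr P = \<tau> powr (P - 2) * \<tau> powr 2" using powr_add[of \<tau> "P - 2" 2] by simp
      also have "\<dots> = \<tau> powr (P - 2) * \<tau>\<^sup>2" using \<tau> by simp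
      also have "\<dots> \<le> (S * F) powr (P - 2) * \<tau>\<^sup>2"
        using \<tau>S \<tau> P by (intro mult_right_mono powr_mono2) auto
      finally have "ennreal (\<tau> powr P) \<le> ennreal ((S * F) powr (P - 2) * \<tau>\<^sup>2)" by (rule ennreal_leI)
      also have "\<dots> = ennreal (S powr (P - 2) * F powr (P - 2)) * ennreal (\<tau>\<^sup>2)"
        by (subst powr_mult) (rule ennreal_mult, simp_all)
      also have "\<dots> \<le> ennreal (S powr (P - 2) * F powr (P - 2)) * (Q x * ennreal F)"
        by (intro mult_left_mono sq) simp
      also have "\<dots> = ennreal (S powr (P - 2)) * (ennreal (F powr (P - 2) * F) * Q x)"
        using \<open>F \<ge> 0\<close> by (simp add: ennreal_mult mult_ac)
      also have "F powr (P - 2) * F = F powr (P - 1)"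
        using \<open>F > 0\<close> powr_add[of F "P - 2" 1] by simp
      finally show ?thesis by (simp add: \<tau>_def W_def F_def)
    qed (simp add: \<tau>_def)
  qed
  have "(\<integral>\<^sup>+x. ennreal (cmod (\<Sum>m. d m * \<phi> (x + zz m)) powr P) \<partial>lborel) \<le> (\<integral>\<^sup>+x. ennreal (S powr (P - 2)) * (W x * Q x) \<partial>lborel)"
    using fin by (intro nn_integral_mono_AE) (auto elim!: eventually_mono intro: pt)
  also have "\<dots> = ennreal (S powr (P - 2)) * (\<integral>\<^sup>+x. (\<Sum>m. ennreal ((cmod (d m))\<^sup>2) * (W x * ennreal (cmod (\<phi> (x + zz m))))) \<partial>lborel)"
  proof -
    have "W x * Q x = (\<Sum>m. ennreal ((cmod (d m))\<^sup>2) * (W x * ennreal (cmod (\<phi> (x + zz m)))))" for x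
      unfolding Q_def ennreal_suminf_cmult[symmetric] by (simp only: mult.left_commute)
    moreover have "(\<lambda>x. \<Sum>m. ennreal ((cmod (d m))\<^sup>2) * (W x * ennreal (cmod (\<phi> (x + zz m))))) \<in> borel_measurable lborel"
      by measurable
    ultimately show ?thesis by (simp only: nn_integral_cmult)
  qed
  also have "(\<integral>\<^sup>+x. (\<Sum>m. ennreal ((cmod (d m))\<^sup>2) * (W x * ennreal (cmod (\<phi> (x + zz m))))) \<partial>lborel)
      = (\<Sum>m. ennreal ((cmod (d m))\<^sup>2) * (\<integral>\<^sup>+x. W x * ennreal (cmod (\<phi> (x + zz m))) \<partial>lborel))"
    by (subst nn_integral_suminf) (simp_all add: nn_integral_cmult)
  \<comment> \<open>W is periodic, so the shift by \<open>zz m\<close> can be undone and the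
    integral no longer depends on m.\<close>
  also have "(\<lambda>m. \<integral>\<^sup>+x. W x * ennreal (cmod (\<phi> (x + zz m))) \<partial>lborel) = (\<lambda>m. \<integral>\<^sup>+x. W x * ennreal (cmod (\<phi> x)) \<partial>lborel)"
  proof
    fix m
    have "(\<integral>\<^sup>+x. W x * ennreal (cmod (\<phi> x)) \<partial>lborel) = (\<integral>\<^sup>+x. W (zz m + 1 * x) * ennreal (cmod (\<phi> (zz m + 1 * x))) \<partial>lborel)"
      by (subst nn_integral_real_affine[where c = 1 and t = "zz m"]) simp_all
    then show "(\<integral>\<^sup>+x. W x * ennreal (cmod (\<phi> (x + zz m))) \<partial>lborel) = (\<integral>\<^sup>+x. W x * ennreal (cmod (\<phi> x)) \<partial>lborel)"
      by (simp add: add.commute[of "zz m"] Wper)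
  qed
  also have "(\<Sum>m. ennreal ((cmod (d m))\<^sup>2) * (\<integral>\<^sup>+x. W x * ennreal (cmod (\<phi> x)) \<partial>lborel))
      = (\<Sum>m. ennreal ((cmod (d m))\<^sup>2)) * (\<integral>\<^sup>+x. W x * ennreal (cmod (\<phi> x)) \<partial>lborel)"
    by simp
  also have "(\<integral>\<^sup>+x. W x * ennreal (cmod (\<phi> x)) \<partial>lborel) = (\<integral>\<^sup>+x. (\<Sum>m. W (x + zz m) * ennreal (cmod (\<phi> (x + zz m)))) * indicator UI x \<partial>lborel)"
    by (rule nn_integral_fold) measurable
  also have "\<dots> = (\<integral>\<^sup>+x. (W x * psum \<phi> x) * indicator UI x \<partial>lborel)"
    by (simp add: Wper psum_def)
  also have "\<dots> = (\<integral>\<^sup>+x. ennreal (enn2real (psum \<phi> x) powr P) * indicator UI x \<partial>lborel)"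
  proof (rule nn_integral_cong_AE, use fin in eventually_elim)
    case (elim x)
    define F where "F = enn2real (psum \<phi> x)"
    have F: "psum \<phi> x = ennreal F" "F \<ge> 0" using elim by (simp_all add: F_def)
    have "F powr (P - 1) * F = F powr P"
      using F(2) powr_add[of F "P - 1" 1] by (cases "F = 0") simp_all
    then have "W x * psum \<phi> x = ennreal (F powr P)"
      unfolding W_def F_def[symmetric] F(1) using F(2) by (simp flip: ennreal_mult)
    then show ?case by (simp add: F_def)
  qed
  finally have "(\<integral>\<^sup>+x. ennreal (cmod (\<Sum>m. d m * \<phi> (x + zz m)) powr P) \<partial>lborel)
      \<le> ennreal (S powr (P - 2)) * ((\<Sum>m. ennreal ((cmod (d m))\<^sup>2)) * (\<integral>\<^sup>+x. ennreal (enn2real (psum \<phi> x) powr P) * indicator UI x \<partial>lborel))" .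
  also have "\<dots> \<le> ennreal (S powr (P - 2)) * (ennreal (S\<^sup>2) * (\<integral>\<^sup>+x. ennreal (enn2real (psum \<phi> x) powr P) * indicator UI x \<partial>lborel))"
    by (intro mult_left_mono mult_right_mono d) simp_all
  also have "\<dots> = ennreal (S powr (P - 2) * S\<^sup>2) * (\<integral>\<^sup>+x. ennreal (enn2real (psum \<phi> x) powr P) * indicator UI x \<partial>lborel)"
    by (simp add: ennreal_mult mult.assoc)
  also have "S powr (P - 2) * S\<^sup>2 = S powr P"
  proof (cases "S = 0")
    case False
    then have "S powr 2 = S\<^sup>2" using S by simp
    then show ?thesis using powr_add[of S "P - 2" 2] by simp
  qed simp
  finally show ?thesis .
qed

section \<open>The transform after rescaling\<close>

lemma low_weight_le:
  assumes "0 < \<delta>" "\<delta> < 1" "r \<le> n"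
  shows "low_weight \<delta> n \<xi> \<le> \<bar>\<xi>\<bar> ^ r / \<delta> ^ r"
proof (cases "\<bar>\<xi>\<bar> < \<delta>")
  case True
  have "\<delta> ^ r \<le> 1" "0 < \<delta> ^ r" using assms by (auto intro: power_le_one)
  have "\<bar>\<xi>\<bar> ^ n \<le> \<bar>\<xi>\<bar> ^ r" using True assms by (intro power_decreasing) auto
  also have "\<dots> \<le> \<bar>\<xi>\<bar> ^ r / \<delta> ^ r"
    using \<open>\<delta> ^ r \<le> 1\<close> \<open>0 < \<delta> ^ r\<close> by (simp add: le_divide_eq mult_left_le)
  finally show ?thesis using True by (simp add: low_weight_def)
next
  case False
  then have "\<delta> ^ r \<le> \<bar>\<xi>\<bar> ^ r" using assms by (intro power_mono) auto
  then show ?thesis using False assms by (simp add: low_weight_def le_divide_eq)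
qed

text \<open>\<open>low_weight\<close> is dominated by the power r of \<xi> for r \<le> n, and
  integrability against F is supplied for r \<le> N; hence the minimum. In the squared integral with
  n \<le> N one factor is bounded and the other integrated, which costs one power of the scale; for
  n > N the bound with exponent N + 1 applies and nothing is lost. \<sigma> records the
  difference.\<close>

lemma scaled_estimates:
  fixes F :: "real \<Rightarrow> complex" and n :: nat
  assumes [measurable]: "F \<in> borel_measurable borel"
    and L: "\<And>\<xi>. cmod (F \<xi>) \<le> L" and D: "\<And>\<xi>. cmod (F \<xi>) * \<bar>\<xi>\<bar> ^ (N + 1) \<le> D"
    and int: "\<And>r. r \<le> N \<Longrightarrow> integrable lborel (\<lambda>\<xi>. cmod (F \<xi>) * \<bar>\<xi>\<bar> ^ r)"
    and \<delta>: "0 < \<delta>" "\<delta> < 1"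
  defines "r \<equiv> min n N" and "\<sigma> \<equiv> (if n \<le> N then 1 else 0 :: real)"
  obtains A where "A \<ge> 0" "\<And>\<mu>::real. \<bar>\<mu>\<bar> \<ge> 1 \<Longrightarrow>
      integrable lborel (\<lambda>\<xi>. of_real \<bar>\<mu>\<bar> * F (\<mu> * \<xi>)) \<and>
      (\<forall>\<xi>. cmod (of_real \<bar>\<mu>\<bar> * F (\<mu> * \<xi>)) * \<bar>\<xi>\<bar> ^ (N + 1) \<le> D * \<bar>\<mu>\<bar> powr (- real N)) \<and>
      (\<integral>\<^sup>+\<xi>. ennreal (cmod (of_real \<bar>\<mu>\<bar> * F (\<mu> * \<xi>)) * low_weight \<delta> n \<xi>) \<partial>lborel) \<le> ennreal (A * \<bar>\<mu>\<bar> powr (- real r)) \<and>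
      (\<integral>\<^sup>+\<xi>. ennreal ((cmod (of_real \<bar>\<mu>\<bar> * F (\<mu> * \<xi>)) * low_weight \<delta> n \<xi>)\<^sup>2) \<partial>lborel) \<le> ennreal (A * \<bar>\<mu>\<bar> powr (\<sigma> - 2 * real r))"
proof -
  have r: "r \<le> N" "r \<le> n" by (simp_all add: r_def)
  have L0: "L \<ge> 0" using order_trans[OF norm_ge_zero L[of 0]] .
  have D0: "D \<ge> 0" using D[of 0] by simp
  define J where "J = (LINT x|lborel. inverse (1 + x\<^sup>2) :: real)"
  have "J \<ge> 0" unfolding J_def by (intro integral_nonneg_AE AE_I2) simp
  define I where "I = (LINT \<xi>|lborel. cmod (F \<xi>) * \<bar>\<xi>\<bar> ^ r)"
  have "I \<ge> 0" unfolding I_def by (intro integral_nonneg_AE AE_I2) simp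
  have In: "(\<integral>\<^sup>+\<xi>. ennreal (cmod (F \<xi>) * \<bar>\<xi>\<bar> ^ r) \<partial>lborel) = ennreal I"
    unfolding I_def by (intro nn_integral_eq_integral int r AE_I2) simp
  define c where "c = 1 / \<delta> ^ r"
  have c0: "c \<ge> 0" using \<delta> by (simp add: c_def)
  have rho: "low_weight \<delta> n \<xi> \<le> c * \<bar>\<xi>\<bar> ^ r" for \<xi>
    using low_weight_le[OF \<delta> r(2), of \<xi>] by (simp add: c_def)
  \<comment> \<open>A1 belongs to the first-power integral, A2 and A3 to the squared one in the
    cases n \<le> N and n > N.\<close>
  define A1 where "A1 = c * I"
  define A2 where "A2 = c\<^sup>2 * (L + D) * I"
  define A3 where "A3 = (2 / \<delta> ^ (2 * N + 2)) * D\<^sup>2 * J"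
  have A0: "A1 \<ge> 0" "A2 \<ge> 0" "A3 \<ge> 0"
    using c0 \<open>I \<ge> 0\<close> \<open>J \<ge> 0\<close> L0 D0 \<delta> by (simp_all add: A1_def A2_def A3_def)
  define A where "A = A1 + A2 + A3"
  show thesis
  proof (rule that[of A], goal_cases)
    case 1
    show ?case using A0 by (simp add: A_def)
  next
    case (2 \<mu>)
    define a where "a = \<bar>\<mu>\<bar>"
    have a: "a \<ge> 1" "a > 0" "\<mu> \<noteq> 0" using 2 by (auto simp: a_def)
    define G where "G \<xi> = of_real a * F (\<mu> * \<xi>)" for \<xi>
    have [measurable]: "G \<in> borel_measurable borel" unfolding G_def[abs_def] by measurable
    have nG: "cmod (G \<xi>) = a * cmod (F (\<mu> * \<xi>))" for \<xi> using a by (simp add: G_def norm_mult)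
    have Gk: "cmod (G \<xi>) * \<bar>\<xi>\<bar> ^ k = (a / a ^ k) * (cmod (F (\<mu> * \<xi>)) * \<bar>\<mu> * \<xi>\<bar> ^ k)" for \<xi> k
      unfolding nG using a by (simp add: a_def abs_mult power_mult_distrib)
    have iF: "integrable lborel F"
    proof -
      have "integrable lborel (\<lambda>\<xi>. cmod (F \<xi>) * \<bar>\<xi>\<bar> ^ 0)" by (rule int) simp
      then have "integrable lborel (\<lambda>\<xi>. cmod (F \<xi>))" by simp
      then show ?thesis by (rule integrable_norm_cancel) simp
    qed
    have iG: "integrable lborel G"
      unfolding G_def using lborel_integrable_real_affine[OF iF \<open>\<mu> \<noteq> 0\<close>, of 0] by simp
    have pw: "a / a ^ (k + 1) = a powr (- real k)" for k
      using a by (simp add: powr_minus powr_realpow inverse_eq_divide)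
    have GD: "cmod (G \<xi>) * \<bar>\<xi>\<bar> ^ (N + 1) \<le> D * a powr (- real N)" for \<xi>
    proof -
      have "cmod (G \<xi>) * \<bar>\<xi>\<bar> ^ (N + 1) = a powr (- real N) * (cmod (F (\<mu> * \<xi>)) * \<bar>\<mu> * \<xi>\<bar> ^ (N + 1))"
        unfolding Gk pw ..
      also have "\<dots> \<le> a powr (- real N) * D" by (intro mult_left_mono D) simp
      finally show ?thesis by (simp only: mult.commute)
    qed
    have I1: "(\<integral>\<^sup>+\<xi>. ennreal (cmod (F (\<mu> * \<xi>)) * \<bar>\<mu> * \<xi>\<bar> ^ r) \<partial>lborel) = ennreal (I / a)"
    proof -
      have "ennreal I = ennreal a * (\<integral>\<^sup>+\<xi>. ennreal (cmod (F (0 + \<mu> * \<xi>)) * \<bar>0 + \<mu> * \<xi>\<bar> ^ r) \<partial>lborel)"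
        unfolding In[symmetric] a_def by (rule nn_integral_real_affine) (use a in simp_all)
      then have "ennreal (1 / a) * ennreal I = (ennreal (1 / a) * ennreal a) * (\<integral>\<^sup>+\<xi>. ennreal (cmod (F (\<mu> * \<xi>)) * \<bar>\<mu> * \<xi>\<bar> ^ r) \<partial>lborel)"
        by (simp add: mult.assoc)
      moreover have "ennreal (1 / a) * ennreal a = 1" using a by (simp flip: ennreal_mult)
      moreover have "ennreal (1 / a) * ennreal I = ennreal (I / a)" using a \<open>I \<ge> 0\<close> by (simp flip: ennreal_mult)
      ultimately show ?thesis by simp
    qed
    have B1: "(\<integral>\<^sup>+\<xi>. ennreal (cmod (G \<xi>) * low_weight \<delta> n \<xi>) \<partial>lborel) \<le> ennreal (A * a powr (- real r))"
    proof -
      have "(\<integral>\<^sup>+\<xi>. ennreal (cmod (G \<xi>) * low_weight \<delta> n \<xi>) \<partial>lborel)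
          \<le> (\<integral>\<^sup>+\<xi>. ennreal (c * (a / a ^ r)) * ennreal (cmod (F (\<mu> * \<xi>)) * \<bar>\<mu> * \<xi>\<bar> ^ r) \<partial>lborel)"
      proof (rule nn_integral_mono)
        fix \<xi>
        have "cmod (G \<xi>) * low_weight \<delta> n \<xi> \<le> cmod (G \<xi>) * (c * \<bar>\<xi>\<bar> ^ r)" by (intro mult_left_mono rho) simp
        also have "\<dots> = c * (cmod (G \<xi>) * \<bar>\<xi>\<bar> ^ r)" by (simp only: mult_ac)
        also have "\<dots> = (c * (a / a ^ r)) * (cmod (F (\<mu> * \<xi>)) * \<bar>\<mu> * \<xi>\<bar> ^ r)" unfolding Gk by (simp only: mult.assoc)
        finally have "ennreal (cmod (G \<xi>) * low_weight \<delta> n \<xi>) \<le> ennreal ((c * (a / a ^ r)) * (cmod (F (\<mu> * \<xi>)) * \<bar>\<mu> * \<xi>\<bar> ^ r))"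
          by (rule ennreal_leI)
        then show "ennreal (cmod (G \<xi>) * low_weight \<delta> n \<xi>) \<le> ennreal (c * (a / a ^ r)) * ennreal (cmod (F (\<mu> * \<xi>)) * \<bar>\<mu> * \<xi>\<bar> ^ r)"
          using c0 a by (subst ennreal_mult[symmetric]) auto
      qed
      also have "\<dots> = ennreal (c * (a / a ^ r)) * ennreal (I / a)"
        by (subst nn_integral_cmult) (simp_all add: I1)
      also have "\<dots> = ennreal ((c * (a / a ^ r)) * (I / a))"
        using c0 a \<open>I \<ge> 0\<close> by (intro ennreal_mult[symmetric]) auto
      also have "(c * (a / a ^ r)) * (I / a) = A1 * a powr (- real r)"
        using a by (simp add: A1_def powr_minus powr_realpow inverse_eq_divide)
      also have "ennreal (A1 * a powr (- real r)) \<le> ennreal (A * a powr (- real r))"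
        using A0 by (intro ennreal_leI mult_right_mono) (auto simp: A_def)
      finally show ?thesis .
    qed
    have B2: "(\<integral>\<^sup>+\<xi>. ennreal ((cmod (G \<xi>) * low_weight \<delta> n \<xi>)\<^sup>2) \<partial>lborel) \<le> ennreal (A * a powr (\<sigma> - 2 * real r))"
    proof (cases "n \<le> N")
      case True
      then have rn: "r = n" "\<sigma> = 1" by (simp_all add: r_def \<sigma>_def)
      have Fb: "cmod (F \<eta>) * \<bar>\<eta>\<bar> ^ r \<le> L + D" for \<eta>
      proof (cases "\<bar>\<eta>\<bar> \<le> 1")
        case True
        then have "cmod (F \<eta>) * \<bar>\<eta>\<bar> ^ r \<le> L * 1" using L0 by (intro mult_mono L power_le_one) auto
        then show ?thesis using D0 by simp
      next
        case False
        then have "cmod (F \<eta>) * \<bar>\<eta>\<bar> ^ r \<le> cmod (F \<eta>) * \<bar>\<eta>\<bar> ^ (N + 1)"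
          using r by (intro mult_left_mono power_increasing) auto
        then show ?thesis using D[of \<eta>] L0 by linarith
      qed
      have sqr: "((x * y) * t)\<^sup>2 = (x\<^sup>2 * y\<^sup>2) * (t * t)" for x y t :: real
        by (simp add: power2_eq_square mult_ac)
      define k where "k = c\<^sup>2 * (a / a ^ r)\<^sup>2 * (L + D)"
      have k0: "k \<ge> 0" using L0 D0 by (simp add: k_def)
      have "(\<integral>\<^sup>+\<xi>. ennreal ((cmod (G \<xi>) * low_weight \<delta> n \<xi>)\<^sup>2) \<partial>lborel)
          \<le> (\<integral>\<^sup>+\<xi>. ennreal k * ennreal (cmod (F (\<mu> * \<xi>)) * \<bar>\<mu> * \<xi>\<bar> ^ r) \<partial>lborel)"
      proof (rule nn_integral_mono)
        fix \<xi>
        let ?t = "cmod (F (\<mu> * \<xi>)) * \<bar>\<mu> * \<xi>\<bar> ^ r"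
        have "cmod (G \<xi>) * low_weight \<delta> n \<xi> \<le> cmod (G \<xi>) * (c * \<bar>\<xi>\<bar> ^ r)" by (intro mult_left_mono rho) simp
        also have "\<dots> = c * (cmod (G \<xi>) * \<bar>\<xi>\<bar> ^ r)" by (simp only: mult_ac)
        also have "\<dots> = (c * (a / a ^ r)) * ?t" unfolding Gk by (simp only: mult.assoc)
        finally have "(cmod (G \<xi>) * low_weight \<delta> n \<xi>)\<^sup>2 \<le> ((c * (a / a ^ r)) * ?t)\<^sup>2" by (rule power_mono) simp
        also have "\<dots> = (c\<^sup>2 * (a / a ^ r)\<^sup>2) * (?t * ?t)" by (rule sqr)
        also have "\<dots> \<le> (c\<^sup>2 * (a / a ^ r)\<^sup>2) * ((L + D) * ?t)" by (intro mult_left_mono mult_right_mono Fb) auto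
        also have "\<dots> = k * ?t" by (simp only: k_def mult.assoc)
        finally have "ennreal ((cmod (G \<xi>) * low_weight \<delta> n \<xi>)\<^sup>2) \<le> ennreal (k * ?t)" by (rule ennreal_leI)
        then show "ennreal ((cmod (G \<xi>) * low_weight \<delta> n \<xi>)\<^sup>2) \<le> ennreal k * ennreal ?t"
          using k0 by (subst ennreal_mult[symmetric]) auto
      qed
      also have "\<dots> = ennreal k * ennreal (I / a)" by (subst nn_integral_cmult) (simp_all add: I1)
      also have "\<dots> = ennreal (k * (I / a))" using k0 a \<open>I \<ge> 0\<close> by (intro ennreal_mult[symmetric]) auto
      also have "k * (I / a) = A2 * a powr (\<sigma> - 2 * real r)"
      proof -
        have "a powr (\<sigma> - 2 * real r) = a / (a ^ r)\<^sup>2"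
          using a by (simp add: rn powr_diff powr_realpow[symmetric] powr_powr mult.commute flip: powr_numeral)
        then show ?thesis using a by (simp add: k_def A2_def power2_eq_square)
      qed
      also have "ennreal (A2 * a powr (\<sigma> - 2 * real r)) \<le> ennreal (A * a powr (\<sigma> - 2 * real r))"
        using A0 by (intro ennreal_leI mult_right_mono) (auto simp: A_def)
      finally show ?thesis .
    next
      case False
      then have rn: "r = N" "\<sigma> = 0" "N + 1 \<le> n" by (simp_all add: r_def \<sigma>_def)
      define D' where "D' = D * a powr (- real N)"
      define k where "k = (2 / \<delta> ^ (2 * N + 2)) * D'\<^sup>2"
      have k0: "k \<ge> 0" using \<delta> by (simp add: k_def)
      have "(\<integral>\<^sup>+\<xi>. ennreal ((cmod (G \<xi>) * low_weight \<delta> n \<xi>)\<^sup>2) \<partial>lborel) \<le> (\<integral>\<^sup>+\<xi>. ennreal (k * inverse (1 + \<xi>\<^sup>2)) \<partial>lborel)"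
      proof (intro nn_integral_mono ennreal_leI)
        fix \<xi> :: real
        have pos: "0 < 1 + \<xi>\<^sup>2" by (simp add: add_pos_nonneg)
        have dp: "0 < \<delta> ^ (2 * N + 2)" "\<delta> ^ (2 * N + 2) \<le> 1" using \<delta> by (auto intro: power_le_one simp del: power_Suc)
        \<comment> \<open>Below \<delta>, n > N makes the weight at most
          \<open>|\<xi>| ^ (N + 1)\<close>. Above \<delta>, N of the powers in the bound for G are
          replaced by \<delta> and the last one is kept, to be used with \<open>\<delta>\<^sup>2 *
          (1 + \<xi>\<^sup>2) \<le> 2 * \<xi>\<^sup>2\<close>.\<close>
        have "(cmod (G \<xi>) * low_weight \<delta> n \<xi>)\<^sup>2 * (1 + \<xi>\<^sup>2) \<le> k"
        proof (cases "\<bar>\<xi>\<bar> < \<delta>")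
          case True
          then have "\<xi>\<^sup>2 \<le> 1" using \<delta> by (simp add: abs_square_le_1)
          have "\<bar>\<xi>\<bar> ^ n \<le> \<bar>\<xi>\<bar> ^ (N + 1)" using True \<delta> rn(3) by (intro power_decreasing) auto
          then have "cmod (G \<xi>) * low_weight \<delta> n \<xi> \<le> cmod (G \<xi>) * \<bar>\<xi>\<bar> ^ (N + 1)"
            unfolding low_weight_def using True by (auto intro!: mult_left_mono simp del: power_Suc)
          also have "\<dots> \<le> D'" unfolding D'_def by (rule GD)
          finally have "(cmod (G \<xi>) * low_weight \<delta> n \<xi>)\<^sup>2 \<le> D'\<^sup>2" by (rule power_mono) simp
          then have "(cmod (G \<xi>) * low_weight \<delta> n \<xi>)\<^sup>2 * (1 + \<xi>\<^sup>2) \<le> D'\<^sup>2 * 2"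
            using \<open>\<xi>\<^sup>2 \<le> 1\<close> by (intro mult_mono) auto
          also have "\<dots> \<le> D'\<^sup>2 * (2 / \<delta> ^ (2 * N + 2))" using dp by (intro mult_left_mono) (auto simp: le_divide_eq simp del: power_Suc)
          finally show ?thesis by (simp only: k_def mult.commute)
        next
          case False
          then have x: "\<delta> \<le> \<bar>\<xi>\<bar>" by simp
          have g1: "cmod (G \<xi>) * \<delta> ^ N * \<bar>\<xi>\<bar> \<le> D'"
          proof -
            have "\<delta> ^ N * \<bar>\<xi>\<bar> \<le> \<bar>\<xi>\<bar> ^ N * \<bar>\<xi>\<bar>" using x \<delta> by (intro mult_right_mono power_mono) auto
            then have "cmod (G \<xi>) * (\<delta> ^ N * \<bar>\<xi>\<bar>) \<le> cmod (G \<xi>) * (\<bar>\<xi>\<bar> ^ N * \<bar>\<xi>\<bar>)" by (intro mult_left_mono) auto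
            then show ?thesis using GD[of \<xi>] by (simp add: D'_def mult_ac)
          qed
          have d2: "\<delta>\<^sup>2 \<le> \<bar>\<xi>\<bar>\<^sup>2" using x \<delta> by (intro power_mono) auto
          have "\<delta>\<^sup>2 \<le> 1" using \<delta> by (simp add: power_le_one)
          then have "\<delta>\<^sup>2 * \<xi>\<^sup>2 \<le> 1 * \<xi>\<^sup>2" by (intro mult_right_mono) auto
          with d2 have m1: "\<delta>\<^sup>2 * (1 + \<xi>\<^sup>2) \<le> 2 * \<xi>\<^sup>2" by (simp add: distrib_left)
          have "(cmod (G \<xi>) * \<delta> ^ N * \<bar>\<xi>\<bar>)\<^sup>2 \<le> D'\<^sup>2" using \<delta> by (intro power_mono g1) auto
          then have g2: "(cmod (G \<xi>))\<^sup>2 * (\<delta> ^ N)\<^sup>2 * \<xi>\<^sup>2 \<le> D'\<^sup>2" by (simp add: power_mult_distrib)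
          have "(cmod (G \<xi>))\<^sup>2 * (\<delta> ^ N)\<^sup>2 * (\<delta>\<^sup>2 * (1 + \<xi>\<^sup>2)) \<le> (cmod (G \<xi>))\<^sup>2 * (\<delta> ^ N)\<^sup>2 * (2 * \<xi>\<^sup>2)"
            by (intro mult_left_mono m1) simp
          also have "\<dots> \<le> 2 * D'\<^sup>2" using g2 by simp
          finally have "(cmod (G \<xi>))\<^sup>2 * (1 + \<xi>\<^sup>2) * \<delta> ^ (2 * N + 2) \<le> 2 * D'\<^sup>2"
            by (simp add: power_add power_mult power2_eq_square mult_ac)
          then have "(cmod (G \<xi>))\<^sup>2 * (1 + \<xi>\<^sup>2) \<le> 2 * D'\<^sup>2 / \<delta> ^ (2 * N + 2)" using dp(1) by (simp only: pos_le_divide_eq)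
          then show ?thesis using False by (simp add: low_weight_def k_def)
        qed
        then show "(cmod (G \<xi>) * low_weight \<delta> n \<xi>)\<^sup>2 \<le> k * inverse (1 + \<xi>\<^sup>2)"
          using pos by (simp add: inverse_eq_divide pos_le_divide_eq)
      qed
      also have "\<dots> = ennreal (LINT \<xi>|lborel. k * inverse (1 + \<xi>\<^sup>2))"
        using k0 by (intro nn_integral_eq_integral integrable_mult_right integrable_inverse_1_plus_square' AE_I2) simp
      also have "(LINT \<xi>|lborel. k * inverse (1 + \<xi>\<^sup>2)) = k * J" by (simp add: J_def)
      also have "k * J = A3 * a powr (\<sigma> - 2 * real r)"
      proof -
        have "a powr (\<sigma> - 2 * real r) = (a powr (- real N))\<^sup>2"
          unfolding rn by (simp add: power2_eq_square flip: powr_add)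
        then show ?thesis by (simp add: k_def A3_def D'_def power_mult_distrib)
      qed
      also have "ennreal (A3 * a powr (\<sigma> - 2 * real r)) \<le> ennreal (A * a powr (\<sigma> - 2 * real r))"
        using A0 by (intro ennreal_leI mult_right_mono) (auto simp: A_def)
      finally show ?thesis .
    qed
    show ?case
      using iG GD B1 B2 unfolding G_def a_def by blast
  qed
qed

text \<open>By inversion the average acts on each exponential as the multiplier
  \<open>av_mult\<close> at \<open>\<xi> / \<mu>\<close>; substituting \<open>\<mu> * \<xi>\<close>
  for \<xi> brings everything to scale one.\<close>

lemma average_eq_FT:
  fixes M :: int and j :: nat
  assumes f0: "integrable lborel f0" and ff: "AE x in lborel. f x = f0 x"
    and Ff: "integrable lborel (FT f0)" and h: "h > 0" and M: "M \<noteq> 0"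
  defines "\<mu> \<equiv> real_of_int M ^ j"
  shows "average M j h f (- (of_int k / of_int M ^ j)) =
    (LINT \<xi>|lborel. (of_real \<bar>\<mu>\<bar> * FT f0 (\<mu> * \<xi>)) * av_mult h \<xi> * ee (- (of_int k * \<xi>)))"
proof -
  have [measurable]: "f0 \<in> borel_measurable borel" using f0 by auto
  have \<mu>: "\<mu> \<noteq> 0" using M by (simp add: \<mu>_def)
  define a where "a = \<bar>\<mu>\<bar>"
  have a: "a > 0" using \<mu> by (simp add: a_def)
  have aM: "real_of_int \<bar>M\<bar> ^ j = a" by (simp add: a_def \<mu>_def power_abs)
  define y where "y = - (of_int k / \<mu>)"
  define F where "F x = (LINT \<xi>|lborel. FT f0 \<xi> * ee (x * \<xi>))" for x
  have [measurable]: "F \<in> borel_measurable borel" unfolding F_def[abs_def] by measurable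
  have fF: "AE x in lborel. f x = F x"
    using ff FT_inversion[OF f0 Ff] by eventually_elim (simp add: F_def)
  let ?I = "{- (h / a)..h / a}"
  have "(LINT t:?I|lebesgue. f (y + t)) = (LINT t|lborel. of_real (indicator ?I t) * F (y + t))"
    unfolding set_lebesgue_integral_def
  proof (rule lebesgue_integral_representative(2))
    have "AE t in lborel. f (y + 1 * t) = F (y + 1 * t)" by (rule AE_lborel_affine[OF fF]) simp
    then show ae: "AE t in lborel. indicator ?I t *\<^sub>R f (y + t) = of_real (indicator ?I t) * F (y + t)"
      by eventually_elim (simp add: scaleR_conv_of_real)
    show m: "(\<lambda>t. of_real (indicator ?I t) * F (y + t)) \<in> borel_measurable borel" by measurable
    show "(\<lambda>t. indicator ?I t *\<^sub>R f (y + t)) \<in> borel_measurable lebesgue"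
      by (rule measurable_lebesgue_AE_eq[OF ae m])
  qed
  also have "\<dots> = (LINT t|lborel. of_real (indicator ?I t) * (LINT \<xi>|lborel. FT f0 \<xi> * ee ((y + t) * \<xi>)))"
    by (simp add: F_def)
  also have "\<dots> = (LINT \<xi>|lborel. FT f0 \<xi> * (LINT t|lborel. of_real (indicator ?I t) * ee ((y + t) * \<xi>)))"
  proof (rule Fubini_ee[OF _ Ff])
    show "integrable lborel (\<lambda>t. complex_of_real (indicator ?I t))"
      by (intro integrable_of_real integrable_real_indicator) (auto simp: emeasure_lborel_Icc_eq)
  qed measurable
  also have "\<dots> = (LINT \<xi>|lborel. of_real (2 * h / a) * (FT f0 \<xi> * av_mult h (\<xi> / \<mu>) * ee (y * \<xi>)))"
  proof (intro Bochner_Integration.integral_cong refl)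
    fix \<xi>
    \<comment> \<open>The interval is symmetric, so the substitution of \<open>- s / \<mu>\<close>
      for t turns it into \<open>{-h..h}\<close> for either sign of \<mu>.\<close>
    have ind: "indicator ?I (0 + (- 1 / \<mu>) * s) = (indicator {-h..h} s :: real)" for s
    proof -
      have mem: "x \<in> {-b..b} \<longleftrightarrow> \<bar>x\<bar> \<le> b" for x b :: real by auto
      have "(0 + (- 1 / \<mu>) * s \<in> ?I) \<longleftrightarrow> \<bar>(- 1 / \<mu>) * s\<bar> \<le> h / a" by (simp only: mem add_0_left)
      also have "\<dots> \<longleftrightarrow> \<bar>s\<bar> \<le> h" using a by (simp add: abs_mult a_def divide_le_cancel)
      also have "\<dots> \<longleftrightarrow> s \<in> {-h..h}" by (simp only: mem)
      finally show ?thesis by (simp only: indicator_def)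
    qed
    have "(LINT t|lborel. of_real (indicator ?I t) * ee ((y + t) * \<xi>))
        = \<bar>- 1 / \<mu>\<bar> *\<^sub>R (LINT s|lborel. of_real (indicator ?I (0 + (- 1 / \<mu>) * s)) * ee ((y + (0 + (- 1 / \<mu>) * s)) * \<xi>))"
      using \<mu> by (intro lborel_integral_real_affine) simp
    also have "(\<lambda>s. complex_of_real (indicator ?I (0 + (- 1 / \<mu>) * s)) * ee ((y + (0 + (- 1 / \<mu>) * s)) * \<xi>))
        = (\<lambda>s. ee (y * \<xi>) * (indicator {-h..h} s *\<^sub>R ee (- (s * (\<xi> / \<mu>)))))"
    proof
      fix s
      have "ee ((y + (0 + (- 1 / \<mu>) * s)) * \<xi>) = ee (y * \<xi>) * ee (- (s * (\<xi> / \<mu>)))"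
        using \<mu> by (simp add: ee_add[symmetric] field_simps)
      then show "complex_of_real (indicator ?I (0 + (- 1 / \<mu>) * s)) * ee ((y + (0 + (- 1 / \<mu>) * s)) * \<xi>)
          = ee (y * \<xi>) * (indicator {-h..h} s *\<^sub>R ee (- (s * (\<xi> / \<mu>))))"
        unfolding ind by (simp only: scaleR_conv_of_real mult_ac)
    qed
    also have "\<bar>- 1 / \<mu>\<bar> *\<^sub>R (LINT s|lborel. ee (y * \<xi>) * (indicator {-h..h} s *\<^sub>R ee (- (s * (\<xi> / \<mu>)))))
        = of_real (2 * h / a) * (av_mult h (\<xi> / \<mu>) * ee (y * \<xi>))"
      using h a unfolding integral_mult_right_zero av_mult_def by (simp add: scaleR_conv_of_real a_def)
    finally show "FT f0 \<xi> * (LINT t|lborel. of_real (indicator ?I t) * ee ((y + t) * \<xi>))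
        = of_real (2 * h / a) * (FT f0 \<xi> * av_mult h (\<xi> / \<mu>) * ee (y * \<xi>))"
      by (simp only: mult_ac)
  qed
  also have "\<dots> = of_real (2 * h / a) * (LINT \<xi>|lborel. FT f0 \<xi> * av_mult h (\<xi> / \<mu>) * ee (y * \<xi>))"
    by (rule integral_mult_right_zero)
  finally have "average M j h f y = of_real (a / (2 * h)) * (of_real (2 * h / a) * (LINT \<xi>|lborel. FT f0 \<xi> * av_mult h (\<xi> / \<mu>) * ee (y * \<xi>)))"
    unfolding average_def aM by simp
  also have "\<dots> = (LINT \<xi>|lborel. FT f0 \<xi> * av_mult h (\<xi> / \<mu>) * ee (y * \<xi>))" using a h by simp
  also have "\<dots> = a *\<^sub>R (LINT \<xi>|lborel. FT f0 (0 + \<mu> * \<xi>) * av_mult h ((0 + \<mu> * \<xi>) / \<mu>) * ee (y * (0 + \<mu> * \<xi>)))"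
    unfolding a_def by (rule lborel_integral_real_affine[OF \<mu>])
  also have "\<dots> = (LINT \<xi>|lborel. (of_real \<bar>\<mu>\<bar> * FT f0 (\<mu> * \<xi>)) * av_mult h \<xi> * ee (- (of_int k * \<xi>)))"
    unfolding scaleR_conv_of_real integral_mult_right_zero[symmetric] a_def y_def using \<mu>
    by (intro Bochner_Integration.integral_cong refl) (simp add: mult_ac)
  finally show ?thesis by (simp add: y_def \<mu>_def)
qed

section \<open>Transfer to the norms and spaces of the statement\<close>

lemma psum_eq_infsum: "(\<Sum>\<^sub>\<infinity>k::int. ennreal (cmod (\<phi> (x + of_int k)))) = psum \<phi> x"
  unfolding infsum_ennreal_int_decode psum_def zz_def ..

lemma psum_AE_cong:
  assumes "AE x in lborel. \<phi> x = \<phi>' x"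
  shows "AE x in lborel. \<forall>m. \<phi> (x + zz m) = \<phi>' (x + zz m)"
  unfolding AE_all_countable
proof
  fix m
  have "AE x in lborel. \<phi> (zz m + 1 * x) = \<phi>' (zz m + 1 * x)" by (rule AE_lborel_affine[OF assms]) simp
  then show "AE x in lborel. \<phi> (x + zz m) = \<phi>' (x + zz m)" by (simp add: add.commute)
qed

lemma periodized_finite:
  assumes \<phi>: "\<phi> \<in> periodized_lp_space p" and ae: "AE x in lborel. \<phi> x = \<phi>' x" and p: "p \<noteq> \<infinity>"
  shows "(\<integral>\<^sup>+x. ennreal (enn2real (psum \<phi>' x) powr enn2real p) * indicator UI x \<partial>lborel) < \<infinity>"
proof -
  let ?J = "\<integral>\<^sup>+x. enn_powr (psum \<phi> x) (enn2real p) \<partial>restrict_space lebesgue {-1/2..1/2}"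
  have "enn_powr ?J (1 / enn2real p) < \<infinity>"
    using \<phi> p by (simp add: periodized_lp_space_def lp_norm_def psum_eq_infsum)
  then have "?J < \<infinity>" by (cases "?J = \<infinity>") (auto simp: enn_powr_def less_top)
  also have "?J = (\<integral>\<^sup>+x. enn_powr (psum \<phi> x) (enn2real p) * indicator {-1/2..1/2} x \<partial>lborel)"
    by (subst nn_integral_restrict_space) (simp_all add: nn_integral_completion)
  finally have fin: "(\<integral>\<^sup>+x. enn_powr (psum \<phi> x) (enn2real p) * indicator {-1/2..1/2} x \<partial>lborel) < \<infinity>" .
  have "(\<integral>\<^sup>+x. ennreal (enn2real (psum \<phi>' x) powr enn2real p) * indicator UI x \<partial>lborel)
      \<le> (\<integral>\<^sup>+x. enn_powr (psum \<phi> x) (enn2real p) * indicator {-1/2..1/2} x \<partial>lborel)"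
  proof (rule nn_integral_mono_AE, use psum_AE_cong[OF ae] in eventually_elim)
    case (elim x)
    then have "psum \<phi>' x = psum \<phi> x" by (simp add: psum_def)
    \<comment> \<open>Where the periodization is infinite, \<open>enn2real\<close> gives 0, so the
      inequality holds there too.\<close>
    then show ?case
      by (cases "x \<in> UI") (auto simp: enn_powr_def UI_def indicator_def)
  qed
  then show ?thesis using fin by (rule order.strict_trans1)
qed

lemma periodized_bounded:
  assumes \<phi>: "\<phi> \<in> periodized_lp_space \<infinity>" and ae: "AE x in lborel. \<phi> x = \<phi>' x"
    and [measurable]: "\<phi>' \<in> borel_measurable borel"
  obtains b where "b \<ge> 0" "AE x in lborel. psum \<phi>' x \<le> ennreal b"
proof -
  let ?M = "restrict_space lebesgue {-1/2..1/2::real}"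
  define s where "s = esssup ?M (psum \<phi>)"
  have s: "s < \<infinity>"
    using \<phi> by (simp add: periodized_lp_space_def lp_norm_def psum_eq_infsum s_def)
  have "AE x in ?M. psum \<phi> x \<le> s" unfolding s_def by (rule esssup_AE)
  then have "AE x in lebesgue. x \<in> {-1/2..1/2} \<longrightarrow> psum \<phi> x \<le> s"
    by (subst (asm) AE_restrict_space_iff) auto
  then have "AE x in lborel. x \<in> {-1/2..1/2} \<longrightarrow> psum \<phi> x \<le> s" by (simp only: AE_completion_iff)
  with psum_AE_cong[OF ae] have "AE x in lborel. x \<in> UI \<longrightarrow> psum \<phi>' x \<le> s"
    by eventually_elim (auto simp: psum_def UI_def)
  then have "AE x in lborel. psum \<phi>' x \<le> s"
  proof (rule AE_periodic[rotated 2])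
    show "Measurable.pred borel (\<lambda>x. psum \<phi>' x \<le> s)" by measurable
    show "psum \<phi>' (x + of_int k) \<le> s" if "psum \<phi>' x \<le> s" for x and k :: int
      using that by (simp only: psum_periodic)
  qed
  moreover have "s = ennreal (enn2real s)" using s by simp
  ultimately show thesis using that[of "enn2real s"] by simp
qed

lemma lp_norm_le_finite:
  fixes err g :: "real \<Rightarrow> complex"
  assumes p: "p \<noteq> \<infinity>" and ae: "AE x in lborel. err x = g x" and "Y \<ge> 0"
    and I: "(\<integral>\<^sup>+x. ennreal (cmod (g x) powr enn2real p) \<partial>lborel) \<le> ennreal Y"
  shows "lp_norm lebesgue p (\<lambda>x. ennreal (cmod (err x))) \<le> ennreal (Y powr (1 / enn2real p))"
proof -
  have "(\<integral>\<^sup>+x. enn_powr (ennreal (cmod (err x))) (enn2real p) \<partial>lebesgue) = (\<integral>\<^sup>+x. ennreal (cmod (g x) powr enn2real p) \<partial>lborel)"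
    unfolding nn_integral_completion
    by (rule nn_integral_cong_AE, use ae in eventually_elim) (simp add: enn_powr_def)
  with I have le: "(\<integral>\<^sup>+x. enn_powr (ennreal (cmod (err x))) (enn2real p) \<partial>lebesgue) \<le> ennreal Y" by simp
  then have fin: "(\<integral>\<^sup>+x. enn_powr (ennreal (cmod (err x))) (enn2real p) \<partial>lebesgue) \<noteq> \<infinity>"
    by (metis ennreal_less_top infinity_ennreal_def leD)
  have "enn2real (\<integral>\<^sup>+x. enn_powr (ennreal (cmod (err x))) (enn2real p) \<partial>lebesgue) \<le> Y"
    using le \<open>Y \<ge> 0\<close> by (simp add: enn2real_leI)
  then show ?thesis
    using p fin by (auto simp: lp_norm_def enn_powr_def intro!: ennreal_leI powr_mono2)
qed

lemma lp_norm_le_infinite: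
  fixes err g :: "real \<Rightarrow> complex"
  assumes ae: "AE x in lborel. err x = g x" and g: "g \<in> borel_measurable borel"
    and I: "AE x in lborel. cmod (g x) \<le> Y"
  shows "lp_norm lebesgue \<infinity> (\<lambda>x. ennreal (cmod (err x))) \<le> ennreal Y"
proof -
  \<comment> \<open>\<open>esssup_I\<close> asks for measurability; err will contain an unordered
    infinite sum, so it is inherited from the Borel function g.\<close>
  have [measurable]: "err \<in> borel_measurable lebesgue" by (rule measurable_lebesgue_AE_eq[OF ae g])
  have "AE x in lborel. ennreal (cmod (err x)) \<le> ennreal Y"
    using ae I by eventually_elim (simp add: ennreal_leI)
  then have "esssup lebesgue (\<lambda>x. ennreal (cmod (err x))) \<le> ennreal Y"
    by (intro esssup_I AE_completion) measurable
  then show ?thesis by (simp add: lp_norm_def)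
qed

lemma fourier_eq_FT:
  assumes i: "integrable lebesgue \<phi>" and \<phi>': "\<phi>' \<in> borel_measurable borel" "AE x in lborel. \<phi> x = \<phi>' x"
  shows "fourier \<phi> = FT \<phi>'"
proof
  fix \<xi>
  note [measurable] = \<phi>'(1)
  have e: "exp (- (2 * pi * \<i> * x * \<xi>)) = ee (- (x * \<xi>))" for x :: real
    by (simp add: ee_eq_exp mult_ac)
  show "fourier \<phi> \<xi> = FT \<phi>' \<xi>"
    unfolding fourier_def FT_def e
  proof (rule lebesgue_integral_representative(2))
    show ae: "AE x in lborel. \<phi> x * ee (- (x * \<xi>)) = \<phi>' x * ee (- (x * \<xi>))"
      using \<phi>'(2) by eventually_elim simp
    show m: "(\<lambda>x. \<phi>' x * ee (- (x * \<xi>))) \<in> borel_measurable borel" by measurable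
    show "(\<lambda>x. \<phi> x * ee (- (x * \<xi>))) \<in> borel_measurable lebesgue" by (rule measurable_lebesgue_AE_eq[OF ae m])
  qed
qed

theorem theorem16:
  fixes p q :: ennreal and h \<epsilon> \<delta> B :: real and N n :: nat and M :: int
    and \<phi> f :: "real \<Rightarrow> complex"
  assumes "2 \<le> p" and "1 / p + 1 / q = 1" and "h > 0" and "\<bar>M\<bar> \<ge> 2"
    and "\<phi> \<in> periodized_lp_space p"
    and "B > 0"
    and "\<And>\<xi>. (\<Sum>\<^sub>\<infinity>k::int. ennreal (cmod (fourier \<phi> (\<xi> + of_int k)) powr enn2real q)) < ennreal B"
    and "n \<ge> 1" and "0 < \<delta>" and "\<delta> < 1 / 2"
    and "boundedly_differentiable n (\<lambda>\<xi>. fourier \<phi> \<xi> * fourier_distr (phi_tilde h N) \<xi>)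
           {\<xi>. \<bar>\<xi>\<bar> < \<delta>}"
    and "\<And>l::int. l \<noteq> 0 \<Longrightarrow>
           boundedly_differentiable n (fourier \<phi>) {\<xi>. \<bar>\<xi> + of_int l\<bar> < \<delta>}"
    and "\<exists>K::real. \<forall>\<xi>. \<bar>\<xi>\<bar> < \<delta> \<longrightarrow>
           (\<Sum>\<^sub>\<infinity>l\<in>UNIV - {0::int}. ennreal (cmod (nderiv n (fourier \<phi>) (\<xi> + of_int l)))) \<le> ennreal K"
    and "\<And>\<beta>. \<beta> < n \<Longrightarrow>
           nderiv \<beta> (\<lambda>\<xi>. 1 - fourier \<phi> \<xi> * fourier_distr (phi_tilde h N) \<xi>) 0 = 0"
    and "strang_fix n \<phi>"
    and "f \<in> sobolev_1 (N + 1)"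
    and "\<epsilon> > 0" and "\<exists>g. weak_deriv (N + 1) f g \<and> g \<in> lip \<epsilon>"
  shows "\<exists>C\<ge>0. \<forall>j.
    (AE x in lebesgue. (\<lambda>k. expansion_term M h \<phi> f j k x) summable_on UNIV) \<and>
    lp_norm lebesgue p
      (\<lambda>x. ennreal (cmod (f x - of_real (real_of_int \<bar>M\<bar> powr (- (real j / 2))) *
                                 (\<Sum>\<^sub>\<infinity>k. expansion_term M h \<phi> f j k x))))
    \<le> ennreal (if real n > real N + enn2real (1 / p)
               then C * real_of_int \<bar>M\<bar> powr (- (real j * (real N + enn2real (1 / p))))
               else C * real_of_int \<bar>M\<bar> powr (- (real j * real n)))"
proof -
  have \<phi>m: "integrable lebesgue \<phi>" using assms(15) by (simp add: strang_fix_def)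
  obtain \<phi>0 where \<phi>0 [measurable]: "\<phi>0 \<in> borel_measurable borel" and \<phi>\<phi>: "AE x in lborel. \<phi> x = \<phi>0 x"
    using borel_representative[OF borel_measurable_integrable[OF \<phi>m]] by blast
  have i\<phi>: "integrable lborel \<phi>0"
    using lebesgue_integral_representative(1)[OF _ \<phi>0 \<phi>\<phi>] \<phi>m by auto
  have Feq: "fourier \<phi> = FT \<phi>0" by (rule fourier_eq_FT[OF \<phi>m \<phi>0 \<phi>\<phi>])
  have d1: "\<delta> < 1" using assms(10) by simp
  obtain f0 D where f0: "integrable lborel f0" and ff: "AE x in lborel. f x = f0 x" and "D \<ge> 0"
    and fD: "\<And>\<xi>. cmod (FT f0 \<xi>) * \<bar>\<xi>\<bar> ^ (N + 1) \<le> D"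
    and fr: "\<And>r. r \<le> N \<Longrightarrow> integrable lborel (\<lambda>\<xi>. cmod (FT f0 \<xi>) * \<bar>\<xi>\<bar> ^ r)"
    using sobolev_FT[OF assms(16,17,18)] by blast
  have [measurable]: "f0 \<in> borel_measurable borel" using f0 by auto
  have Ff: "integrable lborel (FT f0)"
  proof -
    have "integrable lborel (\<lambda>\<xi>. cmod (FT f0 \<xi>) * \<bar>\<xi>\<bar> ^ 0)" by (rule fr) simp
    then have "integrable lborel (\<lambda>\<xi>. cmod (FT f0 \<xi>))" by simp
    then show ?thesis by (rule integrable_norm_cancel) simp
  qed
  obtain K0 where K0: "K0 \<ge> 0"
    "\<And>\<xi>. \<bar>\<xi>\<bar> < \<delta> \<Longrightarrow> cmod (1 - FT \<phi>0 \<xi> * fourier_distr (phi_tilde h N) \<xi>) \<le> K0 * \<bar>\<xi>\<bar> ^ n"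
    using one_minus_bound[OF assms(11,8,9,14)] unfolding Feq by blast
  obtain K1 where K1: "\<And>\<xi>. \<bar>\<xi>\<bar> < \<delta> \<Longrightarrow>
      (\<Sum>\<^sub>\<infinity>l\<in>UNIV - {0::int}. ennreal (cmod (nderiv n (fourier \<phi>) (\<xi> + of_int l)))) \<le> ennreal K1"
    using assms(13) by blast
  \<comment> \<open>The constant K1 of the hypothesis may be negative, which \<open>ennreal\<close>
    reads as 0; hence the maximum.\<close>
  have b1: "(\<Sum>l\<in>L. cmod (FT \<phi>0 (\<xi> + of_int l))) \<le> max 0 K1 * \<bar>\<xi>\<bar> ^ n"
    if "\<bar>\<xi>\<bar> < \<delta>" "finite L" "0 \<notin> L" for \<xi> L
    unfolding Feq[symmetric]
  proof (rule translates_sum_bound[OF assms(12) _ _ that(2,3) _ that(1)])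
    show "nderiv \<beta> (fourier \<phi>) (of_int l) = 0" if "l \<noteq> 0" "\<beta> < n" for l :: int and \<beta>
      using assms(15) that by (simp add: strang_fix_def)
    show "(\<Sum>\<^sub>\<infinity>l\<in>UNIV - {0::int}. ennreal (cmod (nderiv n (fourier \<phi>) (\<xi> + of_int l)))) \<le> ennreal (max 0 K1)"
      if "\<bar>\<xi>\<bar> < \<delta>" for \<xi>
      by (rule order_trans[OF K1[OF that]]) (simp add: ennreal_leI)
  qed simp_all
  obtain C where "C \<ge> 0" and C:
    "\<And>G D. integrable lborel G \<Longrightarrow> (\<And>\<xi>. cmod (G \<xi>) * \<bar>\<xi>\<bar> ^ (N + 1) \<le> D) \<Longrightarrow>
      \<exists>E d. E \<in> borel_measurable borel \<and>
        (AE x in lborel. (LINT \<xi>|lborel. G \<xi> * ee (x * \<xi>)) - (\<Sum>m. (LINT \<xi>|lborel. G \<xi> * av_mult h \<xi> * ee (- (zz m * \<xi>))) * \<phi>0 (x + zz m))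
           = E x - (\<Sum>m. d m * \<phi>0 (x + zz m))) \<and>
        (\<forall>x. ennreal (cmod (E x)) \<le> ennreal C * (\<integral>\<^sup>+\<xi>. ennreal (cmod (G \<xi>) * low_weight \<delta> n \<xi>) \<partial>lborel)) \<and>
        (\<integral>\<^sup>+x. ennreal ((cmod (E x))\<^sup>2) \<partial>lborel) \<le> ennreal C * (\<integral>\<^sup>+\<xi>. ennreal ((cmod (G \<xi>) * low_weight \<delta> n \<xi>)\<^sup>2) \<partial>lborel) \<and>
        (\<Sum>m. ennreal ((cmod (d m))\<^sup>2)) \<le> ennreal (C * D\<^sup>2)"
  proof (rule quasi_projection_error[OF i\<phi> assms(3,9,10), of N K0 n "max 0 K1"], goal_cases)
    case (1 \<xi>)
    show ?case by (rule K0(2)) (fact 1)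
  next
    case (2 \<xi> L)
    show ?case by (rule b1) (fact 2)+
  next
    case 3
    show ?case by (rule K0(1))
  next
    case 4
    show ?case by simp
  next
    case (5 C)
    show ?case by (rule that) (fact 5)+
  qed
  define r where "r = min n N"
  define \<sigma> where "\<sigma> = (if n \<le> N then 1 else 0 :: real)"
  obtain A where "A \<ge> 0" and A: "\<And>\<mu>::real. \<bar>\<mu>\<bar> \<ge> 1 \<Longrightarrow>
      integrable lborel (\<lambda>\<xi>. of_real \<bar>\<mu>\<bar> * FT f0 (\<mu> * \<xi>)) \<and>
      (\<forall>\<xi>. cmod (of_real \<bar>\<mu>\<bar> * FT f0 (\<mu> * \<xi>)) * \<bar>\<xi>\<bar> ^ (N + 1) \<le> D * \<bar>\<mu>\<bar> powr (- real N)) \<and>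
      (\<integral>\<^sup>+\<xi>. ennreal (cmod (of_real \<bar>\<mu>\<bar> * FT f0 (\<mu> * \<xi>)) * low_weight \<delta> n \<xi>) \<partial>lborel) \<le> ennreal (A * \<bar>\<mu>\<bar> powr (- real r)) \<and>
      (\<integral>\<^sup>+\<xi>. ennreal ((cmod (of_real \<bar>\<mu>\<bar> * FT f0 (\<mu> * \<xi>)) * low_weight \<delta> n \<xi>)\<^sup>2) \<partial>lborel) \<le> ennreal (A * \<bar>\<mu>\<bar> powr (\<sigma> - 2 * real r))"
    unfolding r_def \<sigma>_def
  proof (rule scaled_estimates[of "FT f0" "LINT x|lborel. cmod (f0 x)" N D \<delta> n], goal_cases)
    case 1
    show ?case by measurable
  next
    case 2
    show ?case by (rule norm_FT_le[OF f0])
  next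
    case 3
    show ?case by (rule fD)
  next
    case (4 r)
    show ?case by (rule fr) (fact 4)
  next
    case 5
    show ?case by (rule assms(9))
  next
    case 6
    show ?case by (rule d1)
  next
    case (7 A)
    note A = this[folded r_def \<sigma>_def]
    show ?case by (rule that) (fact A)+
  qed
  \<comment> \<open>This writes the bound on the square sum of the coefficients as a square, as
    \<open>series_lp_bound\<close> expects.\<close>
  define S where "S = sqrt C * D"
  have S: "S \<ge> 0" "S\<^sup>2 = C * D\<^sup>2" using \<open>C \<ge> 0\<close> \<open>D \<ge> 0\<close> by (simp_all add: S_def power_mult_distrib)
  define X where "X = C * A"
  have X: "X \<ge> 0" using \<open>C \<ge> 0\<close> \<open>A \<ge> 0\<close> by (simp add: X_def)
  have psfin: "AE x in lborel. psum \<phi>0 x < \<infinity>"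
    using fold_complex(1)[OF i\<phi>] by eventually_elim (simp add: psum_def ennreal_suminf_neq_top less_top[symmetric])
  have M0: "M \<noteq> 0" using assms(4) by auto
  \<comment> \<open>The whole argument for a fixed j, before any p-norm is taken. X and S do not
    depend on j, which enters only through powers of a.\<close>
  have key: "\<exists>E d. E \<in> borel_measurable borel \<and>
      (AE x in lborel. (\<lambda>k. expansion_term M h \<phi> f j k x) summable_on UNIV) \<and>
      (AE x in lborel. f x - of_real (real_of_int \<bar>M\<bar> powr (- (real j / 2))) * (\<Sum>\<^sub>\<infinity>k. expansion_term M h \<phi> f j k x)
         = E (of_int M ^ j * x) - (\<Sum>m. d m * \<phi>0 (of_int M ^ j * x + zz m))) \<and>
      (\<forall>x. cmod (E x) \<le> X * a powr (- real r)) \<and>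
      (\<integral>\<^sup>+x. ennreal ((cmod (E x))\<^sup>2) \<partial>lborel) \<le> ennreal (X * a powr (\<sigma> - 2 * real r)) \<and>
      (\<Sum>m. ennreal ((cmod (d m))\<^sup>2)) \<le> ennreal ((S * a powr (- real N))\<^sup>2)"
    if aj: "a = real_of_int \<bar>M\<bar> ^ j" for j a
  proof -
    define \<mu> where "\<mu> = real_of_int M ^ j"
    have \<mu>a: "\<bar>\<mu>\<bar> = a" by (simp add: \<mu>_def aj power_abs)
    have a1: "a \<ge> 1" using assms(4) by (simp add: aj one_le_power)
    then have \<mu>0: "\<mu> \<noteq> 0" using \<mu>a by auto
    define G where "G \<xi> = of_real a * FT f0 (\<mu> * \<xi>)" for \<xi>
    have AG: "integrable lborel G" "\<And>\<xi>. cmod (G \<xi>) * \<bar>\<xi>\<bar> ^ (N + 1) \<le> D * a powr (- real N)"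
      "(\<integral>\<^sup>+\<xi>. ennreal (cmod (G \<xi>) * low_weight \<delta> n \<xi>) \<partial>lborel) \<le> ennreal (A * a powr (- real r))"
      "(\<integral>\<^sup>+\<xi>. ennreal ((cmod (G \<xi>) * low_weight \<delta> n \<xi>)\<^sup>2) \<partial>lborel) \<le> ennreal (A * a powr (\<sigma> - 2 * real r))"
      using A[of \<mu>] a1 unfolding \<mu>a G_def by blast+
    define c where "c k = average M j h f (- (of_int k / of_int M ^ j))" for k :: int
    have c: "(LINT \<xi>|lborel. G \<xi> * av_mult h \<xi> * ee (- (zz m * \<xi>))) = c (int_decode m)" for m
      unfolding c_def zz_def G_def \<mu>a[symmetric] unfolding \<mu>_def
      by (rule average_eq_FT[OF f0 ff Ff assms(3) M0, symmetric])
    obtain E d where E [measurable]: "E \<in> borel_measurable borel"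
      and dec: "AE x in lborel. (LINT \<xi>|lborel. G \<xi> * ee (x * \<xi>)) - (\<Sum>m. c (int_decode m) * \<phi>0 (x + zz m))
           = E x - (\<Sum>m. d m * \<phi>0 (x + zz m))"
      and E1: "\<And>x. ennreal (cmod (E x)) \<le> ennreal C * (\<integral>\<^sup>+\<xi>. ennreal (cmod (G \<xi>) * low_weight \<delta> n \<xi>) \<partial>lborel)"
      and E2: "(\<integral>\<^sup>+x. ennreal ((cmod (E x))\<^sup>2) \<partial>lborel) \<le> ennreal C * (\<integral>\<^sup>+\<xi>. ennreal ((cmod (G \<xi>) * low_weight \<delta> n \<xi>)\<^sup>2) \<partial>lborel)"
      and d: "(\<Sum>m. ennreal ((cmod (d m))\<^sup>2)) \<le> ennreal (C * (D * a powr (- real N))\<^sup>2)"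
      using C[OF AG(1,2)] unfolding c by blast
    have E1': "cmod (E x) \<le> X * a powr (- real r)" for x
    proof -
      have "ennreal (cmod (E x)) \<le> ennreal C * ennreal (A * a powr (- real r))"
        by (rule order_trans[OF E1]) (intro mult_left_mono AG(3), simp)
      also have "\<dots> = ennreal (X * a powr (- real r))"
        using \<open>C \<ge> 0\<close> \<open>A \<ge> 0\<close> by (simp add: X_def mult.assoc flip: ennreal_mult)
      finally show ?thesis using X by simp
    qed
    have E2': "(\<integral>\<^sup>+x. ennreal ((cmod (E x))\<^sup>2) \<partial>lborel) \<le> ennreal (X * a powr (\<sigma> - 2 * real r))"
    proof -
      have "(\<integral>\<^sup>+x. ennreal ((cmod (E x))\<^sup>2) \<partial>lborel) \<le> ennreal C * ennreal (A * a powr (\<sigma> - 2 * real r))"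
        by (rule order_trans[OF E2]) (intro mult_left_mono AG(4), simp)
      also have "\<dots> = ennreal (X * a powr (\<sigma> - 2 * real r))"
        using \<open>C \<ge> 0\<close> \<open>A \<ge> 0\<close> by (simp add: X_def mult.assoc flip: ennreal_mult)
      finally show ?thesis .
    qed
    have d': "(\<Sum>m. ennreal ((cmod (d m))\<^sup>2)) \<le> ennreal ((S * a powr (- real N))\<^sup>2)"
      using d by (simp add: power_mult_distrib S(2) mult.assoc)
    have Gx: "(LINT \<xi>|lborel. G \<xi> * ee ((\<mu> * x) * \<xi>)) = (LINT \<xi>|lborel. FT f0 \<xi> * ee (x * \<xi>))" for x
    proof -
      have "(LINT \<xi>|lborel. FT f0 \<xi> * ee (x * \<xi>)) = a *\<^sub>R (LINT \<xi>|lborel. FT f0 (0 + \<mu> * \<xi>) * ee (x * (0 + \<mu> * \<xi>)))"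
        unfolding \<mu>a[symmetric] by (rule lborel_integral_real_affine[OF \<mu>0])
      also have "\<dots> = (LINT \<xi>|lborel. G \<xi> * ee ((\<mu> * x) * \<xi>))"
        unfolding scaleR_conv_of_real integral_mult_right_zero[symmetric] G_def
        by (intro Bochner_Integration.integral_cong refl) (simp add: mult_ac)
      finally show ?thesis ..
    qed
    have cb: "\<exists>b. \<forall>k. cmod (c k) \<le> b"
    proof -
      have iGa: "integrable lborel (\<lambda>\<xi>. G \<xi> * av_mult h \<xi>)"
        by (rule integrable_mult_bounded[OF AG(1) _ av_mult_le_1[OF assms(3)]]) measurable
      have "cmod (c k) \<le> (LINT \<xi>|lborel. cmod (G \<xi> * av_mult h \<xi>))" for k
        using norm_FT_le[OF iGa, of "of_int k"] c[of "int_encode k"] by (simp add: FT_def zz_def mult.commute)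
      then show ?thesis by blast
    qed
    then obtain b where b: "\<And>k. cmod (c k) \<le> b" by blast
    \<comment> \<open>The outer normalisation of the expansion cancels the one inside
      \<open>dilated_shift\<close>.\<close>
    have factor: "complex_of_real (real_of_int \<bar>M\<bar> powr (- (real j / 2))) * of_real (real_of_int \<bar>M\<bar> powr (real j / 2)) = 1"
      using M0 by (simp add: powr_add[symmetric] flip: of_real_mult)
    have et: "expansion_term M h \<phi> f j k x = of_real (real_of_int \<bar>M\<bar> powr (real j / 2)) * (c k * \<phi> (\<mu> * x + of_int k))" for k x
      by (simp add: expansion_term_def dilated_shift_def c_def \<mu>_def)
    \<comment> \<open>The exceptional sets belong to scale one and are pulled back along the
      dilation by \<mu>.\<close>
    have good: "AE x in lborel. (\<forall>m. \<phi> (0 + \<mu> * x + zz m) = \<phi>0 (0 + \<mu> * x + zz m)) \<and>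
        summable (\<lambda>m. cmod (\<phi>0 (0 + \<mu> * x + zz m))) \<and>
        (LINT \<xi>|lborel. G \<xi> * ee ((0 + \<mu> * x) * \<xi>)) - (\<Sum>m. c (int_decode m) * \<phi>0 (0 + \<mu> * x + zz m))
           = E (0 + \<mu> * x) - (\<Sum>m. d m * \<phi>0 (0 + \<mu> * x + zz m))"
      by (rule AE_lborel_affine[OF _ \<mu>0, where t = 0])
        (use psum_AE_cong[OF \<phi>\<phi>] fold_complex(1)[OF i\<phi>] dec in eventually_elim, blast)
    have hs: "((\<lambda>k. expansion_term M h \<phi> f j k x) has_sum
        of_real (real_of_int \<bar>M\<bar> powr (real j / 2)) * (\<Sum>m. c (int_decode m) * \<phi>0 (\<mu> * x + zz m))) UNIV"
      if eq: "\<forall>m. \<phi> (\<mu> * x + zz m) = \<phi>0 (\<mu> * x + zz m)" and sm: "summable (\<lambda>m. cmod (\<phi>0 (\<mu> * x + zz m)))" for x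
    proof -
      have eq': "\<phi> (\<mu> * x + of_int (int_decode m)) = \<phi>0 (\<mu> * x + zz m)" for m
        using eq[rule_format, of m] by (simp add: zz_def)
      have "summable (\<lambda>m. cmod (c (int_decode m) * \<phi> (\<mu> * x + of_int (int_decode m))))"
      proof (rule summable_comparison_test'[OF summable_mult[OF sm, of b]])
        fix m :: nat assume "0 \<le> m"
        show "norm (cmod (c (int_decode m) * \<phi> (\<mu> * x + of_int (int_decode m)))) \<le> b * cmod (\<phi>0 (\<mu> * x + zz m))"
          unfolding eq' norm_mult real_norm_def abs_mult abs_norm_cancel by (intro mult_right_mono b) simp
      qed
      from has_sum_cmult_right[OF has_sum_int_decode[OF this], of "of_real (real_of_int \<bar>M\<bar> powr (real j / 2))"]
      show ?thesis unfolding et eq' .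
    qed
    have sumae: "AE x in lborel. (\<lambda>k. expansion_term M h \<phi> f j k x) summable_on UNIV"
      using good
    proof eventually_elim
      case (elim x)
      then show ?case using hs[of x] by (auto simp: summable_on_def)
    qed
    have errae: "AE x in lborel. f x - of_real (real_of_int \<bar>M\<bar> powr (- (real j / 2))) * (\<Sum>\<^sub>\<infinity>k. expansion_term M h \<phi> f j k x)
         = E (\<mu> * x) - (\<Sum>m. d m * \<phi>0 (\<mu> * x + zz m))"
      using good ff FT_inversion[OF f0 Ff]
    proof eventually_elim
      case (elim x)
      have "(\<Sum>\<^sub>\<infinity>k. expansion_term M h \<phi> f j k x) = of_real (real_of_int \<bar>M\<bar> powr (real j / 2)) * (\<Sum>m. c (int_decode m) * \<phi>0 (\<mu> * x + zz m))"
        using hs[of x] elim(1) by (intro infsumI) auto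
      then have "of_real (real_of_int \<bar>M\<bar> powr (- (real j / 2))) * (\<Sum>\<^sub>\<infinity>k. expansion_term M h \<phi> f j k x) = (\<Sum>m. c (int_decode m) * \<phi>0 (\<mu> * x + zz m))"
        using factor by (simp only: mult.assoc[symmetric] mult_1_left)
      then show ?case using elim by (simp add: Gx)
    qed
    show ?thesis
      using E sumae errae E1' E2' d' unfolding \<mu>_def by blast
  qed
  define pR where "pR = enn2real (1 / p)"
  define rate where "rate = (if real n > real N + pR then real N + pR else real n)"
  have "\<exists>Cf\<ge>0. \<forall>j. (AE x in lborel. (\<lambda>k. expansion_term M h \<phi> f j k x) summable_on UNIV) \<and>
    lp_norm lebesgue p
      (\<lambda>x. ennreal (cmod (f x - of_real (real_of_int \<bar>M\<bar> powr (- (real j / 2))) * (\<Sum>\<^sub>\<infinity>k. expansion_term M h \<phi> f j k x))))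
    \<le> ennreal (Cf * (real_of_int \<bar>M\<bar> ^ j) powr (- rate))"
  proof (cases "p = \<infinity>")
    case True
    then have pR0: "pR = 0" by (simp add: pR_def)
    \<comment> \<open>With 1/p = 0 both cases of the rate reduce to the minimum of n and N.\<close>
    have rr: "rate = real r" by (auto simp: rate_def pR0 r_def)
    obtain b where "b \<ge> 0" and b: "AE x in lborel. psum \<phi>0 x \<le> ennreal b"
      using periodized_bounded[OF _ \<phi>\<phi> \<phi>0] assms(5) True by blast
    show ?thesis
    proof (intro exI[of _ "X + S * b"] conjI allI)
      show "0 \<le> X + S * b" using X S \<open>b \<ge> 0\<close> by simp
      fix j
      define a where "a = real_of_int \<bar>M\<bar> ^ j"
      have a1: "a \<ge> 1" using assms(4) by (simp add: a_def one_le_power)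
      have \<mu>0: "real_of_int M ^ j \<noteq> 0" using M0 by simp
      obtain E d where E [measurable]: "E \<in> borel_measurable borel"
        and sumae: "AE x in lborel. (\<lambda>k. expansion_term M h \<phi> f j k x) summable_on UNIV"
        and err: "AE x in lborel. f x - of_real (real_of_int \<bar>M\<bar> powr (- (real j / 2))) * (\<Sum>\<^sub>\<infinity>k. expansion_term M h \<phi> f j k x)
           = E (of_int M ^ j * x) - (\<Sum>m. d m * \<phi>0 (of_int M ^ j * x + zz m))"
        and E1: "\<And>x. cmod (E x) \<le> X * a powr (- real r)"
        and d: "(\<Sum>m. ennreal ((cmod (d m))\<^sup>2)) \<le> ennreal ((S * a powr (- real N))\<^sup>2)"
        using key[OF a_def] by blast
      show "AE x in lborel. (\<lambda>k. expansion_term M h \<phi> f j k x) summable_on UNIV" by (rule sumae)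
      have S0: "0 \<le> S * a powr (- real N)" using S by simp
      have bound: "AE x in lborel. cmod (E x - (\<Sum>m. d m * \<phi>0 (x + zz m))) \<le> (X + S * b) * a powr (- real r)"
        using b psfin
      proof eventually_elim
        case (elim x)
        have "enn2real (psum \<phi>0 x) \<le> b" using elim(1) \<open>b \<ge> 0\<close> by (rule enn2real_leI[rotated])
        have "cmod (\<Sum>m. d m * \<phi>0 (x + zz m)) \<le> (S * a powr (- real N)) * enn2real (psum \<phi>0 x)"
          by (rule series_sup_bound[OF coeff_le_of_square_sum[OF d S0] elim(2) S0])
        also have "\<dots> \<le> (S * a powr (- real r)) * b"
          using \<open>enn2real (psum \<phi>0 x) \<le> b\<close> S a1 \<open>b \<ge> 0\<close>
          by (intro mult_mono mult_left_mono powr_mono) (auto simp: r_def)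
        finally have "cmod (\<Sum>m. d m * \<phi>0 (x + zz m)) \<le> S * b * a powr (- real r)" by (simp only: mult_ac)
        then show ?case
          using norm_triangle_ineq4[of "E x" "\<Sum>m. d m * \<phi>0 (x + zz m)"] E1[of x] unfolding distrib_right by linarith
      qed
      have Bd: "AE x in lborel. cmod (E (0 + of_int M ^ j * x) - (\<Sum>m. d m * \<phi>0 (0 + of_int M ^ j * x + zz m))) \<le> (X + S * b) * a powr (- real r)"
        by (rule AE_lborel_affine[OF bound \<mu>0])
      show "lp_norm lebesgue p
        (\<lambda>x. ennreal (cmod (f x - of_real (real_of_int \<bar>M\<bar> powr (- (real j / 2))) * (\<Sum>\<^sub>\<infinity>k. expansion_term M h \<phi> f j k x))))
        \<le> ennreal ((X + S * b) * (real_of_int \<bar>M\<bar> ^ j) powr (- rate))"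
        unfolding True rr a_def[symmetric]
      proof (rule lp_norm_le_infinite[OF err])
        show "(\<lambda>x. E (of_int M ^ j * x) - (\<Sum>m. d m * \<phi>0 (of_int M ^ j * x + zz m))) \<in> borel_measurable borel"
          by measurable
      qed (use Bd in simp)
    qed
  next
    case False
    define P where "P = enn2real p"
    have pP: "p = ennreal P" using False by (simp add: P_def less_top)
    have P2: "P \<ge> 2"
    proof -
      have "ennreal 2 \<le> ennreal P" using assms(1) by (simp add: pP)
      then show ?thesis by (subst (asm) ennreal_le_iff2) auto
    qed
    have pR: "pR = 1 / P"
    proof -
      have "1 / p = ennreal 1 / ennreal P" by (simp add: pP)
      also have "\<dots> = ennreal (1 / P)" using P2 by (intro divide_ennreal) auto
      finally show ?thesis using P2 by (simp add: pR_def)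
    qed
    define \<Psi> where "\<Psi> = enn2real (\<integral>\<^sup>+x. ennreal (enn2real (psum \<phi>0 x) powr P) * indicator UI x \<partial>lborel)"
    have \<Psi>: "(\<integral>\<^sup>+x. ennreal (enn2real (psum \<phi>0 x) powr P) * indicator UI x \<partial>lborel) = ennreal \<Psi>" "\<Psi> \<ge> 0"
      using periodized_finite[OF assms(5) \<phi>\<phi> False] by (simp_all add: \<Psi>_def P_def)
    define Y0 where "Y0 = 2 powr P * (X powr (P - 2) * X + S powr P * \<Psi>)"
    have Y0: "Y0 \<ge> 0" using X \<Psi>(2) by (simp add: Y0_def)
    \<comment> \<open>\<open>\<sigma> - r * P\<close> is the exponent of the P-th power integral at
      scale one; the dilation by \<open>M ^ j\<close> contributes -1.\<close>
    define s where "s = \<sigma> - real r * P - 1"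
    \<comment> \<open>For n \<le> N the 1 in \<sigma> cancels the contribution of the dilation and n
      remains; otherwise \<open>(N * P + 1) / P = N + 1 / P\<close> remains. As 0 < 1/P < 1, the
      condition n > N + 1/P means n > N for integers.\<close>
    have rs: "s * (1 / P) = - rate"
    proof (cases "n \<le> N")
      case True
      then have "\<not> real n > real N + pR" using P2 by (simp add: pR add_increasing2 not_less)
      then have "rate = real n" by (simp add: rate_def)
      then show ?thesis using True P2 by (simp add: s_def \<sigma>_def r_def field_simps)
    next
      case nN: False
      then have "real N + 1 \<le> real n" by linarith
      moreover have "pR < 1" using P2 by (simp add: pR)
      ultimately have "rate = real N + 1 / P" by (simp add: rate_def pR)
      then show ?thesis using nN P2 by (simp add: s_def \<sigma>_def r_def field_simps)
    qed
    show ?thesis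
    proof (intro exI[of _ "Y0 powr (1 / P)"] conjI allI)
      show "0 \<le> Y0 powr (1 / P)" by simp
      fix j
      define a where "a = real_of_int \<bar>M\<bar> ^ j"
      have a1: "a \<ge> 1" using assms(4) by (simp add: a_def one_le_power)
      have \<mu>0: "real_of_int M ^ j \<noteq> 0" using M0 by simp
      have \<mu>a: "\<bar>real_of_int M ^ j\<bar> = a" by (simp add: a_def power_abs)
      obtain E d where E [measurable]: "E \<in> borel_measurable borel"
        and sumae: "AE x in lborel. (\<lambda>k. expansion_term M h \<phi> f j k x) summable_on UNIV"
        and err: "AE x in lborel. f x - of_real (real_of_int \<bar>M\<bar> powr (- (real j / 2))) * (\<Sum>\<^sub>\<infinity>k. expansion_term M h \<phi> f j k x)
           = E (of_int M ^ j * x) - (\<Sum>m. d m * \<phi>0 (of_int M ^ j * x + zz m))"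
        and E1: "\<And>x. cmod (E x) \<le> X * a powr (- real r)"
        and E2: "(\<integral>\<^sup>+x. ennreal ((cmod (E x))\<^sup>2) \<partial>lborel) \<le> ennreal (X * a powr (\<sigma> - 2 * real r))"
        and d: "(\<Sum>m. ennreal ((cmod (d m))\<^sup>2)) \<le> ennreal ((S * a powr (- real N))\<^sup>2)"
        using key[OF a_def] by blast
      show "AE x in lborel. (\<lambda>k. expansion_term M h \<phi> f j k x) summable_on UNIV" by (rule sumae)
      have S0: "0 \<le> S * a powr (- real N)" using S by simp
      define T where "T x = (\<Sum>m. d m * \<phi>0 (x + zz m))" for x
      have [measurable]: "T \<in> borel_measurable borel" unfolding T_def[abs_def] by measurable
      define \<kappa> where "\<kappa> = a powr (\<sigma> - real r * P)"
      have IE: "(\<integral>\<^sup>+x. ennreal (cmod (E x) powr P) \<partial>lborel) \<le> ennreal (X powr (P - 2) * X * \<kappa>)"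
      proof -
        have "(\<integral>\<^sup>+x. ennreal (cmod (E x) powr P) \<partial>lborel) \<le> ennreal ((X * a powr (- real r)) powr (P - 2)) * ennreal (X * a powr (\<sigma> - 2 * real r))"
          by (rule order_trans[OF bounded_lp_bound[OF E E1 P2]]) (intro mult_left_mono E2, simp)
        also have "\<dots> = ennreal ((X * a powr (- real r)) powr (P - 2) * (X * a powr (\<sigma> - 2 * real r)))"
          using X by (intro ennreal_mult[symmetric]) auto
        also have "(X * a powr (- real r)) powr (P - 2) * (X * a powr (\<sigma> - 2 * real r)) = X powr (P - 2) * X * (a powr (- real r * (P - 2)) * a powr (\<sigma> - 2 * real r))"
          by (simp only: powr_mult powr_powr mult_ac)
        \<comment> \<open>The interpolated exponent:
          \<open>- r * (P - 2) + (\<sigma> - 2 * r) = \<sigma> - r * P\<close>.\<close>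
        also have "a powr (- real r * (P - 2)) * a powr (\<sigma> - 2 * real r) = \<kappa>"
          unfolding \<kappa>_def powr_add[symmetric] by (simp add: algebra_simps)
        finally show ?thesis .
      qed
      have IT: "(\<integral>\<^sup>+x. ennreal (cmod (T x) powr P) \<partial>lborel) \<le> ennreal (S powr P * \<Psi> * \<kappa>)"
      proof -
        have "(\<integral>\<^sup>+x. ennreal (cmod (T x) powr P) \<partial>lborel) \<le> ennreal ((S * a powr (- real N)) powr P) * ennreal \<Psi>"
          unfolding T_def \<Psi>(1)[symmetric] by (rule series_lp_bound[OF \<phi>0 psfin d S0 P2])
        also have "\<dots> = ennreal ((S * a powr (- real N)) powr P * \<Psi>)"
          using \<Psi>(2) by (intro ennreal_mult[symmetric]) auto
        also have "\<dots> \<le> ennreal (S powr P * \<Psi> * \<kappa>)"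
        proof (rule ennreal_leI)
          \<comment> \<open>The coefficient part decays at least as fast as the bound for E, because
            r \<le> N, \<sigma> \<ge> 0 and a \<ge> 1.\<close>
          have "a powr (- real N * P) \<le> \<kappa>"
            unfolding \<kappa>_def
          proof (rule powr_mono)
            have "real r * P \<le> real N * P" using P2 by (intro mult_right_mono) (auto simp: r_def)
            moreover have "\<sigma> \<ge> 0" by (simp add: \<sigma>_def)
            ultimately show "- real N * P \<le> \<sigma> - real r * P" by linarith
          qed (rule a1)
          then have "(S powr P * \<Psi>) * a powr (- real N * P) \<le> (S powr P * \<Psi>) * \<kappa>"
            using \<Psi>(2) by (intro mult_left_mono) auto
          then show "(S * a powr (- real N)) powr P * \<Psi> \<le> S powr P * \<Psi> * \<kappa>"
            by (simp only: powr_mult powr_powr mult_ac)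
        qed
        finally show ?thesis .
      qed
      define g where "g x = E x - T x" for x
      have [measurable]: "g \<in> borel_measurable borel" unfolding g_def[abs_def] by measurable
      have Ig: "(\<integral>\<^sup>+x. ennreal (cmod (g x) powr P) \<partial>lborel) \<le> ennreal (Y0 * \<kappa>)"
      proof -
        have "(\<integral>\<^sup>+x. ennreal (cmod (g x) powr P) \<partial>lborel) \<le> (\<integral>\<^sup>+x. ennreal (2 powr P) * (ennreal (cmod (E x) powr P) + ennreal (cmod (T x) powr P)) \<partial>lborel)"
        proof (rule nn_integral_mono)
          fix x
          have "ennreal (cmod (g x) powr P) \<le> ennreal (2 powr P * (cmod (E x) powr P + cmod (T x) powr P))"
            unfolding g_def by (intro ennreal_leI powr_diff_le P2)
          then show "ennreal (cmod (g x) powr P) \<le> ennreal (2 powr P) * (ennreal (cmod (E x) powr P) + ennreal (cmod (T x) powr P))"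
            by (simp add: ennreal_mult)
        qed
        also have "\<dots> = ennreal (2 powr P) * ((\<integral>\<^sup>+x. ennreal (cmod (E x) powr P) \<partial>lborel) + (\<integral>\<^sup>+x. ennreal (cmod (T x) powr P) \<partial>lborel))"
          by (subst nn_integral_cmult, simp, subst nn_integral_add) simp_all
        also have "\<dots> \<le> ennreal (2 powr P) * (ennreal (X powr (P - 2) * X * \<kappa>) + ennreal (S powr P * \<Psi> * \<kappa>))"
          by (intro mult_left_mono add_mono IE IT) simp
        also have "\<dots> = ennreal (2 powr P * (X powr (P - 2) * X * \<kappa> + S powr P * \<Psi> * \<kappa>))"
          using X \<Psi>(2) by (simp add: ennreal_mult \<kappa>_def)
        also have "2 powr P * (X powr (P - 2) * X * \<kappa> + S powr P * \<Psi> * \<kappa>) = Y0 * \<kappa>"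
          by (simp add: Y0_def algebra_simps)
        finally show ?thesis .
      qed
      \<comment> \<open>Returning from scale one to the original variable divides the integral by
        a.\<close>
      have Is: "(\<integral>\<^sup>+x. ennreal (cmod (g (of_int M ^ j * x)) powr P) \<partial>lborel) \<le> ennreal (Y0 * a powr s)"
      proof -
        have "(\<integral>\<^sup>+x. ennreal (cmod (g x) powr P) \<partial>lborel) = ennreal a * (\<integral>\<^sup>+x. ennreal (cmod (g (0 + of_int M ^ j * x)) powr P) \<partial>lborel)"
          unfolding \<mu>a[symmetric] by (rule nn_integral_real_affine[OF _ \<mu>0]) measurable
        with Ig have "ennreal a * (\<integral>\<^sup>+x. ennreal (cmod (g (of_int M ^ j * x)) powr P) \<partial>lborel) \<le> ennreal (Y0 * \<kappa>)" by simp
        then have "ennreal (1 / a) * (ennreal a * (\<integral>\<^sup>+x. ennreal (cmod (g (of_int M ^ j * x)) powr P) \<partial>lborel)) \<le> ennreal (1 / a) * ennreal (Y0 * \<kappa>)"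
          by (intro mult_left_mono) auto
        moreover have "ennreal (1 / a) * ennreal a = 1" using a1 by (simp flip: ennreal_mult)
        moreover have "ennreal (1 / a) * ennreal (Y0 * \<kappa>) = ennreal (Y0 * a powr s)"
          using a1 Y0 by (simp add: \<kappa>_def s_def powr_diff flip: ennreal_mult)
        ultimately show ?thesis by (simp only: mult.assoc[symmetric] mult_1_left)
      qed
      have "AE x in lborel. f x - of_real (real_of_int \<bar>M\<bar> powr (- (real j / 2))) * (\<Sum>\<^sub>\<infinity>k. expansion_term M h \<phi> f j k x) = g (of_int M ^ j * x)"
        using err by (simp add: g_def T_def)
      from lp_norm_le_finite[OF False this _ Is[unfolded P_def]] Y0
      have "lp_norm lebesgue p
        (\<lambda>x. ennreal (cmod (f x - of_real (real_of_int \<bar>M\<bar> powr (- (real j / 2))) * (\<Sum>\<^sub>\<infinity>k. expansion_term M h \<phi> f j k x))))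
        \<le> ennreal ((Y0 * a powr s) powr (1 / P))" by (simp add: P_def)
      also have "(Y0 * a powr s) powr (1 / P) = Y0 powr (1 / P) * a powr (- rate)"
        by (simp only: powr_mult powr_powr rs)
      finally show "lp_norm lebesgue p
        (\<lambda>x. ennreal (cmod (f x - of_real (real_of_int \<bar>M\<bar> powr (- (real j / 2))) * (\<Sum>\<^sub>\<infinity>k. expansion_term M h \<phi> f j k x))))
        \<le> ennreal (Y0 powr (1 / P) * (real_of_int \<bar>M\<bar> ^ j) powr (- rate))" unfolding a_def .
    qed
  qed
  moreover have "Cf * (real_of_int \<bar>M\<bar> ^ j) powr (- rate)
      = (if real n > real N + enn2real (1 / p)
               then Cf * real_of_int \<bar>M\<bar> powr (- (real j * (real N + enn2real (1 / p))))
               else Cf * real_of_int \<bar>M\<bar> powr (- (real j * real n)))" for Cf j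
  proof -
    have "(real_of_int \<bar>M\<bar> ^ j) powr t = real_of_int \<bar>M\<bar> powr (real j * t)" for t
      using M0 by (simp add: powr_powr flip: powr_realpow)
    then show ?thesis by (simp add: rate_def pR_def)
  qed
  ultimately show ?thesis by (simp only: AE_completion_iff)
qed

end
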